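(* Let $\Omega\subset\mathbb R^N$ be a bounded Lipschitz domain, $K:L^2(\Omega)\to L^2(\Omega)$ bounded and linear, $y^\delta\in L^2(\Omega)$, and $\alpha>0$. For $s\in(0,1)$ define $\mathcal J_{\alpha,s}:L^2(\Omega)\to(-\infty,+\infty]$ by $$\mathcal J_{\alpha,s}(u)=\begin{cases}\frac12\|Ku-y^\delta\|_{L^2(\Omega)}^2+\frac\alpha2\left(\|u\|_{L^2(\Omega)}^2+\mathcal E_s(u,u)\right),&u\in H_0^s(\Omega),\\ +\infty,&u\notin H_0^s(\Omega),\end{cases}$$ and define $\mathcal J_{\alpha,1}:L^2(\Omega)\to(-\infty,+\infty]$ by $$\mathcal J_{\alpha,1}(u)=\begin{cases}\frac12\|Ku-y^\delta\|_{L^2(\Omega)}^2+\frac\alpha2\left(\|u\|_{L^2(\Omega)}^2+\|\nabla u\|_{L^2(\Omega)}^2\right),&u\in H_0^1(\Omega),\\ +\infty,&u\notin H_0^1(\Omega).\end{cases}$$ Let $u_{\alpha,s}^\delta$ be the unique minimizer of $\mathcal J_{\alpha,s}$, and let $u_{\alpha,1}^\delta$ be the unique minimizer of $\mathcal J_{\alpha,1}$. Then, as $s\to1^-$, $$u_{\alpha,s}^\delta\to u_{\alpha,1}^\delta\quad\text{strongly in }L^2(\Omega).$$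
   Context: $H_0^s(\Omega)$ is the space of functions $u\in H^s(\mathbb R^N)$ with $u=0$ a.e. in $\mathbb R^N\setminus\Omega$; functions on $\Omega$ are extended by zero to $\mathbb R^N$. The fractional energy is $$\mathcal E_s(u,u)=\frac{C_{N,s}}{2}\iint_{\mathbb R^{2N}}\frac{|u(x)-u(y)|^2}{|x-y|^{N+2s}}\,dx\,dy,$$ where the normalization constants $C_{N,s}>0$ are chosen (Bourgain--Brezis--Mironescu normalization) so that for every $u\in H_0^1(\Omega)$, $\lim_{s\to1^-}\mathcal E_s(u,u)=\int_\Omega|\nabla u|^2\,dx$; in particular $C_{N,s}\asymp1-s$ as $s\to1^-$. *)

theory Defs
  imports "HOL-Analysis.Analysis"
begin

section \<open>Lipschitz domains\<close>

text \<open>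
  The rotated coordinate system of the usual definition is encoded by the direction \<open>e\<close> of its last
  axis: \<open>x \<bullet> e\<close> is the last coordinate of \<open>x\<close> and \<open>x - (x \<bullet> e) *\<^sub>R e\<close>, a point of the hyperplane
  orthogonal to \<open>e\<close>, collects the remaining ones.
\<close>

definition lipschitz_domain :: "(real^'n) set \<Rightarrow> bool" where
  "lipschitz_domain \<Omega> \<longleftrightarrow> open \<Omega> \<and> connected \<Omega> \<and> \<Omega> \<noteq> {} \<and>
     (\<forall>p\<in>frontier \<Omega>. \<exists>r>0. \<exists>e. \<exists>\<gamma> :: real^'n \<Rightarrow> real. \<exists>L.
        norm e = 1 \<and> L-lipschitz_on {v. v \<bullet> e = 0} \<gamma> \<and>
        \<Omega> \<inter> ball p r = {x \<in> ball p r. x \<bullet> e > \<gamma> (x - (x \<bullet> e) *\<^sub>R e)})"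


section \<open>The space of square integrable functions\<close>

text \<open>
  Functions on \<open>\<Omega>\<close> are extended by zero to the whole space. Elements of \<open>L\<^sup>2(\<Omega>)\<close> are handled through
  Borel representatives, which every class of Lebesgue measurable functions has; equality in
  \<open>L\<^sup>2(\<Omega>)\<close> is equality almost everywhere.
\<close>

definition L2 :: "(real^'n) set \<Rightarrow> (real^'n \<Rightarrow> real) set" where
  "L2 \<Omega> = {u \<in> borel_measurable borel.
     integrable lborel (\<lambda>x. (u x)\<^sup>2) \<and> (AE x in lborel. x \<notin> \<Omega> \<longrightarrow> u x = 0)}"

definition L2_norm :: "(real^'n) set \<Rightarrow> (real^'n \<Rightarrow> 'b::real_normed_vector) \<Rightarrow> real" where
  "L2_norm \<Omega> u = sqrt (LINT x:\<Omega>|lborel. (norm (u x))\<^sup>2)"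

text \<open>
  Linearity and boundedness force \<open>K\<close> to respect equality almost everywhere, so \<open>K\<close> induces an
  operator on the equivalence classes.
\<close>

definition bounded_linear_L2 ::
    "(real^'n) set \<Rightarrow> ((real^'n \<Rightarrow> real) \<Rightarrow> (real^'n \<Rightarrow> real)) \<Rightarrow> bool" where
  "bounded_linear_L2 \<Omega> K \<longleftrightarrow>
     (\<forall>u\<in>L2 \<Omega>. K u \<in> L2 \<Omega>) \<and>
     (\<forall>u\<in>L2 \<Omega>. \<forall>v\<in>L2 \<Omega>. AE x in lborel. K (\<lambda>x. u x + v x) x = K u x + K v x) \<and>
     (\<forall>c. \<forall>u\<in>L2 \<Omega>. AE x in lborel. K (\<lambda>x. c * u x) x = c * K u x) \<and>
     (\<exists>B. \<forall>u\<in>L2 \<Omega>. L2_norm \<Omega> (K u) \<le> B * L2_norm \<Omega> u)"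


section \<open>First order Sobolev spaces\<close>

definition partial_deriv :: "'n \<Rightarrow> (real^'n \<Rightarrow> real) \<Rightarrow> real^'n \<Rightarrow> real" where
  "partial_deriv i f x = frechet_derivative f (at x) (axis i 1)"

primrec C_k :: "nat \<Rightarrow> (real^'n \<Rightarrow> real) \<Rightarrow> bool" where
  "C_k 0 f \<longleftrightarrow> continuous_on UNIV f"
| "C_k (Suc k) f \<longleftrightarrow> (\<forall>x. f differentiable (at x)) \<and> (\<forall>i. C_k k (partial_deriv i f))"

definition test_functions :: "(real^'n) set \<Rightarrow> (real^'n \<Rightarrow> real) set" where
  "test_functions \<Omega> = {\<phi>. (\<forall>k. C_k k \<phi>) \<and>
     compact (closure {x. \<phi> x \<noteq> 0}) \<and> closure {x. \<phi> x \<noteq> 0} \<subseteq> \<Omega>}"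

definition is_weak_gradient ::
    "(real^'n) set \<Rightarrow> (real^'n \<Rightarrow> real) \<Rightarrow> (real^'n \<Rightarrow> real^'n) \<Rightarrow> bool" where
  "is_weak_gradient \<Omega> u g \<longleftrightarrow>
     (\<forall>i. (\<lambda>x. g x $ i) \<in> L2 \<Omega>) \<and>
     (\<forall>\<phi>\<in>test_functions \<Omega>. \<forall>i.
        (LINT x:\<Omega>|lborel. u x * partial_deriv i \<phi> x) = - (LINT x:\<Omega>|lborel. g x $ i * \<phi> x))"

definition H1 :: "(real^'n) set \<Rightarrow> (real^'n \<Rightarrow> real) set" where
  "H1 \<Omega> = {u \<in> L2 \<Omega>. \<exists>g. is_weak_gradient \<Omega> u g}"

text \<open>The weak gradient is unique up to equality almost everywhere in \<open>\<Omega>\<close>.\<close>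

definition weak_gradient :: "(real^'n) set \<Rightarrow> (real^'n \<Rightarrow> real) \<Rightarrow> real^'n \<Rightarrow> real^'n" where
  "weak_gradient \<Omega> u = (SOME g. is_weak_gradient \<Omega> u g)"

definition H1_norm :: "(real^'n) set \<Rightarrow> (real^'n \<Rightarrow> real) \<Rightarrow> real" where
  "H1_norm \<Omega> u = sqrt ((L2_norm \<Omega> u)\<^sup>2 + (L2_norm \<Omega> (weak_gradient \<Omega> u))\<^sup>2)"

text \<open>The closure of the test functions in \<open>H\<^sup>1(\<Omega>)\<close>.\<close>

definition H01 :: "(real^'n) set \<Rightarrow> (real^'n \<Rightarrow> real) set" where
  "H01 \<Omega> = {u \<in> H1 \<Omega>. \<forall>\<epsilon>>0. \<exists>\<phi>\<in>test_functions \<Omega>. H1_norm \<Omega> (\<lambda>x. u x - \<phi> x) < \<epsilon>}"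


section \<open>Fractional Sobolev spaces and the fractional energy\<close>

text \<open>On the diagonal, a null set, the quotient is \<open>0\<close> by the convention for division.\<close>

definition gagliardo :: "real \<Rightarrow> (real^'n \<Rightarrow> real) \<Rightarrow> (real^'n) \<times> (real^'n) \<Rightarrow> real" where
  "gagliardo s u = (\<lambda>(x, y). \<bar>u x - u y\<bar>\<^sup>2 / norm (x - y) powr (real CARD('n) + 2 * s))"

definition Hs :: "real \<Rightarrow> (real^'n \<Rightarrow> real) set" where
  "Hs s = {u \<in> L2 UNIV. integrable (lborel \<Otimes>\<^sub>M lborel) (gagliardo s u)}"

definition H0s :: "real \<Rightarrow> (real^'n) set \<Rightarrow> (real^'n \<Rightarrow> real) set" where
  "H0s s \<Omega> = {u \<in> Hs s. AE x in lborel. x \<notin> \<Omega> \<longrightarrow> u x = 0}"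

text \<open>\<open>C\<close> maps \<open>s\<close> to the normalization constant; the dimension is that of the type.\<close>

definition energy :: "(real \<Rightarrow> real) \<Rightarrow> real \<Rightarrow> (real^'n \<Rightarrow> real) \<Rightarrow> real" where
  "energy C s u = C s / 2 * (\<integral>p. gagliardo s u p \<partial>(lborel \<Otimes>\<^sub>M lborel))"

definition BBM_normalized :: "(real^'n) set \<Rightarrow> (real \<Rightarrow> real) \<Rightarrow> bool" where
  "BBM_normalized \<Omega> C \<longleftrightarrow> (\<forall>s\<in>{0<..<1}. 0 < C s) \<and>
     (\<forall>u\<in>H01 \<Omega>. ((\<lambda>s. energy C s u) \<longlongrightarrow> (L2_norm \<Omega> (weak_gradient \<Omega> u))\<^sup>2) (at_left 1))"


section \<open>The regularized functionals\<close>

definition J_frac ::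
    "(real^'n) set \<Rightarrow> ((real^'n \<Rightarrow> real) \<Rightarrow> (real^'n \<Rightarrow> real)) \<Rightarrow> (real^'n \<Rightarrow> real) \<Rightarrow>
     (real \<Rightarrow> real) \<Rightarrow> real \<Rightarrow> real \<Rightarrow> (real^'n \<Rightarrow> real) \<Rightarrow> ereal" where
  "J_frac \<Omega> K y C \<alpha> s u =
     (if u \<in> H0s s \<Omega>
      then ereal (1/2 * (L2_norm \<Omega> (\<lambda>x. K u x - y x))\<^sup>2
                  + \<alpha>/2 * ((L2_norm \<Omega> u)\<^sup>2 + energy C s u))
      else \<infinity>)"

definition J_one ::
    "(real^'n) set \<Rightarrow> ((real^'n \<Rightarrow> real) \<Rightarrow> (real^'n \<Rightarrow> real)) \<Rightarrow> (real^'n \<Rightarrow> real) \<Rightarrow>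
     real \<Rightarrow> (real^'n \<Rightarrow> real) \<Rightarrow> ereal" where
  "J_one \<Omega> K y \<alpha> u =
     (if u \<in> H01 \<Omega>
      then ereal (1/2 * (L2_norm \<Omega> (\<lambda>x. K u x - y x))\<^sup>2
                  + \<alpha>/2 * ((L2_norm \<Omega> u)\<^sup>2 + (L2_norm \<Omega> (weak_gradient \<Omega> u))\<^sup>2))
      else \<infinity>)"

definition is_unique_minimizer ::
    "(real^'n) set \<Rightarrow> ((real^'n \<Rightarrow> real) \<Rightarrow> ereal) \<Rightarrow> (real^'n \<Rightarrow> real) \<Rightarrow> bool" where
  "is_unique_minimizer \<Omega> J u \<longleftrightarrow>
     is_arg_min J (\<lambda>v. v \<in> L2 \<Omega>) u \<and>
     (\<forall>v. is_arg_min J (\<lambda>v. v \<in> L2 \<Omega>) v \<longrightarrow> (AE x in lborel. v x = u x))"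

end

(*
  The functionals are convex, so the minimizers satisfy Euler--Lagrange equations, and no
  Gamma-convergence or compactness is needed. Subtract from u_s a test function psi that is H^1-close
  to u_1. The equation for w = u_s - psi bounds ||w||^2 + E_s(w,w) by E_s(psi,w) and terms in which u_1
  appears. Write E_s(psi,w) = E_s(phi,w) + E_s(psi - phi,w) with phi smooth on the whole space. By
  translation invariance E_s(phi,w) only involves second differences of phi, so it equals
  -<Lap phi,w> up to o(1) ||w||; the other term is absorbed by E_s(w,w) up to the energy of psi - phi.
  It remains to choose phi H^1-close to u_1 with Lap phi close, in L^2(Omega), to the functional that
  the equation for u_1 calls the Laplacian of u_1. Here the Lipschitz boundary enters: localize u_1
  with cutoffs, and translate each piece before mollifying, so that inside Omega the mollified
  piece does not see the boundary.
*)
theory Submission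
  imports Defs
begin

section \<open>Smooth functions\<close>

text \<open>Closeness to the limit minimizer in H^1 says nothing about second derivatives, so
  \<open>\<psi>\<close> cannot be paired with \<open>w\<close> through its own Laplacian; hence the
  second function \<open>\<phi>\<close>. It is paired only with functions vanishing outside \<Omega>
  and may be supported beyond \<Omega>. The zero extension of \<open>u_one\<close> has the zero
  extension of its gradient as weak gradient, but its distributional Laplacian may carry a layer on
  the boundary. Shifting each piece outwards moves this layer to where \<open>w\<close> vanishes.
  Inside \<Omega> the Laplacian is a functional built from the data term and the L^2 norm, hence
  bounded on L^2. The constants C_s are accessible only through the limits of energies on
  H_0^1(\<Omega>). They enter through one number, C_s / (2N) times the second moment of the kernel
  on the unit ball. A single test function with nonzero gradient forces this number to tend to 1,
  and that in turn gives the limit of the energy for test functions of the whole space, such as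
  \<open>\<psi> - \<phi>\<close>, of which the normalization does not speak.\<close>

lemma partial_deriv_eqI:
  assumes "(f has_derivative D) (at x)"
  shows "partial_deriv i f x = D (axis i 1)"
  using frechet_derivative_at[OF assms] by (simp add: partial_deriv_def)

lemma has_derivative_frechet:
  "f differentiable (at x) \<Longrightarrow> (f has_derivative frechet_derivative f (at x)) (at x)"
  by (simp add: frechet_derivative_works)

lemma partial_deriv_add:
  assumes "f differentiable (at x)" "g differentiable (at x)"
  shows "partial_deriv i (\<lambda>x. f x + g x) x = partial_deriv i f x + partial_deriv i g x"
  using partial_deriv_eqI[OF has_derivative_add[OF assms[THEN has_derivative_frechet]]]
  by (simp add: partial_deriv_def)

lemma partial_deriv_mult:
  assumes "f differentiable (at x)" "g differentiable (at x)"
  shows "partial_deriv i (\<lambda>x. f x * g x) x = f x * partial_deriv i g x + partial_deriv i f x * g x"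
  using partial_deriv_eqI[OF has_derivative_mult[OF assms[THEN has_derivative_frechet]]]
  by (simp add: partial_deriv_def)

lemma partial_deriv_const [simp]: "partial_deriv i (\<lambda>x. c) = (\<lambda>x. 0)"
  using partial_deriv_eqI[OF has_derivative_const] by fast

lemma C_k_const [simp]: "C_k k (\<lambda>x. c)"
  by (induction k arbitrary: c) auto

lemma C_k_Suc_imp: "C_k (Suc k) f \<Longrightarrow> C_k k f"
proof (induction k arbitrary: f)
  case 0
  then have "\<forall>x. f differentiable (at x)" by simp
  then have "f differentiable_on UNIV" by (auto simp: differentiable_on_def)
  then show ?case by (simp add: differentiable_imp_continuous_on)
next
  case (Suc k)
  then show ?case by (metis C_k.simps(2))
qed

lemma C_k_add: "C_k k f \<Longrightarrow> C_k k g \<Longrightarrow> C_k k (\<lambda>x. f x + g x)"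
proof (induction k arbitrary: f g)
  case 0
  then show ?case by (auto intro: continuous_intros)
next
  case (Suc k)
  have "partial_deriv i (\<lambda>x. f x + g x) = (\<lambda>x. partial_deriv i f x + partial_deriv i g x)" for i
    using Suc.prems by (auto simp: partial_deriv_add)
  then show ?case using Suc by (auto intro!: derivative_intros)
qed

lemma C_k_mult: "C_k k f \<Longrightarrow> C_k k g \<Longrightarrow> C_k k (\<lambda>x. f x * g x)"
proof (induction k arbitrary: f g)
  case 0
  then show ?case by (auto intro: continuous_intros)
next
  case (Suc k)
  have "partial_deriv i (\<lambda>x. f x * g x)
      = (\<lambda>x. f x * partial_deriv i g x + partial_deriv i f x * g x)" for i
    using Suc.prems by (auto simp: partial_deriv_mult)
  moreover have "C_k k (\<lambda>x. f x * partial_deriv i g x + partial_deriv i f x * g x)" for i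
    using Suc.prems C_k_Suc_imp[OF Suc.prems(1)] C_k_Suc_imp[OF Suc.prems(2)]
    by (intro C_k_add Suc.IH) auto
  ultimately show ?case using Suc.prems by auto
qed

lemma partial_deriv_inverse:
  assumes "f differentiable (at x)" "f x \<noteq> 0"
  shows "partial_deriv i (\<lambda>x. inverse (f x)) x
    = (-1) * (partial_deriv i f x * (inverse (f x) * inverse (f x)))"
proof -
  have "((\<lambda>x. inverse (f x)) has_derivative
      (\<lambda>h. - (inverse (f x) * frechet_derivative f (at x) h * inverse (f x)))) (at x)"
    using Deriv.has_derivative_inverse[OF assms(2) has_derivative_frechet[OF assms(1)]] by simp
  from partial_deriv_eqI[OF this, of i] show ?thesis by (simp add: partial_deriv_def)
qed

lemma C_k_inverse: "C_k k f \<Longrightarrow> (\<And>x. f x \<noteq> 0) \<Longrightarrow> C_k k (\<lambda>x. inverse (f x))"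
proof (induction k arbitrary: f)
  case 0
  then show ?case by (auto intro: continuous_intros)
next
  case (Suc k)
  have "partial_deriv i (\<lambda>x. inverse (f x))
      = (\<lambda>x. (-1) * (partial_deriv i f x * (inverse (f x) * inverse (f x))))" for i
    using Suc.prems by (auto simp: partial_deriv_inverse)
  moreover have "C_k k (\<lambda>x. (-1) * (partial_deriv i f x * (inverse (f x) * inverse (f x))))" for i
    using Suc.prems C_k_Suc_imp[OF Suc.prems(1)]
    by (intro C_k_mult Suc.IH C_k_const) auto
  moreover have "(\<lambda>x. inverse (f x)) differentiable (at x)" for x
    using Suc.prems by (auto intro!: derivative_intros)
  ultimately show ?case by auto
qed

definition smooth_fun :: "(real^'n \<Rightarrow> real) \<Rightarrow> bool" where
  "smooth_fun f \<longleftrightarrow> (\<forall>k. C_k k f)"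

text \<open>A recursive form without a count of derivatives: differentiating a smooth function costs
  no order.\<close>

lemma smooth_fun_iff:
  "smooth_fun f \<longleftrightarrow> (\<forall>x. f differentiable (at x)) \<and> (\<forall>i. smooth_fun (partial_deriv i f))"
proof
  assume f: "smooth_fun f"
  then have "C_k (Suc k) f" for k unfolding smooth_fun_def by blast
  then show "(\<forall>x. f differentiable (at x)) \<and> (\<forall>i. smooth_fun (partial_deriv i f))"
    unfolding smooth_fun_def by auto
next
  assume *: "(\<forall>x. f differentiable (at x)) \<and> (\<forall>i. smooth_fun (partial_deriv i f))"
  then have "C_k (Suc k) f" for k unfolding smooth_fun_def by auto
  then show "smooth_fun f" unfolding smooth_fun_def using C_k_Suc_imp by blast
qed

lemma smooth_fun_differentiable: "smooth_fun f \<Longrightarrow> f differentiable (at x)"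
  using smooth_fun_iff by blast

lemma smooth_fun_partial: "smooth_fun f \<Longrightarrow> smooth_fun (partial_deriv i f)"
  using smooth_fun_iff by blast

lemma smooth_fun_continuous: "smooth_fun f \<Longrightarrow> continuous_on S f"
  using continuous_on_subset[of UNIV f S] unfolding smooth_fun_def by (metis C_k.simps(1) subset_UNIV)

lemma smooth_fun_const [simp]: "smooth_fun (\<lambda>x. c)"
  and smooth_fun_add: "smooth_fun f \<Longrightarrow> smooth_fun g \<Longrightarrow> smooth_fun (\<lambda>x. f x + g x)"
  and smooth_fun_mult: "smooth_fun f \<Longrightarrow> smooth_fun g \<Longrightarrow> smooth_fun (\<lambda>x. f x * g x)"
  and smooth_fun_inverse: "smooth_fun f \<Longrightarrow> (\<And>x. f x \<noteq> 0) \<Longrightarrow> smooth_fun (\<lambda>x. inverse (f x))"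
  by (auto simp: smooth_fun_def C_k_add C_k_mult C_k_inverse)

lemma smooth_fun_cmult: "smooth_fun f \<Longrightarrow> smooth_fun (\<lambda>x. c * f x)"
  by (intro smooth_fun_mult) simp_all

lemma smooth_fun_diff:
  assumes "smooth_fun f" "smooth_fun g"
  shows "smooth_fun (\<lambda>x. f x - g x)"
  using smooth_fun_add[OF assms(1) smooth_fun_cmult[OF assms(2), of "-1"]] by simp

lemma smooth_fun_divide:
  "smooth_fun f \<Longrightarrow> smooth_fun g \<Longrightarrow> (\<And>x. g x \<noteq> 0) \<Longrightarrow> smooth_fun (\<lambda>x. f x / g x)"
  unfolding divide_inverse by (intro smooth_fun_mult smooth_fun_inverse)

lemma smooth_fun_coord: "smooth_fun (\<lambda>x::real^'n. x $ j)"
proof -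
  have d: "((\<lambda>x::real^'n. x $ j) has_derivative (\<lambda>h. h $ j)) (at x)" for x
    by (intro derivative_intros bounded_linear_imp_has_derivative bounded_linear_vec_nth)
  then have "partial_deriv i (\<lambda>x::real^'n. x $ j) = (\<lambda>x. axis i 1 $ j)" for i
    using partial_deriv_eqI[OF d] by blast
  moreover have "(\<lambda>x::real^'n. x $ j) differentiable (at x)" for x
    using d differentiable_def by blast
  ultimately show ?thesis by (subst smooth_fun_iff) simp
qed

lemma smooth_fun_sum:
  "finite A \<Longrightarrow> (\<And>a. a \<in> A \<Longrightarrow> smooth_fun (f a)) \<Longrightarrow> smooth_fun (\<lambda>x. \<Sum>a\<in>A. f a x)"
  by (induction rule: finite_induct) (auto intro: smooth_fun_add)

lemma smooth_fun_norm_sq: "smooth_fun (\<lambda>x::real^'n. (norm (x - a))\<^sup>2)"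
proof -
  have "(\<lambda>x::real^'n. (norm (x - a))\<^sup>2) = (\<lambda>x. \<Sum>i\<in>UNIV. (x $ i - a $ i) * (x $ i - a $ i))"
    by (auto simp: power2_norm_eq_inner inner_vec_def)
  then show ?thesis
    by (simp add: smooth_fun_sum smooth_fun_mult smooth_fun_diff smooth_fun_coord)
qed

section \<open>Functions flat at the origin\<close>

definition flat :: "nat \<Rightarrow> real \<Rightarrow> real" where
  "flat m t = (if t > 0 then (1 / t) ^ m * exp (- (1 / t)) else 0)"

lemma flat_nonneg: "flat m t \<ge> 0" by (simp add: flat_def)

lemma flat_pos_iff: "flat m t > 0 \<longleftrightarrow> t > 0" by (simp add: flat_def)

lemma flat_tendsto_0: "(flat m \<longlongrightarrow> 0) (at_right 0)"
proof -
  have "((\<lambda>t. t ^ m / exp t) \<longlongrightarrow> (0::real)) at_top"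
    by (rule tendsto_power_div_exp_0)
  moreover have "filterlim (\<lambda>t::real. 1 / t) at_top (at_right 0)"
    using filterlim_inverse_at_top_right by (simp add: inverse_eq_divide)
  ultimately have "((\<lambda>t. (1 / t) ^ m / exp (1 / t)) \<longlongrightarrow> (0::real)) (at_right 0)"
    by (rule filterlim_compose)
  moreover have "\<forall>\<^sub>F t in at_right 0. (1 / t) ^ m / exp (1 / t) = flat m t"
    by (auto simp: eventually_at_right_field flat_def exp_minus divide_inverse intro!: exI[of _ 1])
  ultimately show ?thesis by (rule Lim_transform_eventually)
qed

text \<open>Differentiating t^(-m) exp(-1/t) gives a combination of the functions with exponents m +
  1 and m + 2. Carrying the exponent makes the family closed under differentiation, so smoothness
  follows by one induction over the order, for all exponents at once.\<close>

lemma flat_has_derivative: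
  "(flat m has_real_derivative (- real m * flat (Suc m) t + flat (Suc (Suc m)) t)) (at t)"
proof -
  consider "t > 0" | "t < 0" | "t = 0" by linarith
  then show ?thesis
  proof cases
    case 1
    have "((\<lambda>t. (1 / t) ^ m * exp (- (1 / t))) has_real_derivative
        (- real m * flat (Suc m) t + flat (Suc (Suc m)) t)) (at t)"
    proof (cases m)
      case 0
      then show ?thesis using 1
        by (auto intro!: derivative_eq_intros simp: flat_def power2_eq_square field_simps)
    next
      case (Suc n)
      have "((\<lambda>t. (1 / t) ^ Suc n) has_real_derivative (real (Suc n) * (1 / t) ^ n * (- (1 / t)\<^sup>2))) (at t)"
      proof -
        have "((\<lambda>t. 1 / t) has_real_derivative (- (1 / t)\<^sup>2)) (at t)"
          using 1 by (auto intro!: derivative_eq_intros simp: power2_eq_square)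
        from DERIV_power[OF this, of "Suc n"] show ?thesis by (simp add: mult_ac)
      qed
      moreover have "((\<lambda>t. exp (- (1 / t))) has_real_derivative exp (- (1 / t)) * (1 / t)\<^sup>2) (at t)"
        using 1 by (auto intro!: derivative_eq_intros simp: power2_eq_square field_simps)
      ultimately have "((\<lambda>t. (1 / t) ^ Suc n * exp (- (1 / t))) has_real_derivative
          real (Suc n) * (1 / t) ^ n * (- (1 / t)\<^sup>2) * exp (- (1 / t))
          + exp (- (1 / t)) * (1 / t)\<^sup>2 * (1 / t) ^ Suc n) (at t)"
        by (rule DERIV_mult)
      also have "real (Suc n) * (1 / t) ^ n * (- (1 / t)\<^sup>2) * exp (- (1 / t))
          + exp (- (1 / t)) * (1 / t)\<^sup>2 * (1 / t) ^ Suc n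
          = - real m * flat (Suc m) t + flat (Suc (Suc m)) t"
        using 1 Suc by (simp add: flat_def power2_eq_square algebra_simps flip: add_divide_distrib)
      finally show ?thesis by (simp add: Suc)
    qed
    then show ?thesis
      by (rule has_field_derivative_transform_within_open[where S = "{0<..}"])
         (use 1 in \<open>auto simp: flat_def\<close>)
  next
    case 2
    have "((\<lambda>t. 0) has_real_derivative 0) (at t)" by simp
    then have "(flat m has_real_derivative 0) (at t)"
      by (rule has_field_derivative_transform_within_open[where S = "{..<0}"])
         (use 2 in \<open>auto simp: flat_def\<close>)
    then show ?thesis using 2 by (simp add: flat_def)
  next
    case 3
    \<comment> \<open>To the right of 0 this difference quotient is
      \<open>flat (Suc m) h\<close>.\<close>
    have "((\<lambda>h. (flat m (0 + h) - flat m 0) / h) \<longlongrightarrow> 0) (at_right 0)"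
      by (rule Lim_transform_eventually[OF flat_tendsto_0[of "Suc m"]])
         (auto simp: eventually_at_right_field flat_def intro!: exI[of _ 1])
    moreover have "((\<lambda>h. (flat m (0 + h) - flat m 0) / h) \<longlongrightarrow> 0) (at_left 0)"
      by (rule Lim_transform_eventually[OF tendsto_const])
         (auto simp: eventually_at_left_field flat_def intro!: exI[of _ "-1"])
    ultimately have "((\<lambda>h. (flat m (0 + h) - flat m 0) / h) \<longlongrightarrow> 0) (at 0)"
      using filterlim_split_at by blast
    then show ?thesis using 3 by (simp add: DERIV_def flat_def)
  qed
qed

lemma C_k_flat: "smooth_fun p \<Longrightarrow> C_k k (\<lambda>x. flat m (p x))"
proof (induction k arbitrary: m)
  case 0
  have "continuous_on UNIV (flat m)"
    using flat_has_derivative DERIV_isCont continuous_at_imp_continuous_on by blast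
  then show ?case
    using smooth_fun_continuous[OF 0, of UNIV]
    by (auto intro: continuous_on_compose2[of UNIV "flat m"])
next
  case (Suc k)
  have d: "((\<lambda>x. flat m (p x)) has_derivative (\<lambda>h. (- real m * flat (Suc m) (p x)
      + flat (Suc (Suc m)) (p x)) * frechet_derivative p (at x) h)) (at x)" for x
    using has_derivative_compose[OF has_derivative_frechet[OF smooth_fun_differentiable[OF Suc.prems]]
        flat_has_derivative[of m "p x", unfolded has_field_derivative_def]] .
  have "partial_deriv i (\<lambda>x. flat m (p x)) = (\<lambda>x. (- real m * flat (Suc m) (p x)
      + flat (Suc (Suc m)) (p x)) * partial_deriv i p x)" for i
    using partial_deriv_eqI[OF d] by (auto simp: partial_deriv_def)
  moreover have "C_k k (partial_deriv i p)" for i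
    using smooth_fun_partial[OF Suc.prems] by (simp add: smooth_fun_def)
  moreover have "C_k k (\<lambda>x. - real m * flat (Suc m) (p x) + flat (Suc (Suc m)) (p x))"
    by (intro C_k_add C_k_mult C_k_const Suc)
  ultimately show ?case
    using d by (auto simp: differentiable_def simp del: mult_minus_left add_uminus_conv_diff intro!: C_k_mult)
qed

lemma smooth_fun_flat: "smooth_fun p \<Longrightarrow> smooth_fun (\<lambda>x. flat m (p x))"
  using C_k_flat by (auto simp: smooth_fun_def)

section \<open>Test functions\<close>

text \<open>Vanishing outside some compact subset passes through sums, products and derivatives more
  easily than a condition on the closure of the set of nonzero values.\<close>

lemma test_functions_iff:
  "\<phi> \<in> test_functions \<Omega> \<longleftrightarrow>
     smooth_fun \<phi> \<and> (\<exists>K. compact K \<and> K \<subseteq> \<Omega> \<and> (\<forall>x. x \<notin> K \<longrightarrow> \<phi> x = 0))"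
proof
  assume "\<phi> \<in> test_functions \<Omega>"
  then show "smooth_fun \<phi> \<and> (\<exists>K. compact K \<and> K \<subseteq> \<Omega> \<and> (\<forall>x. x \<notin> K \<longrightarrow> \<phi> x = 0))"
    unfolding test_functions_def smooth_fun_def
    by (auto intro!: exI[of _ "closure {x. \<phi> x \<noteq> 0}"] simp: closure_def)
next
  assume *: "smooth_fun \<phi> \<and> (\<exists>K. compact K \<and> K \<subseteq> \<Omega> \<and> (\<forall>x. x \<notin> K \<longrightarrow> \<phi> x = 0))"
  then obtain K where K: "compact K" "K \<subseteq> \<Omega>" "\<forall>x. x \<notin> K \<longrightarrow> \<phi> x = 0" by blast
  then have "closure {x. \<phi> x \<noteq> 0} \<subseteq> K"
    by (intro closure_minimal compact_imp_closed) auto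
  moreover have "compact (closure {x. \<phi> x \<noteq> 0})"
    using calculation K(1) by (meson closed_closure compact_eq_bounded_closed bounded_subset)
  ultimately show "\<phi> \<in> test_functions \<Omega>"
    using * K unfolding test_functions_def smooth_fun_def by auto
qed

lemma test_functions_smooth: "\<phi> \<in> test_functions \<Omega> \<Longrightarrow> smooth_fun \<phi>"
  by (simp add: test_functions_iff)

lemma test_functions_mono: "\<phi> \<in> test_functions \<Omega> \<Longrightarrow> \<Omega> \<subseteq> \<Omega>' \<Longrightarrow> \<phi> \<in> test_functions \<Omega>'"
  unfolding test_functions_iff by blast

lemma test_functions_UNIV: "\<phi> \<in> test_functions \<Omega> \<Longrightarrow> \<phi> \<in> test_functions UNIV"
  by (erule test_functions_mono) simp

lemma test_functions_zero: "(\<lambda>x. 0) \<in> test_functions \<Omega>"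
  unfolding test_functions_iff by auto

lemma test_functions_add:
  assumes "\<phi> \<in> test_functions \<Omega>" "\<psi> \<in> test_functions \<Omega>"
  shows "(\<lambda>x. \<phi> x + \<psi> x) \<in> test_functions \<Omega>"
proof -
  from assms obtain K L where "compact K" "K \<subseteq> \<Omega>" "\<forall>x. x \<notin> K \<longrightarrow> \<phi> x = 0"
    "compact L" "L \<subseteq> \<Omega>" "\<forall>x. x \<notin> L \<longrightarrow> \<psi> x = 0" unfolding test_functions_iff by blast
  with assms show ?thesis unfolding test_functions_iff
    by (auto intro!: exI[of _ "K \<union> L"] smooth_fun_add)
qed

lemma test_functions_mult:
  assumes "\<phi> \<in> test_functions \<Omega>" "smooth_fun \<psi>"
  shows "(\<lambda>x. \<psi> x * \<phi> x) \<in> test_functions \<Omega>"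
  using assms unfolding test_functions_iff by (auto intro!: smooth_fun_mult)

lemma test_functions_mult_right:
  assumes "\<phi> \<in> test_functions \<Omega>" "smooth_fun \<psi>"
  shows "(\<lambda>x. \<phi> x * \<psi> x) \<in> test_functions \<Omega>"
  using test_functions_mult[OF assms] by (simp add: mult.commute)

lemma test_functions_cmult:
  "\<phi> \<in> test_functions \<Omega> \<Longrightarrow> (\<lambda>x. c * \<phi> x) \<in> test_functions \<Omega>"
  by (rule test_functions_mult) simp_all

lemma test_functions_diff:
  assumes "\<phi> \<in> test_functions \<Omega>" "\<psi> \<in> test_functions \<Omega>"
  shows "(\<lambda>x. \<phi> x - \<psi> x) \<in> test_functions \<Omega>"
  using test_functions_add[OF assms(1) test_functions_cmult[OF assms(2), of "-1"]] by simp

lemma test_functions_partial: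
  assumes "\<phi> \<in> test_functions \<Omega>"
  shows "partial_deriv i \<phi> \<in> test_functions \<Omega>"
proof -
  from assms obtain K where K: "compact K" "K \<subseteq> \<Omega>" "\<forall>x. x \<notin> K \<longrightarrow> \<phi> x = 0"
    unfolding test_functions_iff by blast
  have "partial_deriv i \<phi> x = 0" if "x \<notin> K" for x
  proof -
    have "(\<phi> has_derivative (\<lambda>h. 0)) (at x)"
      by (rule has_derivative_transform_within_open[where s = "- K" and f = "\<lambda>x. 0"])
         (use K that compact_imp_closed in auto)
    from partial_deriv_eqI[OF this] show ?thesis by simp
  qed
  with K assms smooth_fun_partial show ?thesis unfolding test_functions_iff by blast
qed

lemma ex_bump:
  fixes a :: "real^'n"
  assumes "r > 0"
  shows "\<exists>\<phi>\<in>test_functions UNIV. (\<forall>x. \<phi> x \<ge> 0) \<and> (\<forall>x. \<phi> x > 0 \<longleftrightarrow> norm (x - a) < r)"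
proof (intro bexI conjI allI)
  let ?f = "\<lambda>x::real^'n. flat 0 (r\<^sup>2 - (norm (x - a))\<^sup>2)"
  show "?f x \<ge> 0" for x by (rule flat_nonneg)
  show *: "?f x > 0 \<longleftrightarrow> norm (x - a) < r" for x
    using assms by (auto simp: flat_pos_iff intro: power_strict_mono power2_less_imp_less)
  have "?f x = 0" if "x \<notin> cball a r" for x
    using *[of x] flat_nonneg[of 0 "r\<^sup>2 - (norm (x - a))\<^sup>2"] that
    by (auto simp: dist_norm norm_minus_commute)
  moreover have "smooth_fun ?f"
    by (intro smooth_fun_flat smooth_fun_diff smooth_fun_norm_sq) simp
  ultimately show "?f \<in> test_functions UNIV"
    unfolding test_functions_iff by (blast intro: compact_cball)
qed

text \<open>A quotient f / (f + g), where f is positive exactly inside radius R and g exactly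
  outside radius r. Because r < R, every point lies in one of the two regions and the denominator
  never vanishes.\<close>

lemma ex_cutoff:
  fixes a :: "real^'n"
  assumes "0 < r" "r < R"
  shows "\<exists>\<eta>\<in>test_functions UNIV. (\<forall>x. norm (x - a) \<le> r \<longrightarrow> \<eta> x = 1) \<and>
    (\<forall>x. norm (x - a) \<ge> R \<longrightarrow> \<eta> x = 0)"
proof (intro bexI conjI allI impI)
  let ?f = "\<lambda>x::real^'n. flat 0 (R\<^sup>2 - (norm (x - a))\<^sup>2)"
  let ?g = "\<lambda>x::real^'n. flat 0 ((norm (x - a))\<^sup>2 - r\<^sup>2)"
  have pos: "?f x + ?g x \<noteq> 0" for x
  proof -
    have "R\<^sup>2 > r\<^sup>2" using assms by (intro power_strict_mono) auto
    then have "R\<^sup>2 - (norm (x - a))\<^sup>2 > 0 \<or> (norm (x - a))\<^sup>2 - r\<^sup>2 > 0" by linarith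
    then have "?f x > 0 \<or> ?g x > 0" by (simp add: flat_pos_iff)
    then show ?thesis using flat_nonneg[of 0] by (metis add_nonneg_eq_0_iff less_irrefl)
  qed
  have f0: "?f x = 0" if "norm (x - a) \<ge> R" for x
    using power_mono[OF that, of 2] assms by (auto simp: flat_def not_less)
  show "?f x / (?f x + ?g x) = 0" if "norm (x - a) \<ge> R" for x
    using f0[OF that] by simp
  show "?f x / (?f x + ?g x) = 1" if "norm (x - a) \<le> r" for x
  proof -
    have "?g x = 0" using power_mono[OF that, of 2] by (simp add: flat_def)
    then show ?thesis using pos[of x] by simp
  qed
  have "smooth_fun (\<lambda>x. ?f x / (?f x + ?g x))"
    by (intro smooth_fun_divide smooth_fun_add smooth_fun_flat smooth_fun_diff smooth_fun_norm_sq pos)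
       simp_all
  moreover have "?f x / (?f x + ?g x) = 0" if "x \<notin> cball a R" for x
    using f0[of x] that by (simp add: dist_norm norm_minus_commute[of a])
  ultimately show "(\<lambda>x. ?f x / (?f x + ?g x)) \<in> test_functions UNIV"
    unfolding test_functions_iff by (blast intro: compact_cball)
qed


section \<open>The inner product of square integrable functions\<close>

text \<open>The integral runs over the whole space. Elements of \<open>L2 \<Omega>\<close> vanish
  almost everywhere outside \<Omega>, so this is the inner product of \<Omega> for them, and it also
  pairs translates, which leave \<Omega>.\<close>

definition ip :: "(real^'n \<Rightarrow> real) \<Rightarrow> (real^'n \<Rightarrow> real) \<Rightarrow> real" where
  "ip u v = (LINT x|lborel. u x * v x)"

definition nrm :: "(real^'n \<Rightarrow> real) \<Rightarrow> real" where
  "nrm u = sqrt (ip u u)"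

lemma L2_measurable [measurable_dest]: "u \<in> L2 \<Omega> \<Longrightarrow> u \<in> borel_measurable borel"
  by (simp add: L2_def)

lemma L2_iff: "u \<in> L2 \<Omega> \<longleftrightarrow> u \<in> L2 UNIV \<and> (AE x in lborel. x \<notin> \<Omega> \<longrightarrow> u x = 0)"
  by (auto simp: L2_def)

lemma L2_UNIV: "u \<in> L2 \<Omega> \<Longrightarrow> u \<in> L2 UNIV"
  using L2_iff by blast

lemma L2_I:
  assumes "u \<in> borel_measurable borel" "integrable lborel (\<lambda>x. (u x)\<^sup>2)"
  shows "u \<in> L2 UNIV"
  using assms by (simp add: L2_def)

lemma integrable_L2_mult:
  assumes "u \<in> L2 \<Omega>" "v \<in> L2 \<Omega>'"
  shows "integrable lborel (\<lambda>x. u x * v x)"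
proof (rule Bochner_Integration.integrable_bound)
  show "integrable lborel (\<lambda>x. (u x)\<^sup>2 + (v x)\<^sup>2)" using assms by (simp add: L2_def)
  show "(\<lambda>x. u x * v x) \<in> borel_measurable lborel" using assms by (auto simp: L2_def)
  have "\<bar>a * b\<bar> \<le> a\<^sup>2 + b\<^sup>2" for a b :: real
  proof -
    have "2 * (\<bar>a\<bar> * \<bar>b\<bar>) \<le> a\<^sup>2 + b\<^sup>2" using sum_squares_bound[of "\<bar>a\<bar>" "\<bar>b\<bar>"] by simp
    moreover have "0 \<le> \<bar>a\<bar> * \<bar>b\<bar>" by simp
    ultimately show ?thesis unfolding abs_mult by linarith
  qed
  then show "AE x in lborel. norm (u x * v x) \<le> norm ((u x)\<^sup>2 + (v x)\<^sup>2)" by auto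
qed

lemma L2_zero [simp]: "(\<lambda>x. 0) \<in> L2 \<Omega>"
  by (simp add: L2_def)

lemma L2_cmult: "u \<in> L2 \<Omega> \<Longrightarrow> (\<lambda>x. c * u x) \<in> L2 \<Omega>"
  by (auto simp: L2_def power_mult_distrib)

lemma L2_add:
  assumes "u \<in> L2 \<Omega>" "v \<in> L2 \<Omega>"
  shows "(\<lambda>x. u x + v x) \<in> L2 \<Omega>"
proof -
  have "integrable lborel (\<lambda>x. (u x)\<^sup>2 + (v x)\<^sup>2 + 2 * (u x * v x))"
    using assms integrable_L2_mult[OF assms]
    by (intro Bochner_Integration.integrable_add integrable_mult_right) (auto simp: L2_def)
  then have "integrable lborel (\<lambda>x. (u x + v x)\<^sup>2)" by (simp add: power2_sum mult.assoc)
  then show ?thesis using assms by (auto simp: L2_def)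
qed

lemma L2_diff:
  assumes "u \<in> L2 \<Omega>" "v \<in> L2 \<Omega>"
  shows "(\<lambda>x. u x - v x) \<in> L2 \<Omega>"
  using L2_add[OF assms(1) L2_cmult[OF assms(2), of "-1"]] by simp

lemma L2_sum:
  "finite A \<Longrightarrow> (\<And>a. a \<in> A \<Longrightarrow> f a \<in> L2 \<Omega>) \<Longrightarrow> (\<lambda>x. \<Sum>a\<in>A. f a x) \<in> L2 \<Omega>"
  by (induction rule: finite_induct) (auto intro: L2_add)

lemma L2_dominated:
  assumes "v \<in> L2 \<Omega>" "u \<in> borel_measurable borel" "AE x in lborel. \<bar>u x\<bar> \<le> \<bar>v x\<bar>"
  shows "u \<in> L2 \<Omega>"
proof -
  have "integrable lborel (\<lambda>x. (u x)\<^sup>2)"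
  proof (rule Bochner_Integration.integrable_bound)
    show "integrable lborel (\<lambda>x. (v x)\<^sup>2)" using assms by (simp add: L2_def)
    show "AE x in lborel. norm ((u x)\<^sup>2) \<le> norm ((v x)\<^sup>2)"
      using assms(3) by (auto simp: abs_le_square_iff)
  qed (use assms in auto)
  moreover have "AE x in lborel. x \<notin> \<Omega> \<longrightarrow> u x = 0"
  proof -
    have "AE x in lborel. x \<notin> \<Omega> \<longrightarrow> v x = 0" using assms(1) by (simp add: L2_def)
    with assms(3) show ?thesis by eventually_elim auto
  qed
  ultimately show ?thesis using assms by (simp add: L2_def)
qed

lemma ip_commute: "ip u v = ip v u"
  by (simp add: ip_def mult.commute)

lemma ip_add_left:
  "u \<in> L2 A \<Longrightarrow> v \<in> L2 B \<Longrightarrow> w \<in> L2 D \<Longrightarrow> ip (\<lambda>x. u x + v x) w = ip u w + ip v w"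
  by (simp add: ip_def distrib_right integrable_L2_mult)

lemma ip_diff_left:
  "u \<in> L2 A \<Longrightarrow> v \<in> L2 B \<Longrightarrow> w \<in> L2 D \<Longrightarrow> ip (\<lambda>x. u x - v x) w = ip u w - ip v w"
  by (simp add: ip_def left_diff_distrib integrable_L2_mult)

lemma ip_cmult_left: "ip (\<lambda>x. c * u x) w = c * ip u w"
  by (simp add: ip_def mult.assoc)

lemma ip_zero_left: "ip (\<lambda>x. 0) w = 0"
  by (simp add: ip_def)

lemma ip_add_right:
  "u \<in> L2 A \<Longrightarrow> v \<in> L2 B \<Longrightarrow> w \<in> L2 D \<Longrightarrow> ip w (\<lambda>x. u x + v x) = ip w u + ip w v"
  by (simp add: ip_commute[of w] ip_add_left)

lemma ip_diff_right:
  "u \<in> L2 A \<Longrightarrow> v \<in> L2 B \<Longrightarrow> w \<in> L2 D \<Longrightarrow> ip w (\<lambda>x. u x - v x) = ip w u - ip w v"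
  by (simp add: ip_commute[of w] ip_diff_left)

lemma ip_cmult_right: "ip w (\<lambda>x. c * u x) = c * ip w u"
  by (simp add: ip_commute[of w] ip_cmult_left)

lemma ip_sum_left:
  "finite A \<Longrightarrow> (\<And>a. a \<in> A \<Longrightarrow> f a \<in> L2 B) \<Longrightarrow> w \<in> L2 D \<Longrightarrow>
    ip (\<lambda>x. \<Sum>a\<in>A. f a x) w = (\<Sum>a\<in>A. ip (f a) w)"
proof (induction rule: finite_induct)
  case empty
  then show ?case by (simp add: ip_zero_left)
next
  case (insert a A)
  then show ?case using ip_add_left[of "f a" B "\<lambda>x. \<Sum>a\<in>A. f a x" B w D]
    by (auto intro: L2_sum)
qed

lemma ip_cong_AE:
  assumes "AE x in lborel. u x = u' x" "AE x in lborel. v x = v' x"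
    "u \<in> borel_measurable borel" "u' \<in> borel_measurable borel"
    "v \<in> borel_measurable borel" "v' \<in> borel_measurable borel"
  shows "ip u v = ip u' v'"
  unfolding ip_def using assms(1,2)
  by (intro integral_cong_AE) (use assms in auto)

lemma ip_self_nonneg: "ip u u \<ge> 0"
  by (simp add: ip_def)

lemma nrm_nonneg [simp]: "nrm u \<ge> 0"
  by (simp add: nrm_def ip_self_nonneg)

lemma nrm_sq: "(nrm u)\<^sup>2 = ip u u"
  by (simp add: nrm_def ip_self_nonneg)

lemma nrm_cong_AE:
  assumes "AE x in lborel. u x = u' x"
    "u \<in> borel_measurable borel" "u' \<in> borel_measurable borel"
  shows "nrm u = nrm u'"
  using assms by (simp add: nrm_def ip_cong_AE[of u u'])

text \<open>The discriminant of a nonnegative quadratic polynomial. It yields the Cauchy--Schwarz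
  inequality, the approximate Riesz representation and, with a = 0, the vanishing of first
  variations.\<close>

lemma discriminant_le:
  fixes a b c :: real
  assumes "\<And>t. a + 2 * t * b + t\<^sup>2 * c \<ge> 0" "c \<ge> 0"
  shows "b\<^sup>2 \<le> a * c"
proof (cases "c = 0")
  case True
  have "b = 0"
  proof (rule ccontr)
    assume "b \<noteq> 0"
    \<comment> \<open>At this argument the polynomial, which is affine here, takes the value
      -1.\<close>
    then show False using assms(1)[of "- (a + 1) / (2 * b)"] True by (simp add: field_simps)
  qed
  then show ?thesis using True by simp
next
  case False
  have "0 \<le> (a + 2 * (- b / c) * b + (- b / c)\<^sup>2 * c) * c"
    by (intro mult_nonneg_nonneg assms)
  also have "(a + 2 * (- b / c) * b + (- b / c)\<^sup>2 * c) * c = a * c - b\<^sup>2"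
    using False by (simp add: power2_eq_square field_simps)
  finally show ?thesis by simp
qed

lemma ip_Cauchy_Schwarz:
  assumes "u \<in> L2 A" "v \<in> L2 B"
  shows "\<bar>ip u v\<bar> \<le> nrm u * nrm v"
proof -
  have "ip u u + 2 * t * ip u v + t\<^sup>2 * ip v v \<ge> 0" for t
  proof -
    note m = assms L2_UNIV[OF assms(1)] L2_UNIV[OF assms(2)]
    have "ip (\<lambda>x. u x + t * v x) (\<lambda>x. u x + t * v x) = ip u u + 2 * t * ip u v + t\<^sup>2 * ip v v"
      using m L2_cmult[of v UNIV t]
      by (simp add: ip_add_left[of _ UNIV _ UNIV _ UNIV] ip_add_right[of _ UNIV _ UNIV _ UNIV] L2_add
          ip_cmult_left ip_cmult_right ip_commute[of v u] power2_eq_square algebra_simps)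
    then show ?thesis using ip_self_nonneg by metis
  qed
  then have "(ip u v)\<^sup>2 \<le> ip u u * ip v v"
    by (intro discriminant_le ip_self_nonneg)
  then have "sqrt ((ip u v)\<^sup>2) \<le> sqrt (ip u u * ip v v)" by (rule real_sqrt_le_mono)
  then show ?thesis by (simp add: nrm_def real_sqrt_mult)
qed

lemma nrm_cmult: "nrm (\<lambda>x. c * u x) = \<bar>c\<bar> * nrm u"
  by (simp add: nrm_def ip_cmult_left ip_cmult_right real_sqrt_mult mult.assoc[symmetric])

lemma nrm_minus_commute: "nrm (\<lambda>x. u x - v x) = nrm (\<lambda>x. v x - u x)"
  using nrm_cmult[of "-1" "\<lambda>x. u x - v x"] by simp

lemma nrm_triangle:
  assumes "u \<in> L2 A" "v \<in> L2 B"
  shows "nrm (\<lambda>x. u x + v x) \<le> nrm u + nrm v"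
proof (rule power2_le_imp_le)
  note m = L2_UNIV[OF assms(1)] L2_UNIV[OF assms(2)]
  have "(nrm (\<lambda>x. u x + v x))\<^sup>2 = (nrm u)\<^sup>2 + 2 * ip u v + (nrm v)\<^sup>2"
    using m by (simp add: nrm_sq ip_add_left[of _ UNIV _ UNIV _ UNIV]
        ip_add_right[of _ UNIV _ UNIV _ UNIV] L2_add ip_commute[of v u])
  also have "\<dots> \<le> (nrm u + nrm v)\<^sup>2"
    using ip_Cauchy_Schwarz[OF assms] by (simp add: power2_sum)
  finally show "(nrm (\<lambda>x. u x + v x))\<^sup>2 \<le> (nrm u + nrm v)\<^sup>2" .
qed simp

lemma nrm_triangle_diff:
  assumes "u \<in> L2 A" "v \<in> L2 B"
  shows "nrm (\<lambda>x. u x - v x) \<le> nrm u + nrm v"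
  using nrm_triangle[OF assms(1) L2_cmult[OF assms(2), of "-1"]] nrm_cmult[of "-1" v] by simp

lemma nrm_triangle_sub:
  assumes "u \<in> L2 A" "v \<in> L2 A" "w \<in> L2 A"
  shows "nrm (\<lambda>x. u x - w x) \<le> nrm (\<lambda>x. u x - v x) + nrm (\<lambda>x. v x - w x)"
  using nrm_triangle[OF L2_diff[OF assms(1,2)] L2_diff[OF assms(2,3)]] by simp

lemma nrm_sum_le:
  "finite A \<Longrightarrow> (\<And>a. a \<in> A \<Longrightarrow> f a \<in> L2 B) \<Longrightarrow> nrm (\<lambda>x. \<Sum>a\<in>A. f a x) \<le> (\<Sum>a\<in>A. nrm (f a))"
proof (induction rule: finite_induct)
  case empty
  then show ?case by (simp add: nrm_def ip_zero_left)
next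
  case (insert a A)
  then have "nrm (\<lambda>x. f a x + (\<Sum>a\<in>A. f a x)) \<le> nrm (f a) + nrm (\<lambda>x. \<Sum>a\<in>A. f a x)"
    by (intro nrm_triangle[of _ B _ B] L2_sum) auto
  with insert show ?case by simp
qed

lemma nrm_eq_0_AE:
  assumes "u \<in> L2 A" "nrm u = 0"
  shows "AE x in lborel. u x = 0"
proof -
  have "integrable lborel (\<lambda>x. (u x)\<^sup>2)" using assms by (simp add: L2_def)
  moreover have "(LINT x|lborel. (u x)\<^sup>2) = 0"
    using assms(2) nrm_sq[of u] by (simp add: ip_def power2_eq_square)
  ultimately have "AE x in lborel. (u x)\<^sup>2 = 0"
    by (subst (asm) integral_nonneg_eq_0_iff_AE) auto
  then show ?thesis by simp
qed

text \<open>The link between the integrals over \<Omega> in the definitions and \<open>ip\<close>;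
  the support of one factor suffices, so the other may be any measurable function.\<close>

lemma set_integral_L2:
  assumes "\<Omega> \<in> sets borel" "u \<in> L2 \<Omega>" "f \<in> borel_measurable borel"
  shows "(LINT x:\<Omega>|lborel. u x * f x) = ip u f"
proof -
  have "AE x in lborel. x \<notin> \<Omega> \<longrightarrow> u x = 0" using assms(2) by (simp add: L2_def)
  then have "AE x in lborel. indicator \<Omega> x *\<^sub>R (u x * f x) = u x * f x"
    by eventually_elim (auto simp: indicator_def)
  then show ?thesis unfolding set_lebesgue_integral_def ip_def
    by (rule integral_cong_AE[rotated 2]) (use assms in auto)
qed

lemma L2_norm_eq_nrm:
  assumes "\<Omega> \<in> sets borel" "u \<in> L2 \<Omega>"
  shows "L2_norm \<Omega> u = nrm u"
  using set_integral_L2[OF assms, of u] assms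
  by (simp add: L2_norm_def nrm_def power2_eq_square L2_measurable)

lemma L2_norm_vec_sq:
  fixes g :: "real^'n \<Rightarrow> real^'n"
  assumes "\<Omega> \<in> sets borel" "\<And>i. (\<lambda>x. g x $ i) \<in> L2 \<Omega>"
  shows "(L2_norm \<Omega> g)\<^sup>2 = (\<Sum>i\<in>UNIV. (nrm (\<lambda>x. g x $ i))\<^sup>2)"
proof -
  have i: "integrable lborel (\<lambda>x. indicator \<Omega> x *\<^sub>R (g x $ i * g x $ i))" for i
    using integrable_L2_mult[OF assms(2)[of i] assms(2)[of i]] assms(1)
    by (intro integrable_mult_indicator) auto
  have "(LINT x:\<Omega>|lborel. (norm (g x))\<^sup>2)
      = (LINT x|lborel. (\<Sum>i\<in>UNIV. indicator \<Omega> x *\<^sub>R (g x $ i * g x $ i)))"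
    unfolding set_lebesgue_integral_def
    by (simp add: power2_norm_eq_inner inner_vec_def sum_distrib_left)
  also have "\<dots> = (\<Sum>i\<in>UNIV. ip (\<lambda>x. g x $ i) (\<lambda>x. g x $ i))"
    using i set_integral_L2[OF assms, unfolded set_lebesgue_integral_def] assms(2)
    by (subst Bochner_Integration.integral_sum) (auto simp: L2_measurable)
  finally show ?thesis
    by (simp add: L2_norm_def nrm_sq ip_self_nonneg sum_nonneg)
qed

section \<open>Translations\<close>

lemma distr_translate: "distr lborel borel (\<lambda>x::'a::euclidean_space. x + c) = lborel"
  using lborel_distr_plus[of c] by (simp add: add.commute[of _ c])

lemma integral_translate:
  fixes f :: "'a::euclidean_space \<Rightarrow> real"
  assumes [measurable]: "f \<in> borel_measurable borel"
  shows "(LINT x|lborel. f (x + h)) = (LINT x|lborel. f x)"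
  using integral_distr[of "\<lambda>x. x + h" lborel borel f] assms by (simp add: distr_translate)

lemma integrable_translate:
  fixes f :: "'a::euclidean_space \<Rightarrow> real"
  assumes [measurable]: "f \<in> borel_measurable borel"
  shows "integrable lborel (\<lambda>x. f (x + h)) \<longleftrightarrow> integrable lborel f"
  using integrable_distr_eq[of "\<lambda>x. x + h" lborel borel f] assms by (simp add: distr_translate)

lemma nn_integral_translate:
  fixes f :: "'a::euclidean_space \<Rightarrow> ennreal"
  assumes [measurable]: "f \<in> borel_measurable borel"
  shows "(\<integral>\<^sup>+x. f (x + h) \<partial>lborel) = (\<integral>\<^sup>+x. f x \<partial>lborel)"
  using nn_integral_distr[of "\<lambda>x. x + h" lborel borel f] assms by (simp add: distr_translate)

lemma L2_translate: "u \<in> L2 \<Omega> \<Longrightarrow> (\<lambda>x. u (x + h)) \<in> L2 UNIV"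
  using integrable_translate[of "\<lambda>x. (u x)\<^sup>2" h] by (auto simp: L2_def)

lemma ip_translate:
  assumes "u \<in> L2 A" "v \<in> L2 B"
  shows "ip (\<lambda>x. u (x + h)) (\<lambda>x. v (x + h)) = ip u v"
  unfolding ip_def using integral_translate[of "\<lambda>x. u x * v x" h] assms by (auto simp: L2_def)

lemma nrm_translate: "u \<in> L2 A \<Longrightarrow> nrm (\<lambda>x. u (x + h)) = nrm u"
  by (simp add: nrm_def ip_translate)

section \<open>Continuity of translations in L^2\<close>

definition L2_cont :: "(real^'n \<Rightarrow> real) \<Rightarrow> bool" where
  "L2_cont v \<longleftrightarrow> (\<forall>\<epsilon>>0. \<exists>r>0. \<forall>h. norm h < r \<longrightarrow> nrm (\<lambda>x. v (x + h) - v x) < \<epsilon>)"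

text \<open>Translation is an isometry, so the error of the approximation enters twice with the same
  size; hence thirds.\<close>

lemma L2_cont_limit:
  assumes v: "v \<in> L2 UNIV"
    and ap: "\<And>\<epsilon>. \<epsilon> > 0 \<Longrightarrow> \<exists>u\<in>L2 UNIV. L2_cont u \<and> nrm (\<lambda>x. u x - v x) < \<epsilon>"
  shows "L2_cont v"
  unfolding L2_cont_def
proof (intro allI impI)
  fix \<epsilon> :: real assume "\<epsilon> > 0"
  then obtain u where u: "u \<in> L2 UNIV" "L2_cont u" "nrm (\<lambda>x. u x - v x) < \<epsilon> / 3"
    using ap[of "\<epsilon> / 3"] by auto
  then obtain r where r: "r > 0" "\<And>h. norm h < r \<Longrightarrow> nrm (\<lambda>x. u (x + h) - u x) < \<epsilon> / 3"
    unfolding L2_cont_def using \<open>\<epsilon> > 0\<close> by (metis divide_pos_pos zero_less_numeral)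
  have "nrm (\<lambda>x. v (x + h) - v x) < \<epsilon>" if h: "norm h < r" for h
  proof -
    note t = L2_translate[OF u(1), of h] L2_translate[OF v, of h]
    have "nrm (\<lambda>x. v (x + h) - v x)
        \<le> nrm (\<lambda>x. v (x + h) - u (x + h)) + nrm (\<lambda>x. u (x + h) - v x)"
      by (rule nrm_triangle_sub) (use t v in auto)
    also have "nrm (\<lambda>x. u (x + h) - v x)
        \<le> nrm (\<lambda>x. u (x + h) - u x) + nrm (\<lambda>x. u x - v x)"
      by (rule nrm_triangle_sub) (use t v u in auto)
    also have "nrm (\<lambda>x. v (x + h) - u (x + h)) = nrm (\<lambda>x. u x - v x)"
      using nrm_translate[OF L2_diff[OF u(1) v], of h] by (simp add: nrm_minus_commute[of "\<lambda>x. v (x + h)"])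
    finally show ?thesis using r(2)[OF h] u(3) by linarith
  qed
  with r(1) show "\<exists>r>0. \<forall>h. norm h < r \<longrightarrow> nrm (\<lambda>x. v (x + h) - v x) < \<epsilon>" by blast
qed

lemma L2_cont_cmult:
  assumes "v \<in> L2 UNIV" "L2_cont v"
  shows "L2_cont (\<lambda>x. c * v x)"
  unfolding L2_cont_def
proof (intro allI impI)
  fix \<epsilon> :: real assume e: "\<epsilon> > 0"
  then obtain r where r: "r > 0" "\<And>h. norm h < r \<Longrightarrow> nrm (\<lambda>x. v (x + h) - v x) < \<epsilon> / (\<bar>c\<bar> + 1)"
    using assms(2)[unfolded L2_cont_def] by (metis abs_ge_zero add_nonneg_pos divide_pos_pos zero_less_one)
  have "nrm (\<lambda>x. c * v (x + h) - c * v x) < \<epsilon>" if "norm h < r" for h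
  proof -
    have "nrm (\<lambda>x. c * v (x + h) - c * v x) = \<bar>c\<bar> * nrm (\<lambda>x. v (x + h) - v x)"
      using nrm_cmult[of c "\<lambda>x. v (x + h) - v x"] by (simp add: algebra_simps)
    also have "\<dots> \<le> \<bar>c\<bar> * (\<epsilon> / (\<bar>c\<bar> + 1))"
      using r(2)[OF that] by (intro mult_left_mono) auto
    also have "\<dots> < \<epsilon>" using e by (simp add: field_simps)
    finally show ?thesis .
  qed
  with r(1) show "\<exists>r>0. \<forall>h. norm h < r \<longrightarrow> nrm (\<lambda>x. c * v (x + h) - c * v x) < \<epsilon>" by blast
qed

lemma L2_cont_add:
  assumes "v \<in> L2 UNIV" "L2_cont v" "u \<in> L2 UNIV" "L2_cont u"
  shows "L2_cont (\<lambda>x. v x + u x)"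
  unfolding L2_cont_def
proof (intro allI impI)
  fix \<epsilon> :: real assume e: "\<epsilon> > 0"
  obtain r where r: "r > 0" "\<And>h. norm h < r \<Longrightarrow> nrm (\<lambda>x. v (x + h) - v x) < \<epsilon> / 2"
    using assms(2)[unfolded L2_cont_def] e half_gt_zero by blast
  obtain s where s: "s > 0" "\<And>h. norm h < s \<Longrightarrow> nrm (\<lambda>x. u (x + h) - u x) < \<epsilon> / 2"
    using assms(4)[unfolded L2_cont_def] e half_gt_zero by blast
  have "nrm (\<lambda>x. (v (x + h) + u (x + h)) - (v x + u x)) < \<epsilon>" if "norm h < min r s" for h
  proof -
    have "nrm (\<lambda>x. (v (x + h) - v x) + (u (x + h) - u x))
        \<le> nrm (\<lambda>x. v (x + h) - v x) + nrm (\<lambda>x. u (x + h) - u x)"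
      using assms by (intro nrm_triangle[of _ UNIV _ UNIV] L2_diff L2_translate)
    then show ?thesis using r(2)[of h] s(2)[of h] that by (simp add: algebra_simps)
  qed
  with r(1) s(1) show "\<exists>r>0. \<forall>h. norm h < r \<longrightarrow> nrm (\<lambda>x. (v (x + h) + u (x + h)) - (v x + u x)) < \<epsilon>"
    by (intro exI[of _ "min r s"]) auto
qed

lemma L2_indicator:
  assumes "A \<in> sets borel" "emeasure lborel A < \<infinity>"
  shows "indicator A \<in> L2 UNIV"
proof (rule L2_I)
  have "integrable lborel (indicator A :: _ \<Rightarrow> real)"
    using assms by (simp add: integrable_indicator_iff)
  moreover have "(\<lambda>x. (indicator A x :: real)\<^sup>2) = indicator A"
    by (auto simp: indicator_def)
  ultimately show "integrable lborel (\<lambda>x. (indicator A x :: real)\<^sup>2)" by simp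
qed (use assms in simp)

text \<open>The points whose ball of radius 1/(n+1) lies in U form sets V n that exhaust U. A shift
  h shorter than this radius keeps V n inside U, so the overlap of U with its translate has at least
  the measure of V n, and the squared distance of the indicators, twice the measure of U minus twice
  the overlap, is at most twice the measure that V n misses.\<close>

lemma L2_cont_open:
  fixes U :: "(real^'n) set"
  assumes U: "open U" "emeasure lborel U < \<infinity>"
  shows "L2_cont (indicator U)"
  unfolding L2_cont_def
proof (intro allI impI)
  fix \<epsilon> :: real assume e: "\<epsilon> > 0"
  let ?d = "\<lambda>n::nat. 1 / real (Suc n)"
  define V where "V = (\<lambda>n. {x. ball x (?d n) \<subseteq> U})"
  have "V n = - (\<Union>y\<in>-U. ball y (?d n))" for n
    unfolding V_def by (auto simp: subset_iff dist_commute)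
  then have cl: "V n \<in> sets borel" for n
    by (metis borel_closed closed_Compl open_UN open_ball)
  have VU: "V n \<subseteq> U" for n unfolding V_def using centre_in_ball[of _ "?d n"] by fastforce
  have inc: "incseq V"
  proof (rule incseq_SucI)
    fix n
    have "?d (Suc n) \<le> ?d n" by (simp add: field_simps)
    then show "V n \<subseteq> V (Suc n)" unfolding V_def using subset_ball by blast
  qed
  have UV: "(\<Union>n. V n) = U"
  proof
    show "U \<subseteq> (\<Union>n. V n)"
    proof
      fix x assume "x \<in> U"
      then obtain r where r: "r > 0" "ball x r \<subseteq> U" using U(1) openE by blast
      then obtain n where "?d n < r" using nat_approx_posE by blast
      then have "x \<in> V n" unfolding V_def using r subset_ball[of "?d n" r x] by auto
      then show "x \<in> (\<Union>n. V n)" by blast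
    qed
  qed (use VU in blast)
  have "(\<lambda>n. measure lborel (V n)) \<longlonglongrightarrow> measure lborel (\<Union>n. V n)"
    by (rule Lim_measure_incseq) (use cl inc U UV in auto)
  then have "\<forall>\<^sub>F n in sequentially. \<bar>measure lborel (V n) - measure lborel U\<bar> < \<epsilon>\<^sup>2 / 2"
    unfolding UV tendsto_iff dist_real_def using e half_gt_zero zero_less_power by blast
  then obtain n where n: "\<bar>measure lborel (V n) - measure lborel U\<bar> < \<epsilon>\<^sup>2 / 2"
    by (auto simp: eventually_sequentially)
  let ?u = "indicator U :: real^'n \<Rightarrow> real"
  have L: "?u \<in> L2 UNIV" using U by (intro L2_indicator) auto
  have Vfin: "emeasure lborel (V n) < \<infinity>"
    using emeasure_mono[OF VU, of lborel n] U by (simp add: le_less_trans)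
  have "nrm (\<lambda>x. ?u (x + h) - ?u x) < \<epsilon>" if h: "norm h < ?d n" for h
  proof -
    note t = L2_translate[OF L, of h]
    have "(nrm (\<lambda>x. ?u (x + h) - ?u x))\<^sup>2 = 2 * ip ?u ?u - 2 * ip (\<lambda>x. ?u (x + h)) ?u"
      using L t by (simp add: nrm_sq ip_diff_left[of _ UNIV _ UNIV _ UNIV] ip_translate
          ip_diff_right[of _ UNIV _ UNIV _ UNIV] L2_diff ip_commute[of ?u "\<lambda>x. ?u (x + h)"])
    moreover have "ip ?u ?u = measure lborel U"
      unfolding ip_def by (simp flip: indicator_inter_arith)
    moreover have "measure lborel (V n) \<le> ip (\<lambda>x. ?u (x + h)) ?u"
    proof -
      have "measure lborel (V n) = (LINT x|lborel. indicator (V n) x)" by simp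
      also have "\<dots> \<le> ip (\<lambda>x. ?u (x + h)) ?u"
        unfolding ip_def
      proof (rule integral_mono)
        show "integrable lborel (indicator (V n) :: _ \<Rightarrow> real)"
          using cl Vfin by (simp add: integrable_indicator_iff)
        show "integrable lborel (\<lambda>x. ?u (x + h) * ?u x)" by (rule integrable_L2_mult[OF t L])
        show "indicator (V n) x \<le> ?u (x + h) * ?u x" for x
        proof (cases "x \<in> V n")
          case True
          then have "x + h \<in> U" "x \<in> U" using h VU unfolding V_def
            by (auto simp: subset_iff dist_norm)
          then show ?thesis by simp
        qed simp
      qed
      finally show ?thesis .
    qed
    ultimately have "(nrm (\<lambda>x. ?u (x + h) - ?u x))\<^sup>2 < \<epsilon>\<^sup>2" using n by linarith
    then show ?thesis using e by (simp add: power2_less_imp_less)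
  qed
  then show "\<exists>r>0. \<forall>h. norm h < r \<longrightarrow> nrm (\<lambda>x. ?u (x + h) - ?u x) < \<epsilon>"
    by (intro exI[of _ "?d n"]) auto
qed

text \<open>By outer regularity the set is replaced by an open superset U. The squared L^2 distance
  of the indicators is the measure of U - A, which is why the regularity is applied with the square
  of \<epsilon>.\<close>

lemma L2_cont_indicator:
  fixes A :: "(real^'n) set"
  assumes A: "A \<in> sets borel" "emeasure lborel A < \<infinity>"
  shows "L2_cont (indicator A)"
proof (rule L2_cont_limit)
  show "indicator A \<in> L2 UNIV" by (rule L2_indicator[OF A])
  fix \<epsilon> :: real assume e: "\<epsilon> > 0"
  obtain U where U: "open U" "A \<subseteq> U" "emeasure lborel (U - A) < \<epsilon>\<^sup>2"
    using outer_regular_lborel[OF A(1), of "\<epsilon>\<^sup>2"] e by auto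
  have D: "U - A \<in> sets borel" using U A by auto
  have "emeasure lborel U \<le> emeasure lborel (U - A) + emeasure lborel A"
    using emeasure_subadditive[of "U - A" lborel A] U(2) A D
    by (simp add: Un_absorb2)
  also have "\<dots> < \<infinity>" using U(3) A(2) by (simp add: ennreal_add_less_top less_trans)
  finally have Uf: "emeasure lborel U < \<infinity>" .
  have "ip (\<lambda>x. indicator U x - indicator A x) (\<lambda>x. indicator U x - indicator A x)
      = (LINT x|lborel. indicator (U - A) x)"
    unfolding ip_def using U(2) by (intro Bochner_Integration.integral_cong) (auto simp: indicator_def)
  also have "\<dots> = measure lborel (U - A)" by simp
  finally have "(nrm (\<lambda>x. indicator U x - indicator A x))\<^sup>2 = measure lborel (U - A)"
    by (simp add: nrm_sq)
  also have "\<dots> < \<epsilon>\<^sup>2" using U(3) e unfolding measure_def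
    by (metis enn2real_less_iff ennreal_less_top less_trans zero_less_power)
  finally have "nrm (\<lambda>x. indicator U x - indicator A x) < \<epsilon>"
    using e by (simp add: power2_less_imp_less)
  then show "\<exists>u\<in>L2 UNIV. L2_cont u \<and> nrm (\<lambda>x. u x - indicator A x) < \<epsilon>"
    using L2_cont_open[OF U(1) Uf] L2_indicator[of U] Uf U(1)
    by (intro bexI[of _ "indicator U"]) auto
qed

text \<open>Square integrability stands inside the induction statement because it has to be
  recovered for the constituents: summands and members of an increasing sequence are dominated by
  the whole, and dominated convergence turns the pointwise limit into an L^2 limit.\<close>

lemma L2_cont_nonneg:
  assumes "v \<in> borel_measurable (lborel :: (real^'n) measure)" "\<And>x. v x \<ge> 0"
  shows "v \<in> L2 UNIV \<longrightarrow> L2_cont v"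
  using assms
proof (induction v rule: borel_measurable_induct_real)
  case (set A)
  show ?case
  proof
    assume "(indicator A :: _ \<Rightarrow> real) \<in> L2 UNIV"
    then have "integrable lborel (\<lambda>x. (indicator A x :: real)\<^sup>2)" by (simp add: L2_def)
    moreover have "(\<lambda>x. (indicator A x :: real)\<^sup>2) = indicator A"
      by (auto simp: indicator_def)
    ultimately show "L2_cont (indicator A)"
      using set by (intro L2_cont_indicator) (auto simp: integrable_indicator_iff)
  qed
next
  case (mult u c)
  show ?case
  proof
    assume *: "(\<lambda>x. c * u x) \<in> L2 UNIV"
    show "L2_cont (\<lambda>x. c * u x)"
    proof (cases "c = 0")
      case True
      then show ?thesis by (auto simp: L2_cont_def nrm_def ip_zero_left intro: exI[of _ 1])
    next
      case False
      then have "u \<in> L2 UNIV" using L2_cmult[OF *, of "1 / c"] by simp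
      then show ?thesis using mult L2_cont_cmult by blast
    qed
  qed
next
  case (add u v)
  show ?case
  proof
    assume *: "(\<lambda>x. v x + u x) \<in> L2 UNIV"
    have "u \<in> L2 UNIV" "v \<in> L2 UNIV"
      by (rule L2_dominated[OF *]; use add in force)+
    then show "L2_cont (\<lambda>x. v x + u x)" using add L2_cont_add by blast
  qed
next
  case (seq U)
  show ?case
  proof
    assume v: "v \<in> L2 UNIV"
    have Ule: "U i x \<le> v x" for i x
      using seq.hyps by (intro incseq_le) (auto simp: incseq_def le_fun_def)
    have UL: "U i \<in> L2 UNIV" for i
      using seq.hyps(1,2) Ule[of i] order_trans[OF _ Ule[of i]]
      by (intro L2_dominated[OF v]) force+
    have vm: "v \<in> borel_measurable lborel" using L2_measurable[OF v] by simp
    have "(\<lambda>i. LINT x|lborel. (U i x - v x)\<^sup>2) \<longlonglongrightarrow> (LINT x|(lborel :: (real^'n) measure). (0::real))"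
    proof (rule integral_dominated_convergence[where w = "\<lambda>x. (v x)\<^sup>2"])
      show "integrable lborel (\<lambda>x. (v x)\<^sup>2)" using v by (simp add: L2_def)
      show "AE x in lborel. (\<lambda>i. (U i x - v x)\<^sup>2) \<longlonglongrightarrow> 0"
      proof (rule AE_I2)
        fix x :: "real^'n"
        have "(\<lambda>i. (U i x - v x)\<^sup>2) \<longlonglongrightarrow> (v x - v x)\<^sup>2"
          using seq.hyps by (intro tendsto_intros) auto
        then show "(\<lambda>i. (U i x - v x)\<^sup>2) \<longlonglongrightarrow> 0" by simp
      qed
      show "AE x in lborel. norm ((U i x - v x)\<^sup>2) \<le> (v x)\<^sup>2" for i
      proof (rule AE_I2)
        fix x
        show "norm ((U i x - v x)\<^sup>2) \<le> (v x)\<^sup>2"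
          using power_mono[of "v x - U i x" "v x" 2] Ule[of i x] seq.hyps(2)[of i x]
          by (simp add: power2_commute)
      qed
    qed (use seq.hyps vm in auto)
    then have lim: "(\<lambda>i. (nrm (\<lambda>x. U i x - v x))\<^sup>2) \<longlonglongrightarrow> 0"
      unfolding nrm_sq ip_def by (simp add: power2_eq_square)
    show "L2_cont v"
    proof (rule L2_cont_limit[OF v])
      fix \<epsilon> :: real assume e: "\<epsilon> > 0"
      then have "\<forall>\<^sub>F i in sequentially. (nrm (\<lambda>x. U i x - v x))\<^sup>2 < \<epsilon>\<^sup>2"
        using order_tendstoD(2)[OF lim, of "\<epsilon>\<^sup>2"] by simp
      then obtain i where "(nrm (\<lambda>x. U i x - v x))\<^sup>2 < \<epsilon>\<^sup>2"
        by (auto simp: eventually_sequentially)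
      then have "nrm (\<lambda>x. U i x - v x) < \<epsilon>" using e by (simp add: power2_less_imp_less)
      then show "\<exists>u\<in>L2 UNIV. L2_cont u \<and> nrm (\<lambda>x. u x - v x) < \<epsilon>"
        using UL seq.IH by blast
    qed
  qed
qed

lemma L2_cont:
  assumes "v \<in> L2 A"
  shows "L2_cont v"
proof -
  have m: "v \<in> borel_measurable lborel" using L2_measurable[OF assms] by simp
  have "(\<lambda>x. max 0 (v x)) \<in> L2 UNIV" "(\<lambda>x. max 0 (- v x)) \<in> L2 UNIV"
    by (rule L2_dominated[OF L2_UNIV[OF assms]]; use m in auto)+
  then have "L2_cont (\<lambda>x. max 0 (v x) + (-1) * max 0 (- v x))"
    using m by (intro L2_cont_add L2_cont_cmult L2_cmult L2_cont_nonneg[THEN mp]) auto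
  moreover have "(\<lambda>x. max 0 (v x) + (-1) * max 0 (- v x)) = v" by auto
  ultimately show ?thesis by simp
qed


section \<open>Taylor estimates for test functions\<close>

lemma test_functions_bounded:
  assumes "\<phi> \<in> test_functions \<Omega>"
  shows "\<exists>B>0. \<forall>x. \<bar>\<phi> x\<bar> \<le> B"
proof -
  obtain K where K: "compact K" "\<forall>x. x \<notin> K \<longrightarrow> \<phi> x = 0" and s: "smooth_fun \<phi>"
    using assms unfolding test_functions_iff by blast
  have "bounded (\<phi> ` K)"
    using K(1) smooth_fun_continuous[OF s] compact_continuous_image compact_imp_bounded by blast
  then obtain B where B: "B > 0" "\<And>x. x \<in> K \<Longrightarrow> \<bar>\<phi> x\<bar> \<le> B"
    by (auto simp: bounded_pos)
  have "\<bar>\<phi> x\<bar> \<le> B" for x using B K(2) by (cases "x \<in> K") auto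
  with B(1) show ?thesis by blast
qed

lemma test_functions_support:
  assumes "\<phi> \<in> test_functions \<Omega>"
  shows "\<exists>R>0. \<forall>x. norm x \<ge> R \<longrightarrow> \<phi> x = 0"
proof -
  obtain K where K: "compact K" "\<forall>x. x \<notin> K \<longrightarrow> \<phi> x = 0"
    using assms unfolding test_functions_iff by blast
  obtain R where "R > 0" "\<And>x. x \<in> K \<Longrightarrow> norm x \<le> R"
    using compact_imp_bounded[OF K(1)] by (auto simp: bounded_pos)
  with K(2) show ?thesis by (intro exI[of _ "R + 1"]) force
qed

lemma test_functions_measurable:
  "\<phi> \<in> test_functions \<Omega> \<Longrightarrow> \<phi> \<in> borel_measurable borel"
  by (intro borel_measurable_continuous_onI smooth_fun_continuous test_functions_smooth)

lemma integrable_bounded_support: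
  fixes f :: "real^'n \<Rightarrow> real"
  assumes "f \<in> borel_measurable borel" "\<And>x. norm x < R \<Longrightarrow> \<bar>f x\<bar> \<le> B"
    "\<And>x. norm x \<ge> R \<Longrightarrow> f x = 0"
  shows "integrable lborel f" "\<bar>LINT x|lborel. f x\<bar> \<le> B * measure lborel (ball (0::real^'n) R)"
proof -
  have i: "integrable lborel (\<lambda>x::real^'n. B * indicator (ball 0 R) x)"
    using emeasure_lborel_ball_finite[of "0::real^'n" R]
    by (intro integrable_mult_right) (simp add: integrable_indicator_iff less_top)
  have b: "\<bar>f x\<bar> \<le> B * indicator (ball 0 R) x" for x
    using assms(2)[of x] assms(3)[of x] by (cases "norm x < R") (auto simp: indicator_def dist_norm)
  show f: "integrable lborel f"
  proof (rule Bochner_Integration.integrable_bound[OF i])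
    have "norm (f x) \<le> norm (B * indicator (ball 0 R) x)" for x
      using order_trans[OF b[of x] abs_ge_self] unfolding real_norm_def .
    then show "AE x in lborel. norm (f x) \<le> norm (B * indicator (ball 0 R) x)" by (rule AE_I2)
  qed (use assms(1) in simp)
  have "\<bar>LINT x|lborel. f x\<bar> \<le> (LINT x|lborel. \<bar>f x\<bar>)"
    using integral_norm_bound[of lborel f] by simp
  also have "\<dots> \<le> (LINT x|lborel. B * indicator (ball (0::real^'n) R) x)"
    by (rule integral_mono) (use i f b in auto)
  finally show "\<bar>LINT x|lborel. f x\<bar> \<le> B * measure lborel (ball (0::real^'n) R)" by simp
qed

lemma test_functions_L2:
  assumes "\<phi> \<in> test_functions \<Omega>"
  shows "\<phi> \<in> L2 \<Omega>"
proof -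
  obtain B R where B: "\<forall>x. \<bar>\<phi> x\<bar> \<le> B" and R: "\<forall>x. norm x \<ge> R \<longrightarrow> \<phi> x = 0"
    using test_functions_bounded[OF assms] test_functions_support[OF assms] by blast
  have "integrable lborel (\<lambda>x. (\<phi> x)\<^sup>2)"
  proof (rule integrable_bounded_support(1)[where R = R and B = "B\<^sup>2"])
    show "\<bar>(\<phi> x)\<^sup>2\<bar> \<le> B\<^sup>2" for x using B[rule_format, of x] by (simp add: abs_le_square_iff[symmetric])
    show "(\<lambda>x. (\<phi> x)\<^sup>2) \<in> borel_measurable borel"
      using test_functions_measurable[OF assms] by (rule borel_measurable_power)
  qed (use R in simp)
  moreover have "\<phi> x = 0" if "x \<notin> \<Omega>" for x
    using that assms unfolding test_functions_iff by blast
  ultimately show ?thesis using assms by (auto simp: L2_def test_functions_measurable)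
qed

lemma frechet_derivative_partial:
  fixes f :: "real^'n \<Rightarrow> real"
  assumes "f differentiable (at x)"
  shows "frechet_derivative f (at x) h = (\<Sum>i\<in>UNIV. h $ i * partial_deriv i f x)"
proof -
  have lin: "linear (frechet_derivative f (at x))"
    using has_derivative_linear[OF has_derivative_frechet[OF assms]] .
  have "h = (\<Sum>i\<in>UNIV. h $ i *\<^sub>R axis i 1)"
    using basis_expansion[of h] by (simp add: scalar_mult_eq_scaleR)
  then have "frechet_derivative f (at x) h = frechet_derivative f (at x) (\<Sum>i\<in>UNIV. h $ i *\<^sub>R axis i 1)"
    by simp
  also have "\<dots> = (\<Sum>i\<in>UNIV. h $ i * frechet_derivative f (at x) (axis i 1))"
    using lin by (simp add: linear_sum linear_scale)
  finally show ?thesis by (simp add: partial_deriv_def)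
qed

lemma line_derivative:
  fixes f :: "real^'n \<Rightarrow> real"
  assumes "smooth_fun f"
  shows "((\<lambda>t. f (x + t *\<^sub>R h)) has_real_derivative
    (\<Sum>i\<in>UNIV. h $ i * partial_deriv i f (x + t *\<^sub>R h))) (at t)"
proof -
  have "((\<lambda>t. x + t *\<^sub>R h) has_derivative (\<lambda>s. s *\<^sub>R h)) (at t)"
    by (auto intro!: derivative_eq_intros)
  from has_derivative_compose[OF this has_derivative_frechet[OF smooth_fun_differentiable[OF assms]]]
  have "((\<lambda>t. f (x + t *\<^sub>R h)) has_derivative
      (\<lambda>s. frechet_derivative f (at (x + t *\<^sub>R h)) (s *\<^sub>R h))) (at t)" .
  moreover have "(\<lambda>s. frechet_derivative f (at (x + t *\<^sub>R h)) (s *\<^sub>R h))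
      = (*) (\<Sum>i\<in>UNIV. h $ i * partial_deriv i f (x + t *\<^sub>R h))"
    using frechet_derivative_partial[OF smooth_fun_differentiable[OF assms]]
    by (auto simp: sum_distrib_left sum_distrib_right mult_ac)
  ultimately show ?thesis by (simp add: has_field_derivative_def)
qed

lemma sum_component_bound:
  fixes h :: "real^'n"
  assumes "\<And>i. \<bar>a i\<bar> \<le> B i * c"
  shows "\<bar>\<Sum>i\<in>UNIV. h $ i * a i\<bar> \<le> (\<Sum>i\<in>UNIV. B i) * (norm h * c)"
proof -
  have "\<bar>\<Sum>i\<in>UNIV. h $ i * a i\<bar> \<le> (\<Sum>i\<in>UNIV. \<bar>h $ i\<bar> * \<bar>a i\<bar>)"
    using sum_abs[of "\<lambda>i. h $ i * a i" UNIV] by (simp add: abs_mult)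
  also have "\<dots> \<le> (\<Sum>i\<in>UNIV. norm h * (B i * c))"
    by (intro sum_mono mult_mono component_le_norm_cart assms) auto
  also have "\<dots> = (\<Sum>i\<in>UNIV. B i) * (norm h * c)"
    by (simp add: sum_distrib_left sum_distrib_right mult_ac)
  finally show ?thesis .
qed

lemma test_functions_Lipschitz:
  assumes "\<phi> \<in> test_functions UNIV"
  shows "\<exists>B>0. \<forall>x h. \<bar>\<phi> (x + h) - \<phi> x\<bar> \<le> B * norm h"
proof -
  have "\<forall>i. \<exists>B>0. \<forall>x. \<bar>partial_deriv i \<phi> x\<bar> \<le> B"
    using assms test_functions_partial test_functions_bounded by blast
  then obtain B where B: "\<And>i. B i > 0" "\<And>i x. \<bar>partial_deriv i \<phi> x\<bar> \<le> B i" by metis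
  have "\<bar>\<phi> (x + h) - \<phi> x\<bar> \<le> sum B UNIV * norm h" for x h
  proof -
    obtain t where "\<phi> (x + 1 *\<^sub>R h) - \<phi> (x + 0 *\<^sub>R h)
        = (1 - 0) * (\<Sum>i\<in>UNIV. h $ i * partial_deriv i \<phi> (x + t *\<^sub>R h))"
      using MVT2[of 0 1 "\<lambda>t. \<phi> (x + t *\<^sub>R h)" "\<lambda>t. \<Sum>i\<in>UNIV. h $ i * partial_deriv i \<phi> (x + t *\<^sub>R h)"]
        line_derivative[OF test_functions_smooth[OF assms]] by auto
    moreover have "\<bar>\<Sum>i\<in>UNIV. h $ i * partial_deriv i \<phi> (x + t *\<^sub>R h)\<bar> \<le> sum B UNIV * (norm h * 1)"
      by (rule sum_component_bound) (simp add: B)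
    ultimately show ?thesis by simp
  qed
  moreover have "sum B UNIV > 0" using B(1) by (intro sum_pos) auto
  ultimately show ?thesis by blast
qed

lemma test_functions_Taylor1:
  assumes "\<phi> \<in> test_functions UNIV"
  shows "\<exists>B>0. \<forall>x h. \<bar>\<phi> (x + h) - \<phi> x - (\<Sum>i\<in>UNIV. h $ i * partial_deriv i \<phi> x)\<bar> \<le> B * (norm h)\<^sup>2"
proof -
  have "\<forall>i. \<exists>B>0. \<forall>x h. \<bar>partial_deriv i \<phi> (x + h) - partial_deriv i \<phi> x\<bar> \<le> B * norm h"
    using test_functions_Lipschitz[OF test_functions_partial[OF assms]] by (rule allI)
  then obtain B where B: "\<And>i. B i > 0"
    "\<And>i x h. \<bar>partial_deriv i \<phi> (x + h) - partial_deriv i \<phi> x\<bar> \<le> B i * norm h" by metis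
  have "\<bar>\<phi> (x + h) - \<phi> x - (\<Sum>i\<in>UNIV. h $ i * partial_deriv i \<phi> x)\<bar> \<le> sum B UNIV * (norm h)\<^sup>2" for x h
  proof -
    obtain t where t: "0 < t" "t < 1" and "\<phi> (x + 1 *\<^sub>R h) - \<phi> (x + 0 *\<^sub>R h)
        = (1 - 0) * (\<Sum>i\<in>UNIV. h $ i * partial_deriv i \<phi> (x + t *\<^sub>R h))"
      using MVT2[of 0 1 "\<lambda>t. \<phi> (x + t *\<^sub>R h)" "\<lambda>t. \<Sum>i\<in>UNIV. h $ i * partial_deriv i \<phi> (x + t *\<^sub>R h)"]
        line_derivative[OF test_functions_smooth[OF assms]] by auto
    then have "\<phi> (x + h) - \<phi> x - (\<Sum>i\<in>UNIV. h $ i * partial_deriv i \<phi> x)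
        = (\<Sum>i\<in>UNIV. h $ i * (partial_deriv i \<phi> (x + t *\<^sub>R h) - partial_deriv i \<phi> x))"
      by (simp add: right_diff_distrib sum_subtractf)
    also have "\<bar>\<dots>\<bar> \<le> sum B UNIV * (norm h * norm h)"
    proof (rule sum_component_bound)
      fix i
      have "\<bar>partial_deriv i \<phi> (x + t *\<^sub>R h) - partial_deriv i \<phi> x\<bar> \<le> B i * norm (t *\<^sub>R h)"
        by (rule B)
      also have "\<dots> \<le> B i * norm h"
        using t B(1)[of i] by (auto intro!: mult_left_mono mult_left_le_one_le simp: less_imp_le)
      finally show "\<bar>partial_deriv i \<phi> (x + t *\<^sub>R h) - partial_deriv i \<phi> x\<bar> \<le> B i * norm h" .
    qed
    finally show ?thesis by (simp add: power2_eq_square)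
  qed
  moreover have "sum B UNIV > 0" using B(1) by (intro sum_pos) auto
  ultimately show ?thesis by blast
qed

definition hessian_form :: "(real^'n \<Rightarrow> real) \<Rightarrow> real^'n \<Rightarrow> real^'n \<Rightarrow> real" where
  "hessian_form \<phi> h x = (\<Sum>i\<in>UNIV. h $ i * (\<Sum>j\<in>UNIV. h $ j * partial_deriv j (partial_deriv i \<phi>) x))"

text \<open>One use of the mean value theorem along the line suffices: after subtracting t^2 times
  the Hessian form, the derivative pairs h with the difference of the first order Taylor remainders
  of the gradient at t h and - t h. Each remainder is of order |h|^2, and the pairing adds one more
  factor |h|.\<close>

lemma test_functions_Taylor2:
  fixes \<phi> :: "real^'n \<Rightarrow> real"
  assumes "\<phi> \<in> test_functions UNIV"
  shows "\<exists>B>0. \<forall>x h. \<bar>\<phi> (x + h) + \<phi> (x - h) - 2 * \<phi> x - hessian_form \<phi> h x\<bar> \<le> B * (norm h) ^ 3"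
proof -
  have "\<forall>i. \<exists>B>0. \<forall>(x::real^'n) (h::real^'n). \<bar>partial_deriv i \<phi> (x + h) - partial_deriv i \<phi> x
      - (\<Sum>j\<in>UNIV. h $ j * partial_deriv j (partial_deriv i \<phi>) x)\<bar> \<le> B * (norm h)\<^sup>2"
    using test_functions_Taylor1[OF test_functions_partial[OF assms]] by (rule allI)
  from choice[OF this] obtain B where B': "\<forall>i. B i > 0 \<and> (\<forall>x h. \<bar>partial_deriv i \<phi> (x + h) - partial_deriv i \<phi> x
      - (\<Sum>j\<in>UNIV. h $ j * partial_deriv j (partial_deriv i \<phi>) x)\<bar> \<le> B i * (norm h)\<^sup>2)" ..
  note B = B'[THEN spec, THEN conjunct1] B'[THEN spec, THEN conjunct2, THEN spec, THEN spec]
  have "\<bar>\<phi> (x + h) + \<phi> (x - h) - 2 * \<phi> x - hessian_form \<phi> h x\<bar> \<le> (\<Sum>i\<in>UNIV. 2 * B i) * (norm h) ^ 3" for x h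
  proof -
    let ?Q = "hessian_form \<phi> h x"
    let ?d = "\<lambda>i. partial_deriv i \<phi>"
    let ?H = "\<lambda>t. \<phi> (x + t *\<^sub>R h) + \<phi> (x + t *\<^sub>R (- h)) - t\<^sup>2 * ?Q"
    let ?H' = "\<lambda>t. (\<Sum>i\<in>UNIV. h $ i * ?d i (x + t *\<^sub>R h))
      + (\<Sum>i\<in>UNIV. (- h) $ i * ?d i (x + t *\<^sub>R (- h))) - 2 * t * ?Q"
    note ld = line_derivative[OF test_functions_smooth[OF assms]]
    have "(?H has_real_derivative ?H' t) (at t)" for t
    proof -
      have "((\<lambda>t. t\<^sup>2 * ?Q) has_real_derivative 2 * t * ?Q) (at t)"
        by (auto intro!: derivative_eq_intros)
      from DERIV_diff[OF DERIV_add[OF ld[of x h t] ld[of x "- h" t]] this] show ?thesis .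
    qed
    then have "\<exists>t>0. t < 1 \<and> ?H 1 - ?H 0 = (1 - 0) * ?H' t"
      by (intro MVT2) simp_all
    then obtain t where t: "0 < t" "t < 1" and H: "?H 1 - ?H 0 = (1 - 0) * ?H' t" by blast
    have "\<phi> (x + h) + \<phi> (x - h) - 2 * \<phi> x - ?Q = ?H 1 - ?H 0" by simp
    also have "\<dots> = ?H' t" unfolding H by simp
    \<comment> \<open>The values of the gradient at x cancel, and the two linear terms together
      account for \<open>2 * t * ?Q\<close>.\<close>
    also have "\<dots> = (\<Sum>i\<in>UNIV. h $ i *
        ((?d i (x + t *\<^sub>R h) - ?d i x - (\<Sum>j\<in>UNIV. (t *\<^sub>R h) $ j * partial_deriv j (?d i) x))
       - (?d i (x + t *\<^sub>R (- h)) - ?d i x - (\<Sum>j\<in>UNIV. (t *\<^sub>R (- h)) $ j * partial_deriv j (?d i) x))))"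
      unfolding hessian_form_def
      by (simp add: right_diff_distrib sum_subtractf sum.distrib sum_distrib_left sum_negf
          algebra_simps)
    also have "\<bar>\<dots>\<bar> \<le> (\<Sum>i\<in>UNIV. 2 * B i) * (norm h * (norm h)\<^sup>2)"
    proof (rule sum_component_bound)
      fix i
      have b: "\<bar>?d i (x + t *\<^sub>R k) - ?d i x - (\<Sum>j\<in>UNIV. (t *\<^sub>R k) $ j * partial_deriv j (?d i) x)\<bar>
          \<le> B i * (norm k)\<^sup>2" for k
      proof -
        have "B i * (norm (t *\<^sub>R k))\<^sup>2 \<le> B i * (norm k)\<^sup>2"
          using t B(1)[of i]
          by (intro mult_left_mono power_mono) (auto intro: mult_left_le_one_le simp: less_imp_le)
        with B(2)[of i x "t *\<^sub>R k"] show ?thesis by linarith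
      qed
      show "\<bar>(?d i (x + t *\<^sub>R h) - ?d i x - (\<Sum>j\<in>UNIV. (t *\<^sub>R h) $ j * partial_deriv j (?d i) x))
       - (?d i (x + t *\<^sub>R (- h)) - ?d i x - (\<Sum>j\<in>UNIV. (t *\<^sub>R (- h)) $ j * partial_deriv j (?d i) x))\<bar>
        \<le> 2 * B i * (norm h)\<^sup>2"
        using order_trans[OF abs_triangle_ineq4 add_mono[OF b[of h] b[of "- h"]]]
        by (simp only: norm_minus_cancel mult_2 distrib_right)
    qed
    finally show ?thesis by (simp add: power2_eq_square power3_eq_cube mult_ac)
  qed
  moreover have "(\<Sum>i\<in>UNIV. 2 * B i) > 0" using B(1) by (intro sum_pos) auto
  ultimately show ?thesis by blast
qed

section \<open>Integration by parts\<close>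

lemma test_functions_integrable: "\<phi> \<in> test_functions UNIV \<Longrightarrow> integrable lborel \<phi>"
  using test_functions_bounded[of \<phi> UNIV] test_functions_support[of \<phi> UNIV]
  by (meson integrable_bounded_support(1) test_functions_measurable)

text \<open>The integral of a difference quotient vanishes by translation invariance.\<close>

lemma integral_partial_deriv_zero:
  fixes \<phi> :: "real^'n \<Rightarrow> real"
  assumes "\<phi> \<in> test_functions UNIV"
  shows "(LINT x|lborel. partial_deriv i \<phi> x) = 0"
proof -
  obtain B where B: "B > 0" "\<And>x h. \<bar>\<phi> (x + h) - \<phi> x - (\<Sum>i\<in>UNIV. h $ i * partial_deriv i \<phi> x)\<bar> \<le> B * (norm h)\<^sup>2"
    using test_functions_Taylor1[OF assms] by blast
  obtain R where R: "\<And>x. norm x \<ge> R \<Longrightarrow> \<phi> x = 0"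
    using test_functions_support[OF assms] by blast
  obtain R' where R': "\<And>x. norm x \<ge> R' \<Longrightarrow> partial_deriv i \<phi> x = 0"
    using test_functions_support[OF test_functions_partial[OF assms]] by blast
  note m [measurable] = test_functions_measurable[OF assms] test_functions_measurable[OF test_functions_partial[OF assms, of i]]
  note int = test_functions_integrable[OF assms] test_functions_integrable[OF test_functions_partial[OF assms, of i]]
  \<comment> \<open>The ball contains the supports of \<open>\<phi>\<close>, of its translates by
    vectors of length at most 1, and of the partial derivative, so V does not depend on t.\<close>
  define V where "V = measure lborel (ball (0::real^'n) (max (R + 1) R'))"
  let ?I = "LINT x|lborel. partial_deriv i \<phi> x"
  have key: "\<bar>?I\<bar> \<le> B * V * t" if t: "0 < t" "t \<le> 1" for t
  proof -
    let ?h = "t *\<^sub>R axis i 1 :: real^'n"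
    let ?f = "\<lambda>x. \<phi> (x + ?h) - \<phi> x - t * partial_deriv i \<phi> x"
    have s: "(\<Sum>j\<in>UNIV. ?h $ j * partial_deriv j \<phi> x) = t * partial_deriv i \<phi> x" for x
      by (simp add: axis_def if_distrib if_distribR cong: if_cong)
    have nh: "norm ?h = t" using t by simp
    have "\<bar>LINT x|lborel. ?f x\<bar> \<le> (B * t\<^sup>2) * V"
      unfolding V_def
    proof (rule integrable_bounded_support(2))
      show "?f \<in> borel_measurable borel" by measurable
      show "\<bar>?f x\<bar> \<le> B * t\<^sup>2" for x using B(2)[of x ?h] unfolding s nh .
      show "?f x = 0" if "max (R + 1) R' \<le> norm x" for x
      proof -
        have "norm (x + ?h) \<ge> norm x - norm ?h" by (metis norm_diff_ineq)
        then have "norm (x + ?h) \<ge> R" using that nh t by linarith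
        then show ?thesis using that R R' by simp
      qed
    qed
    moreover have "(LINT x|lborel. ?f x) = - t * ?I"
    proof -
      have "integrable lborel (\<lambda>x. \<phi> (x + ?h))" using integrable_translate[OF m(1)] int by blast
      then have "(LINT x|lborel. ?f x) = (LINT x|lborel. \<phi> (x + ?h)) - (LINT x|lborel. \<phi> x)
          - (LINT x|lborel. t * partial_deriv i \<phi> x)"
        using int by (subst Bochner_Integration.integral_diff) (auto intro: Bochner_Integration.integrable_diff)
      then show ?thesis unfolding integral_translate[OF m(1), of ?h] by simp
    qed
    ultimately have "t * \<bar>?I\<bar> \<le> t * (B * V * t)"
      using t by (simp add: abs_mult power2_eq_square mult_ac)
    then show ?thesis using t by simp
  qed
  have "\<bar>?I\<bar> \<le> 0"
  proof (rule field_le_epsilon)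
    fix e :: real assume e: "e > 0"
    have BV: "B * V \<ge> 0" using B(1) by (simp add: V_def)
    define t where "t = min 1 (e / (B * V + 1))"
    have "t > 0" "t \<le> 1" using e BV by (auto simp: t_def)
    then have "\<bar>?I\<bar> \<le> B * V * t" by (rule key)
    also have "\<dots> \<le> (B * V + 1) * (e / (B * V + 1))"
      using BV \<open>t > 0\<close> by (intro mult_mono) (auto simp: t_def)
    finally show "\<bar>?I\<bar> \<le> 0 + e" using BV by simp
  qed
  then show ?thesis by simp
qed

lemma ip_partial_deriv:
  assumes "\<phi> \<in> test_functions UNIV" "\<psi> \<in> test_functions UNIV"
  shows "ip \<phi> (partial_deriv i \<psi>) = - ip (partial_deriv i \<phi>) \<psi>"
proof -
  note s = test_functions_smooth[OF assms(1)] test_functions_smooth[OF assms(2)]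
  have "(LINT x|lborel. partial_deriv i (\<lambda>x. \<phi> x * \<psi> x) x) = 0"
    by (intro integral_partial_deriv_zero test_functions_mult s assms)
  moreover have "partial_deriv i (\<lambda>x. \<phi> x * \<psi> x) = (\<lambda>x. \<phi> x * partial_deriv i \<psi> x + partial_deriv i \<phi> x * \<psi> x)"
    using partial_deriv_mult[OF smooth_fun_differentiable[OF s(1)] smooth_fun_differentiable[OF s(2)]] by blast
  ultimately show ?thesis
    using integrable_L2_mult[OF test_functions_L2[OF assms(1)] test_functions_L2[OF test_functions_partial[OF assms(2), of i]]]
      integrable_L2_mult[OF test_functions_L2[OF test_functions_partial[OF assms(1), of i]] test_functions_L2[OF assms(2)]]
    by (simp add: ip_def)
qed

lemma partial_deriv_affine:
  assumes "smooth_fun f"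
  shows "partial_deriv i (\<lambda>y. f (c *\<^sub>R y + b)) = (\<lambda>y. c * partial_deriv i f (c *\<^sub>R y + b))"
    "(\<lambda>y. f (c *\<^sub>R y + b)) differentiable (at y)"
proof -
  have d: "((\<lambda>y. f (c *\<^sub>R y + b)) has_derivative (\<lambda>h. frechet_derivative f (at (c *\<^sub>R y + b)) (c *\<^sub>R h))) (at y)" for y
    by (rule has_derivative_compose[OF _ has_derivative_frechet[OF smooth_fun_differentiable[OF assms]]])
       (auto intro!: derivative_eq_intros)
  then show "(\<lambda>y. f (c *\<^sub>R y + b)) differentiable (at y)" unfolding differentiable_def by blast
  have "frechet_derivative f (at z) (c *\<^sub>R h) = c * frechet_derivative f (at z) h" for z h
    using linear_scale[OF has_derivative_linear[OF has_derivative_frechet[OF smooth_fun_differentiable[OF assms]]]]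
    by simp
  then show "partial_deriv i (\<lambda>y. f (c *\<^sub>R y + b)) = (\<lambda>y. c * partial_deriv i f (c *\<^sub>R y + b))"
    using partial_deriv_eqI[OF d] by (auto simp: partial_deriv_def)
qed

lemma C_k_affine: "smooth_fun f \<Longrightarrow> C_k k (\<lambda>y. f (c *\<^sub>R y + b))"
proof (induction k arbitrary: f)
  case 0
  then show ?case using smooth_fun_continuous[OF 0, of UNIV]
    by (auto intro!: continuous_on_compose2[of UNIV f] continuous_intros)
next
  case (Suc k)
  then show ?case
    by (auto simp: partial_deriv_affine intro!: C_k_mult smooth_fun_partial)
qed

lemma test_functions_affine:
  assumes "\<phi> \<in> test_functions UNIV" "c \<noteq> 0"
  shows "(\<lambda>y. \<phi> (c *\<^sub>R y + b)) \<in> test_functions UNIV"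
proof -
  obtain R where R: "R > 0" "\<And>x. norm x \<ge> R \<Longrightarrow> \<phi> x = 0"
    using test_functions_support[OF assms(1)] by blast
  have "\<phi> (c *\<^sub>R y + b) = 0" if "y \<notin> cball 0 ((R + norm b) / \<bar>c\<bar>)" for y
  proof (rule R(2))
    have "R + norm b \<le> \<bar>c\<bar> * norm y" using that assms(2) by (simp add: field_simps)
    moreover have "norm (c *\<^sub>R y) - norm b \<le> norm (c *\<^sub>R y + b)" by (rule norm_diff_ineq)
    ultimately show "R \<le> norm (c *\<^sub>R y + b)" by simp
  qed
  moreover have "smooth_fun (\<lambda>y. \<phi> (c *\<^sub>R y + b))"
    using C_k_affine[OF test_functions_smooth[OF assms(1)]] by (simp add: smooth_fun_def)
  ultimately show ?thesis unfolding test_functions_iff by (blast intro: compact_cball)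
qed


section \<open>Mollification\<close>

text \<open>Equivalently the average of v (x + z) with weight k z, that is, a convolution with the
  reflected kernel. A kernel concentrated near a vector reads v ahead of x in that direction; since
  x enters as y - x, derivatives of the kernel come with a minus sign.\<close>

definition moll :: "(real^'n \<Rightarrow> real) \<Rightarrow> (real^'n \<Rightarrow> real) \<Rightarrow> real^'n \<Rightarrow> real" where
  "moll k v x = (LINT y|lborel. k (y - x) * v y)"

lemma L2_mono: "v \<in> L2 A \<Longrightarrow> A \<subseteq> B \<Longrightarrow> v \<in> L2 B"
  unfolding L2_def by (auto elim: AE_mp)

lemma L2_integrable:
  fixes v :: "real^'n \<Rightarrow> real"
  assumes "bounded \<Omega>" "v \<in> L2 \<Omega>"
  shows "integrable lborel v"
proof -
  obtain R where R: "\<Omega> \<subseteq> ball 0 R" using bounded_subset_ballD[OF assms(1)] by blast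
  have i: "indicator (ball 0 R) \<in> L2 (UNIV :: (real^'n) set)"
    by (rule L2_indicator) (use emeasure_lborel_ball_finite in auto)
  have "AE x in lborel. v x * indicator (ball 0 R) x = v x"
  proof -
    have "AE x in lborel. x \<notin> \<Omega> \<longrightarrow> v x = 0" using assms(2) by (simp add: L2_def)
    then show ?thesis by eventually_elim (use R in \<open>auto simp: indicator_def\<close>)
  qed
  moreover have "integrable lborel (\<lambda>x. v x * indicator (ball 0 R) x)"
    by (rule integrable_L2_mult[OF assms(2) i])
  ultimately show ?thesis
    by (subst (asm) integrable_cong_AE)
       (use L2_measurable[OF assms(2)] in \<open>auto intro!: borel_measurable_times borel_measurable_indicator\<close>)
qed

lemma integrable_pairI:
  fixes f :: "(real^'n) \<times> (real^'n) \<Rightarrow> real"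
  assumes [measurable]: "f \<in> borel_measurable (lborel \<Otimes>\<^sub>M lborel)"
    and "\<And>x. (\<integral>\<^sup>+y. ennreal \<bar>f (x, y)\<bar> \<partial>lborel) \<le> g x"
    and "(\<integral>\<^sup>+x. g x \<partial>lborel) < \<infinity>"
  shows "integrable (lborel \<Otimes>\<^sub>M lborel) f"
proof (rule integrableI_bounded)
  have "(\<integral>\<^sup>+p. ennreal (norm (f p)) \<partial>(lborel \<Otimes>\<^sub>M lborel))
      = (\<integral>\<^sup>+x. \<integral>\<^sup>+y. ennreal \<bar>f (x, y)\<bar> \<partial>lborel \<partial>lborel)"
    by (subst lborel.nn_integral_fst[symmetric]) auto
  also have "\<dots> \<le> (\<integral>\<^sup>+x. g x \<partial>lborel)" by (rule nn_integral_mono) (rule assms(2))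
  finally show "(\<integral>\<^sup>+p. ennreal (norm (f p)) \<partial>(lborel \<Otimes>\<^sub>M lborel)) < \<infinity>"
    using assms(3) by (rule le_less_trans)
qed simp

lemma integrable_bounded_mult:
  fixes v :: "'a \<Rightarrow> real"
  assumes "integrable M v" "k \<in> borel_measurable M" "\<And>y. \<bar>k y\<bar> \<le> B"
  shows "integrable M (\<lambda>y. k y * v y)" "\<bar>LINT y|M. k y * v y\<bar> \<le> B * (LINT y|M. \<bar>v y\<bar>)"
proof -
  have i: "integrable M (\<lambda>y. B * \<bar>v y\<bar>)" using assms(1) by (intro integrable_mult_right integrable_abs)
  have b: "\<bar>k y * v y\<bar> \<le> B * \<bar>v y\<bar>" for y
    unfolding abs_mult using assms(3) by (intro mult_right_mono) auto
  show 1: "integrable M (\<lambda>y. k y * v y)"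
  proof (rule Bochner_Integration.integrable_bound[OF i])
    have "norm (k y * v y) \<le> norm (B * \<bar>v y\<bar>)" for y
      using order_trans[OF b[of y] abs_ge_self] unfolding real_norm_def .
    then show "AE y in M. norm (k y * v y) \<le> norm (B * \<bar>v y\<bar>)" by (rule AE_I2)
  qed (use assms borel_measurable_integrable[OF assms(1)] in simp)
  have "\<bar>LINT y|M. k y * v y\<bar> \<le> (LINT y|M. \<bar>k y * v y\<bar>)"
    using integral_norm_bound[of M "\<lambda>y. k y * v y"] by simp
  also have "\<dots> \<le> (LINT y|M. B * \<bar>v y\<bar>)"
    by (rule integral_mono[OF integrable_abs[OF 1] i b])
  finally show "\<bar>LINT y|M. k y * v y\<bar> \<le> B * (LINT y|M. \<bar>v y\<bar>)" by simp
qed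

lemma test_functions_shift_measurable:
  assumes "k \<in> test_functions UNIV"
  shows "(\<lambda>y. k (y - x)) \<in> borel_measurable lborel"
  using measurable_compose[of "\<lambda>y. y - x" borel borel k borel] test_functions_measurable[OF assms]
  by simp

lemma integrable_moll:
  assumes "k \<in> test_functions UNIV" "integrable lborel v"
  shows "integrable lborel (\<lambda>y. k (y - x) * v y)"
proof -
  obtain B where B: "\<forall>x. \<bar>k x\<bar> \<le> B" using test_functions_bounded[OF assms(1)] by blast
  show ?thesis
    by (rule integrable_bounded_mult(1)[OF assms(2) test_functions_shift_measurable[OF assms(1)]])
       (rule B[rule_format])
qed

lemma has_derivative_quadratic:
  fixes f :: "real^'n \<Rightarrow> real"
  assumes "\<And>h. \<bar>f (x + h) - f x - (\<Sum>i\<in>UNIV. h $ i * c i)\<bar> \<le> B * (norm h)\<^sup>2"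
  shows "(f has_derivative (\<lambda>h. \<Sum>i\<in>UNIV. h $ i * c i)) (at x)"
  unfolding has_derivative_at
proof
  show "bounded_linear (\<lambda>h. \<Sum>i\<in>UNIV. h $ i * c i)"
    unfolding linear_conv_bounded_linear[symmetric] by (rule linearI)
       (auto simp: sum.distrib distrib_right sum_distrib_left mult.assoc)
  have "((\<lambda>h::real^'n. B * norm h) \<longlongrightarrow> B * norm (0::real^'n)) (at 0)"
    by (intro tendsto_intros)
  then have "((\<lambda>h::real^'n. B * norm h) \<longlongrightarrow> 0) (at 0)" by simp
  then show "(\<lambda>h. norm (f (x + h) - f x - (\<Sum>i\<in>UNIV. h $ i * c i)) / norm h) \<midarrow>0\<rightarrow> 0"
  proof (rule Lim_null_comparison[rotated], intro always_eventually allI)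
    fix h :: "real^'n"
    show "norm (norm (f (x + h) - f x - (\<Sum>i\<in>UNIV. h $ i * c i)) / norm h) \<le> B * norm h"
      using assms[of h] by (cases "h = 0") (simp_all add: field_simps power2_eq_square)
  qed
qed

lemma sum_axis: "(\<Sum>j\<in>UNIV. axis i 1 $ j * c j) = (c i :: real)"
  by (simp add: axis_def if_distrib if_distribR cong: if_cong)

text \<open>The quadratic remainder in the Taylor estimate of the kernel is uniform in the base
  point, so it survives integration against v with the L^1 norm of v as a factor.\<close>

lemma moll_has_derivative:
  assumes "k \<in> test_functions UNIV" "integrable lborel v"
  shows "(moll k v has_derivative (\<lambda>h. \<Sum>i\<in>UNIV. h $ i * (- moll (partial_deriv i k) v x))) (at x)"
proof -
  obtain B where B: "B > 0" "\<And>x h. \<bar>k (x + h) - k x - (\<Sum>i\<in>UNIV. h $ i * partial_deriv i k x)\<bar> \<le> B * (norm h)\<^sup>2"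
    using test_functions_Taylor1[OF assms(1)] by blast
  note int = integrable_moll[OF assms] integrable_moll[OF test_functions_partial[OF assms(1)] assms(2)]
  show ?thesis
  proof (rule has_derivative_quadratic)
    fix h
    let ?r = "\<lambda>y. k (y - (x + h)) - k (y - x) + (\<Sum>i\<in>UNIV. h $ i * partial_deriv i k (y - x))"
    have "moll k v (x + h) - moll k v x - (\<Sum>i\<in>UNIV. h $ i * (- moll (partial_deriv i k) v x))
        = moll k v (x + h) - moll k v x + (\<Sum>i\<in>UNIV. h $ i * moll (partial_deriv i k) v x)"
      by (simp add: sum_negf)
    also have "\<dots> = (LINT y|lborel. k (y - (x + h)) * v y - k (y - x) * v y
        + (\<Sum>i\<in>UNIV. h $ i * (partial_deriv i k (y - x) * v y)))"
      unfolding moll_def using int by simp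
    also have "\<dots> = (LINT y|lborel. ?r y * v y)"
      by (rule Bochner_Integration.integral_cong)
         (simp_all add: algebra_simps sum_distrib_left sum_distrib_right)
    finally have e: "moll k v (x + h) - moll k v x - (\<Sum>i\<in>UNIV. h $ i * (- moll (partial_deriv i k) v x))
        = (LINT y|lborel. ?r y * v y)" .
    have "\<bar>LINT y|lborel. ?r y * v y\<bar> \<le> (B * (norm h)\<^sup>2) * (LINT y|lborel. \<bar>v y\<bar>)"
    proof (rule integrable_bounded_mult(2)[OF assms(2)])
      show "?r \<in> borel_measurable lborel"
        by (intro borel_measurable_add borel_measurable_diff borel_measurable_sum
            borel_measurable_times borel_measurable_const test_functions_shift_measurable assms
            test_functions_partial)
      show "\<bar>?r y\<bar> \<le> B * (norm h)\<^sup>2" for y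
        using B(2)[of "y - x" "- h"] by (simp add: sum_negf algebra_simps)
    qed
    then show "\<bar>moll k v (x + h) - moll k v x - (\<Sum>i\<in>UNIV. h $ i * (- moll (partial_deriv i k) v x))\<bar>
        \<le> B * (LINT y|lborel. \<bar>v y\<bar>) * (norm h)\<^sup>2"
      unfolding e by (simp add: mult_ac)
  qed
qed

lemma partial_deriv_moll:
  assumes "k \<in> test_functions UNIV" "integrable lborel v"
  shows "partial_deriv i (moll k v) = (\<lambda>x. (-1) * moll (partial_deriv i k) v x)"
  using partial_deriv_eqI[OF moll_has_derivative[OF assms], of i] unfolding sum_axis by auto

lemma C_k_moll:
  "k \<in> test_functions UNIV \<Longrightarrow> integrable lborel v \<Longrightarrow> C_k m (moll k v)"
proof (induction m arbitrary: k)
  case 0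
  then show ?case
    using has_derivative_continuous[OF moll_has_derivative[OF 0]]
    by (simp add: continuous_at_imp_continuous_on)
next
  case (Suc m)
  have "moll k v differentiable (at x)" for x
    using moll_has_derivative[OF Suc.prems] unfolding differentiable_def by blast
  moreover have "C_k m (partial_deriv i (moll k v))" for i
    unfolding partial_deriv_moll[OF Suc.prems]
    by (intro C_k_mult C_k_const Suc.IH test_functions_partial Suc.prems)
  ultimately show ?case by simp
qed

lemma moll_eq_0:
  assumes "v \<in> L2 \<Omega>" "\<And>y. y \<in> \<Omega> \<Longrightarrow> k (y - x) = 0"
  shows "moll k v x = 0"
proof -
  have "AE y in lborel. y \<notin> \<Omega> \<longrightarrow> v y = 0" using assms(1) by (simp add: L2_def)
  then have "AE y in lborel. k (y - x) * v y = 0" by eventually_elim (use assms(2) in auto)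
  then show ?thesis unfolding moll_def by (rule integral_eq_zero_AE)
qed

lemma moll_test_functions:
  assumes "k \<in> test_functions UNIV" "bounded \<Omega>" "v \<in> L2 \<Omega>"
  shows "moll k v \<in> test_functions UNIV"
proof -
  obtain R where R: "\<And>x. norm x \<ge> R \<Longrightarrow> k x = 0" using test_functions_support[OF assms(1)] by blast
  obtain S where S: "\<And>x. x \<in> \<Omega> \<Longrightarrow> norm x \<le> S" using assms(2) by (auto simp: bounded_iff)
  have "moll k v x = 0" if "x \<notin> cball 0 (R + S)" for x
  proof (rule moll_eq_0[OF assms(3)], rule R)
    fix y assume "y \<in> \<Omega>"
    then show "R \<le> norm (y - x)"
      using S[of y] that norm_triangle_ineq2[of x y] by (simp add: norm_minus_commute)
  qed
  moreover have "smooth_fun (moll k v)"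
    using C_k_moll[OF assms(1) L2_integrable[OF assms(2,3)]] by (simp add: smooth_fun_def)
  ultimately show ?thesis unfolding test_functions_iff by (blast intro: compact_cball)
qed

lemma nn_integral_abs_finite: "integrable M v \<Longrightarrow> (\<integral>\<^sup>+y. ennreal \<bar>v y :: real\<bar> \<partial>M) < \<infinity>"
  by (simp add: integrable_iff_bounded)

lemma nn_integral_translate_left:
  fixes f :: "real^'n \<Rightarrow> ennreal"
  assumes "f \<in> borel_measurable borel"
  shows "(\<integral>\<^sup>+z. f (x + z) \<partial>lborel) = (\<integral>\<^sup>+x. f x \<partial>lborel)"
  using nn_integral_translate[OF assms, of x] by (simp add: add.commute)

text \<open>By Tonelli and translation invariance the double integral of the absolute value is at
  most B times the product of the L^1 norms of v and w.\<close>

lemma integrable_moll_pair: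
  fixes k v w :: "real^'n \<Rightarrow> real"
  assumes k: "k \<in> borel_measurable borel" "\<And>x. \<bar>k x\<bar> \<le> B"
    and v: "integrable lborel v" and w: "integrable lborel w"
  shows "integrable (lborel \<Otimes>\<^sub>M lborel) (\<lambda>(x, z). k z * v (x + z) * w x)"
proof (rule integrable_pairI[where g = "\<lambda>x. ennreal (B * \<bar>w x\<bar>) * (\<integral>\<^sup>+y. ennreal \<bar>v y\<bar> \<partial>lborel)"])
  have B: "B \<ge> 0" using k(2) abs_ge_zero order_trans by blast
  note [measurable] = k(1) borel_measurable_integrable[OF v] borel_measurable_integrable[OF w]
  show "(\<lambda>(x, z). k z * v (x + z) * w x) \<in> borel_measurable (lborel \<Otimes>\<^sub>M lborel)"
    by measurable
  have [measurable]: "v \<in> borel_measurable borel" using borel_measurable_integrable[OF v] by simp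
  show "(\<integral>\<^sup>+z. ennreal \<bar>case (x, z) of (x, z) \<Rightarrow> k z * v (x + z) * w x\<bar> \<partial>lborel)
      \<le> ennreal (B * \<bar>w x\<bar>) * (\<integral>\<^sup>+y. ennreal \<bar>v y\<bar> \<partial>lborel)" for x
  proof -
    have "(\<integral>\<^sup>+z. ennreal \<bar>k z * v (x + z) * w x\<bar> \<partial>lborel)
        \<le> (\<integral>\<^sup>+z. ennreal (B * \<bar>w x\<bar>) * ennreal \<bar>v (x + z)\<bar> \<partial>lborel)"
    proof (rule nn_integral_mono)
      fix z
      have "\<bar>k z * v (x + z) * w x\<bar> = \<bar>k z\<bar> * (\<bar>w x\<bar> * \<bar>v (x + z)\<bar>)" by (simp add: abs_mult)
      also have "\<dots> \<le> B * (\<bar>w x\<bar> * \<bar>v (x + z)\<bar>)" using k(2) by (intro mult_right_mono) auto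
      finally show "ennreal \<bar>k z * v (x + z) * w x\<bar> \<le> ennreal (B * \<bar>w x\<bar>) * ennreal \<bar>v (x + z)\<bar>"
        using B by (simp add: ennreal_mult[symmetric] ennreal_leI mult.assoc)
    qed
    also have "\<dots> = ennreal (B * \<bar>w x\<bar>) * (\<integral>\<^sup>+z. ennreal \<bar>v (x + z)\<bar> \<partial>lborel)"
      by (rule nn_integral_cmult) measurable
    also have "(\<integral>\<^sup>+z. ennreal \<bar>v (x + z)\<bar> \<partial>lborel) = (\<integral>\<^sup>+y. ennreal \<bar>v y\<bar> \<partial>lborel)"
      by (rule nn_integral_translate_left) measurable
    finally show ?thesis by simp
  qed
  have "(\<integral>\<^sup>+x. ennreal (B * \<bar>w x\<bar>) * (\<integral>\<^sup>+y. ennreal \<bar>v y\<bar> \<partial>lborel) \<partial>lborel)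
      = (\<integral>\<^sup>+x. ennreal (B * \<bar>w x\<bar>) \<partial>lborel) * (\<integral>\<^sup>+y. ennreal \<bar>v y\<bar> \<partial>lborel)"
    by (rule nn_integral_multc) measurable
  also have "(\<integral>\<^sup>+x. ennreal (B * \<bar>w x\<bar>) \<partial>lborel) = ennreal B * (\<integral>\<^sup>+x. ennreal \<bar>w x\<bar> \<partial>lborel)"
    using B by (simp add: ennreal_mult nn_integral_cmult)
  also have "\<dots> * (\<integral>\<^sup>+y. ennreal \<bar>v y\<bar> \<partial>lborel) < \<infinity>"
    using nn_integral_abs_finite[OF v] nn_integral_abs_finite[OF w] by (simp add: ennreal_mult_less_top)
  finally show "(\<integral>\<^sup>+x. ennreal (B * \<bar>w x\<bar>) * (\<integral>\<^sup>+y. ennreal \<bar>v y\<bar> \<partial>lborel) \<partial>lborel) < \<infinity>" .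
qed

lemma moll_eq_translate:
  assumes "k \<in> test_functions UNIV" "v \<in> borel_measurable borel"
  shows "moll k v x = (LINT z|lborel. k z * v (x + z))"
proof -
  have "(\<lambda>y. k (y - x) * v y) \<in> borel_measurable borel"
    using test_functions_shift_measurable[OF assms(1)] assms(2) by simp
  from integral_translate[OF this, of x] show ?thesis by (simp add: moll_def add.commute)
qed

text \<open>Fubini: pairing with a mollification averages the pairings with translates. All L^2
  estimates for mollifications are reduced to translates through this identity.\<close>

lemma ip_moll_translate:
  assumes k: "k \<in> test_functions UNIV" and A: "bounded A" "v \<in> L2 A" and B: "bounded B" "w \<in> L2 B"
  shows "integrable lborel (\<lambda>z. k z * ip (\<lambda>x. v (x + z)) w)"
    "ip (moll k v) w = (LINT z|lborel. k z * ip (\<lambda>x. v (x + z)) w)"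
proof -
  obtain C where C: "\<And>x. \<bar>k x\<bar> \<le> C" using test_functions_bounded[OF k] by blast
  note F = integrable_moll_pair[OF test_functions_measurable[OF k] C L2_integrable[OF A] L2_integrable[OF B]]
  have i: "(LINT x|lborel. k z * v (x + z) * w x) = k z * ip (\<lambda>x. v (x + z)) w" for z
    by (simp add: ip_def mult.assoc)
  show "integrable lborel (\<lambda>z. k z * ip (\<lambda>x. v (x + z)) w)"
    using lborel_pair.integrable_snd[OF F] by (simp add: i)
  have "ip (moll k v) w = (LINT x|lborel. LINT z|lborel. k z * v (x + z) * w x)"
    using moll_eq_translate[OF k L2_measurable[OF A(2)]] by (simp add: ip_def)
  also have "\<dots> = (LINT z|lborel. LINT x|lborel. k z * v (x + z) * w x)"
    using lborel_pair.Fubini_integral[OF F] by simp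
  finally show "ip (moll k v) w = (LINT z|lborel. k z * ip (\<lambda>x. v (x + z)) w)" by (simp add: i)
qed

lemma test_functions_reflect:
  assumes "k \<in> test_functions UNIV"
  shows "(\<lambda>z. k (- z)) \<in> test_functions UNIV"
  using test_functions_affine[OF assms, of "-1" 0] by simp

lemma partial_deriv_reflect:
  "smooth_fun f \<Longrightarrow> partial_deriv i (\<lambda>z. f (- z)) = (\<lambda>z. - partial_deriv i f (- z))"
  using partial_deriv_affine(1)[of f i "-1" 0] by simp

lemma partial_deriv_shift:
  "smooth_fun f \<Longrightarrow> partial_deriv i (\<lambda>y. f (y - x)) = (\<lambda>y. partial_deriv i f (y - x))"
  using partial_deriv_affine(1)[of f i 1 "- x"] by simp

text \<open>The adjoint of a mollification is the mollification with the reflected kernel: in each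
  pairing the translation by z is moved to the other factor as a translation by - z, and then z is
  replaced by - z.\<close>

lemma ip_moll:
  fixes v w :: "real^'n \<Rightarrow> real"
  assumes k: "k \<in> test_functions UNIV" and A: "bounded A" "v \<in> L2 A" and B: "bounded B" "w \<in> L2 B"
  shows "ip (moll k v) w = ip v (moll (\<lambda>z. k (- z)) w)"
proof -
  let ?k = "\<lambda>z. k (- z)"
  have t: "ip v (\<lambda>x. w (x + z)) = ip (\<lambda>x. v (x + - z)) w" for z
    using ip_translate[OF A(2) L2_translate[OF B(2), of z], of "- z"] by simp
  let ?f = "\<lambda>z. k z * ip (\<lambda>x. v (x + z)) w"
  have m: "?f \<in> borel_measurable lborel"
    using ip_moll_translate(1)[OF k A B] by (rule borel_measurable_integrable)
  have refl: "distr lborel borel uminus = (lborel :: (real^'n) measure)"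
    using lborel_affine[of "-1" "0 :: real^'n"] by (simp add: density_1)
  have "ip v (moll ?k w) = ip (moll ?k w) v" by (rule ip_commute)
  also have "\<dots> = (LINT z|lborel. k (- z) * ip (\<lambda>x. w (x + z)) v)"
    by (rule ip_moll_translate(2)[OF test_functions_reflect[OF k] B A])
  also have "\<dots> = (LINT z|lborel. ?f (- z))"
    by (simp add: ip_commute[of _ v] t)
  also have "\<dots> = (LINT z|distr lborel borel uminus. ?f z)"
    by (subst integral_distr) (use m in auto)
  finally show ?thesis unfolding refl using ip_moll_translate(2)[OF k A B] by simp
qed

section \<open>Approximate identities, not necessarily centred at the origin\<close>

definition kernel :: "real \<Rightarrow> (real^'n \<Rightarrow> real) \<Rightarrow> bool" where
  "kernel r k \<longleftrightarrow> k \<in> test_functions UNIV \<and> (\<forall>z. k z \<ge> 0) \<and> (LINT z|lborel. k z) = 1 \<and>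
     (\<forall>z. norm z \<ge> r \<longrightarrow> k z = 0)"

lemma kernel_reflect: 
  fixes k :: "real^'n \<Rightarrow> real"
  assumes "kernel r k"
  shows "kernel r (\<lambda>z. k (- z))"
proof -
  have k: "k \<in> test_functions UNIV" using assms by (simp add: kernel_def)
  have refl: "distr lborel borel uminus = (lborel :: (real^'n) measure)"
    using lborel_affine[of "-1" "0 :: real^'n"] by (simp add: density_1)
  have "(LINT z|lborel. k (- z)) = (LINT z|distr lborel borel uminus. k z)"
    by (subst integral_distr) (use test_functions_measurable[OF k] in auto)
  then show ?thesis using assms test_functions_reflect[OF k] unfolding kernel_def refl by auto
qed

text \<open>A normalized bump around c. Kernels away from the origin translate and mollify in a
  single step. The integral of the bump is positive because its set of positivity contains a ball,
  which is not a null set.\<close>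

lemma ex_kernel:
  fixes c :: "real^'n"
  assumes "\<delta> > 0"
  shows "\<exists>k. kernel (norm c + \<delta>) k \<and> (\<forall>z. norm (z - c) \<ge> \<delta> \<longrightarrow> k z = 0)"
proof -
  obtain \<phi> where \<phi>: "\<phi> \<in> test_functions UNIV" "\<And>x. \<phi> x \<ge> 0" "\<And>x. \<phi> x > 0 \<longleftrightarrow> norm (x - c) < \<delta>"
    using ex_bump[OF assms, of c] by blast
  have z: "\<phi> x = 0" if "norm (x - c) \<ge> \<delta>" for x
    using \<phi>(2,3)[of x] that by (smt (verit))
  let ?I = "LINT x|lborel. \<phi> x"
  have int: "integrable lborel \<phi>" by (rule test_functions_integrable[OF \<phi>(1)])
  have "?I \<noteq> 0"
  proof
    assume "?I = 0"
    then have "AE x in lborel. \<phi> x = 0"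
      using integral_nonneg_eq_0_iff_AE[OF int] \<phi>(2) by simp
    then have "{x \<in> space lborel. \<not> \<phi> x = 0} \<in> null_sets lborel"
      by (subst (asm) AE_iff_null) (use test_functions_measurable[OF \<phi>(1)] in auto)
    moreover have "ball c \<delta> \<subseteq> {x \<in> space lborel. \<not> \<phi> x = 0}"
      using \<phi>(3) by (force simp: dist_norm norm_minus_commute)
    ultimately have "ball c \<delta> \<in> null_sets lborel" by (intro null_sets_subset[of "{x \<in> space lborel. \<not> \<phi> x = 0}" lborel "ball c \<delta>"]) auto
    then have "negligible (ball c \<delta>)"
      by (simp add: negligible_iff_null_sets null_sets_completionI)
    then show False using open_not_negligible[of "ball c \<delta>"] assms by simp
  qed
  then have I: "?I > 0" using integral_nonneg_AE[of \<phi> lborel] \<phi>(2) by (simp add: less_le)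
  let ?k = "\<lambda>x. (1 / ?I) * \<phi> x"
  have "norm (z - c) \<ge> \<delta>" if "norm z \<ge> norm c + \<delta>" for z
    using that norm_triangle_ineq2[of z c] by linarith
  then have "kernel (norm c + \<delta>) ?k"
    unfolding kernel_def using test_functions_cmult[OF \<phi>(1), of "1 / ?I"] \<phi>(2) I z
    by (auto simp: less_imp_le)
  then show ?thesis using z by (intro exI[of _ ?k]) simp
qed

lemma kernel_test_function: "kernel r k \<Longrightarrow> k \<in> test_functions UNIV"
  by (simp add: kernel_def)

text \<open>Since the kernel is a probability density supported within radius r, a bound for the
  pairings with all short translates passes to their average. Tested with the function to be
  estimated, this plays the part of Jensen's inequality for L^2 norms.\<close>

lemma ip_moll_le:
  assumes kr: "kernel r k" and A: "bounded A" "v \<in> L2 A" and D: "bounded D" "d \<in> L2 D"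
    and le: "\<And>z. norm z < r \<Longrightarrow> ip (\<lambda>x. v (x + z)) d \<le> c"
  shows "ip (moll k v) d \<le> c"
proof -
  have k: "k \<in> test_functions UNIV" "\<And>z. k z \<ge> 0" "(LINT z|lborel. k z) = 1"
    "\<And>z. norm z \<ge> r \<Longrightarrow> k z = 0" using kr by (auto simp: kernel_def)
  have "ip (moll k v) d = (LINT z|lborel. k z * ip (\<lambda>x. v (x + z)) d)"
    by (rule ip_moll_translate(2)[OF k(1) A D])
  also have "\<dots> \<le> (LINT z|lborel. k z * c)"
  proof (rule integral_mono)
    show "k z * ip (\<lambda>x. v (x + z)) d \<le> k z * c" for z
      using le[of z] k(2)[of z] k(4)[of z] by (cases "norm z < r") (auto intro: mult_left_mono)
  qed (use ip_moll_translate(1)[OF k(1) A D] test_functions_integrable[OF k(1)] in auto)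
  finally show ?thesis using k(3) by simp
qed

lemma moll_L2_bounded:
  assumes "k \<in> test_functions UNIV" "bounded A" "v \<in> L2 A"
  shows "\<exists>D. bounded D \<and> A \<subseteq> D \<and> moll k v \<in> L2 D"
proof -
  note mt = moll_test_functions[OF assms]
  obtain R where R: "\<forall>x. norm x \<ge> R \<longrightarrow> moll k v x = 0" using test_functions_support[OF mt] by blast
  then have "moll k v \<in> L2 (A \<union> ball 0 R)" using test_functions_L2[OF mt] by (subst L2_iff) auto
  then show ?thesis using assms(2) by (intro exI[of _ "A \<union> ball 0 R"]) auto
qed

lemma nrm_moll_le:
  assumes kr: "kernel r k" and A: "bounded A" "v \<in> L2 A"
  shows "nrm (moll k v) \<le> nrm v"
proof -
  obtain D where D: "bounded D" "moll k v \<in> L2 D"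
    using moll_L2_bounded[OF kernel_test_function[OF kr] A] by blast
  have "ip (moll k v) (moll k v) \<le> nrm v * nrm (moll k v)"
  proof (rule ip_moll_le[OF kr A D])
    fix z
    show "ip (\<lambda>x. v (x + z)) (moll k v) \<le> nrm v * nrm (moll k v)"
      using ip_Cauchy_Schwarz[OF L2_translate[OF A(2), of z] D(2)] nrm_translate[OF A(2), of z] by simp
  qed
  then have "nrm (moll k v) * nrm (moll k v) \<le> nrm v * nrm (moll k v)"
    by (simp add: nrm_sq[symmetric] power2_eq_square)
  then show ?thesis
    using nrm_nonneg[of "moll k v"] nrm_nonneg[of v] by (cases "nrm (moll k v) = 0") auto
qed

text \<open>The difference d of mollification and v is paired with itself: translates are
  \<epsilon>-close to v, so the square of the norm of d is at most \<epsilon> times the norm of d.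
  The radius serves every kernel of that radius, so it can be fixed before the direction of the
  kernel is chosen.\<close>

lemma moll_approx:
  fixes v :: "real^'n \<Rightarrow> real"
  assumes A: "bounded A" "v \<in> L2 A" and e: "\<epsilon> > 0"
  shows "\<exists>r>0. \<forall>k. kernel r k \<longrightarrow> nrm (\<lambda>x. moll k v x - v x) \<le> \<epsilon>"
proof -
  obtain r where r: "r > 0" "\<And>h. norm h < r \<Longrightarrow> nrm (\<lambda>x. v (x + h) - v x) < \<epsilon>"
    using L2_cont[OF A(2)] e unfolding L2_cont_def by blast
  have "nrm (\<lambda>x. moll k v x - v x) \<le> \<epsilon>" if kr: "kernel r k" for k
  proof -
    let ?d = "\<lambda>x. moll k v x - v x"
    obtain D where D: "bounded D" "A \<subseteq> D" "moll k v \<in> L2 D"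
      using moll_L2_bounded[OF kernel_test_function[OF kr] A] by blast
    have d: "?d \<in> L2 D" using L2_diff[OF D(3) L2_mono[OF A(2) D(2)]] .
    have "ip (moll k v) ?d \<le> ip v ?d + \<epsilon> * nrm ?d"
    proof (rule ip_moll_le[OF kr A D(1) d])
      fix z :: "real^'n" assume z: "norm z < r"
      have "ip (\<lambda>x. v (x + z)) ?d - ip v ?d = ip (\<lambda>x. v (x + z) - v x) ?d"
        by (rule ip_diff_left[OF L2_translate[OF A(2)] A(2) d, symmetric])
      also have "\<dots> \<le> nrm (\<lambda>x. v (x + z) - v x) * nrm ?d"
        using ip_Cauchy_Schwarz[OF L2_diff[OF L2_translate[OF A(2)] L2_UNIV[OF A(2)]] d, of z]
        by linarith
      also have "\<dots> \<le> \<epsilon> * nrm ?d" using r(2)[OF z] by (intro mult_right_mono) auto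
      finally show "ip (\<lambda>x. v (x + z)) ?d \<le> ip v ?d + \<epsilon> * nrm ?d" by simp
    qed
    moreover have "ip ?d ?d = ip (moll k v) ?d - ip v ?d"
      by (rule ip_diff_left[OF D(3) A(2) d])
    ultimately have "nrm ?d * nrm ?d \<le> \<epsilon> * nrm ?d" by (simp add: nrm_sq[symmetric] power2_eq_square)
    then show ?thesis using nrm_nonneg[of ?d] e by (cases "nrm ?d = 0") auto
  qed
  with r(1) show ?thesis by blast
qed

lemma kernel_mono: "kernel r k \<Longrightarrow> r \<le> r' \<Longrightarrow> kernel r' k"
  unfolding kernel_def by auto

text \<open>For fixed x the shifted kernel is itself a test function of y, so the weak derivative
  moves from the kernel to v. The hypothesis is over test functions of the whole space, because the
  shifted kernel may leave any given domain.\<close>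

lemma moll_weak_derivative:
  assumes k: "k \<in> test_functions UNIV"
    and "\<And>\<psi>. \<psi> \<in> test_functions UNIV \<Longrightarrow> ip v (partial_deriv i \<psi>) = - ip g \<psi>"
  shows "moll (partial_deriv i k) v x = - moll k g x"
proof -
  have "moll k' w x = ip w (\<lambda>y. k' (y - x))" for k' w by (simp add: moll_def ip_def mult.commute)
  moreover have "(\<lambda>y. k (y - x)) \<in> test_functions UNIV"
    using test_functions_affine[OF k, of 1 "- x"] by simp
  ultimately show ?thesis
    using assms(2)[of "\<lambda>y. k (y - x)"] partial_deriv_shift[OF test_functions_smooth[OF k], of i x] by simp
qed


section \<open>Weak gradients\<close>

lemma L2_mult_bounded:
  assumes "v \<in> L2 A" "f \<in> borel_measurable borel" "\<And>x. \<bar>f x\<bar> \<le> B"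
  shows "(\<lambda>x. f x * v x) \<in> L2 A"
proof (rule L2_dominated[OF L2_cmult[OF assms(1), of B]])
  show "(\<lambda>x. f x * v x) \<in> borel_measurable borel"
    using assms(2) L2_measurable[OF assms(1)] by (rule borel_measurable_times)
  have "\<bar>f x * v x\<bar> \<le> \<bar>B * v x\<bar>" for x
    unfolding abs_mult using order_trans[OF assms(3) abs_ge_self] by (intro mult_right_mono) auto
  then show "AE x in lborel. \<bar>f x * v x\<bar> \<le> \<bar>B * v x\<bar>" by (rule AE_I2)
qed

lemma L2_mult_test:
  assumes "v \<in> L2 A" "\<eta> \<in> test_functions \<Omega>"
  shows "(\<lambda>x. \<eta> x * v x) \<in> L2 A"
  using test_functions_bounded[OF assms(2)] L2_mult_bounded[OF assms(1) test_functions_measurable[OF assms(2)]]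
  by blast

lemma ip_mult_shift: "ip (\<lambda>x. \<eta> x * v x) w = ip v (\<lambda>x. \<eta> x * w x)"
  by (simp add: ip_def mult_ac)

lemma nrm_mult_bounded:
  assumes "v \<in> L2 A" "f \<in> borel_measurable borel" "\<And>x. \<bar>f x\<bar> \<le> B"
  shows "nrm (\<lambda>x. f x * v x) \<le> B * nrm v"
proof (rule power2_le_imp_le)
  have B: "B \<ge> 0" using assms(3) abs_ge_zero order_trans by blast
  then show "0 \<le> B * nrm v" by simp
  have "ip (\<lambda>x. f x * v x) (\<lambda>x. f x * v x) \<le> (LINT x|lborel. B\<^sup>2 * (v x * v x))"
    unfolding ip_def
  proof (rule integral_mono)
    note L = L2_mult_bounded[OF assms]
    show "integrable lborel (\<lambda>x. f x * v x * (f x * v x))" by (rule integrable_L2_mult[OF L L])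
    show "integrable lborel (\<lambda>x. B\<^sup>2 * (v x * v x))"
      using integrable_L2_mult[OF assms(1,1)] by simp
    fix x
    have "(f x)\<^sup>2 * (v x)\<^sup>2 \<le> B\<^sup>2 * (v x)\<^sup>2"
      using power_mono[OF assms(3)[of x] abs_ge_zero, of 2] by (intro mult_right_mono) auto
    then show "f x * v x * (f x * v x) \<le> B\<^sup>2 * (v x * v x)" by (simp add: power2_eq_square mult_ac)
  qed
  then show "(nrm (\<lambda>x. f x * v x))\<^sup>2 \<le> (B * nrm v)\<^sup>2"
    by (simp add: nrm_sq power_mult_distrib ip_def[of v v])
qed

text \<open>Pairing \<open>\<eta> g\<close> with its own mollification gives zero, so \<open>\<eta> g\<close> is orthogonal to itself.\<close>

lemma fundamental_lemma_cutoff: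
  fixes g :: "real^'n \<Rightarrow> real"
  assumes b: "bounded \<Omega>" and g: "g \<in> L2 \<Omega>"
    and orth: "\<And>\<psi>. \<psi> \<in> test_functions \<Omega> \<Longrightarrow> ip g \<psi> = 0"
    and \<eta>: "\<eta> \<in> test_functions \<Omega>"
  shows "AE x in lborel. \<eta> x * g x = 0"
proof -
  let ?v = "\<lambda>x. \<eta> x * g x"
  have v: "?v \<in> L2 \<Omega>" by (rule L2_mult_test[OF g \<eta>])
  have "nrm ?v \<le> 0"
  proof (rule field_le_epsilon)
    fix \<epsilon> :: real assume e: "\<epsilon> > 0"
    obtain r where r: "r > 0" "\<forall>k. kernel r k \<longrightarrow> nrm (\<lambda>x. moll k ?v x - ?v x) \<le> \<epsilon>"
      using moll_approx[OF b v e] by blast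
    obtain k :: "real^'n \<Rightarrow> real" where k: "kernel r k" using ex_kernel[OF r(1), of 0] by auto
    note kt = kernel_test_function[OF k]
    have "ip (moll k ?v) ?v = ip ?v (moll (\<lambda>z. k (- z)) ?v)" by (rule ip_moll[OF kt b v b v])
    \<comment> \<open>One factor \<open>\<eta>\<close> changes sides and turns the mollification
      into a test function of \<Omega>, to which the orthogonality applies.\<close>
    also have "\<dots> = ip g (\<lambda>x. \<eta> x * moll (\<lambda>z. k (- z)) ?v x)" by (rule ip_mult_shift)
    also have "\<dots> = 0"
      by (rule orth[OF test_functions_mult_right[OF \<eta> test_functions_smooth[OF
          moll_test_functions[OF test_functions_reflect[OF kt] b v]]]])
    finally have z: "ip (moll k ?v) ?v = 0" .
    have "ip (\<lambda>x. moll k ?v x - ?v x) ?v = ip (moll k ?v) ?v - ip ?v ?v"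
      by (rule ip_diff_left[OF test_functions_L2[OF moll_test_functions[OF kt b v]] v v])
    then have "(nrm ?v)\<^sup>2 \<le> \<bar>ip (\<lambda>x. moll k ?v x - ?v x) ?v\<bar>" using z by (simp add: nrm_sq)
    also have "\<dots> \<le> nrm (\<lambda>x. moll k ?v x - ?v x) * nrm ?v"
      by (rule ip_Cauchy_Schwarz[OF L2_diff[OF test_functions_L2[OF moll_test_functions[OF kt b v]] L2_UNIV[OF v]] v])
    also have "\<dots> \<le> \<epsilon> * nrm ?v" using r(2) k by (intro mult_right_mono) auto
    finally show "nrm ?v \<le> 0 + \<epsilon>"
      using e nrm_nonneg[of ?v] by (cases "nrm ?v = 0") (auto simp: power2_eq_square)
  qed
  then show ?thesis using nrm_eq_0_AE[OF v] nrm_nonneg[of ?v] by linarith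
qed

lemma ex_bump_in:
  fixes \<Omega> :: "(real^'n) set"
  assumes "open \<Omega>" "p \<in> \<Omega>"
  shows "\<exists>r>0. ball p r \<subseteq> \<Omega> \<and> (\<exists>\<eta>\<in>test_functions \<Omega>. (\<forall>x. \<eta> x \<ge> 0) \<and> (\<forall>x\<in>ball p r. \<eta> x > 0))"
proof -
  obtain r where r: "r > 0" "cball p r \<subseteq> \<Omega>" using assms open_contains_cball by blast
  obtain \<phi> where \<phi>: "\<phi> \<in> test_functions UNIV" "\<And>x. \<phi> x \<ge> 0" "\<And>x. \<phi> x > 0 \<longleftrightarrow> norm (x - p) < r"
    using ex_bump[OF r(1), of p] by blast
  have "\<phi> x = 0" if "x \<notin> cball p r" for x
    using \<phi>(2,3)[of x] that by (auto simp: dist_norm norm_minus_commute less_le)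
  then have "\<phi> \<in> test_functions \<Omega>"
    using \<phi>(1) r(2) unfolding test_functions_iff by (blast intro: compact_cball)
  moreover have "\<forall>x\<in>ball p r. \<phi> x > 0" using \<phi>(3) by (auto simp: dist_norm norm_minus_commute)
  ultimately show ?thesis using r \<phi>(2) ball_subset_cball by blast
qed

text \<open>Positive bumps give vanishing almost everywhere near each point of \<Omega>; the
  Lindelof property reduces the cover to countably many pieces, so that the exceptional sets add up
  to a null set.\<close>

lemma fundamental_lemma:
  fixes g :: "real^'n \<Rightarrow> real"
  assumes \<Omega>: "open \<Omega>" "bounded \<Omega>" and g: "g \<in> L2 \<Omega>"
    and orth: "\<And>\<psi>. \<psi> \<in> test_functions \<Omega> \<Longrightarrow> ip g \<psi> = 0"
  shows "AE x in lborel. g x = 0"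
proof -
  define F where "F = {S. open S \<and> (AE x in lborel. x \<in> S \<longrightarrow> g x = 0)}"
  have cover: "\<Omega> \<subseteq> \<Union>F"
  proof
    fix p assume "p \<in> \<Omega>"
    then obtain r \<eta> where r: "r > 0" "\<eta> \<in> test_functions \<Omega>" "\<forall>x\<in>ball p r. \<eta> x > 0"
      using ex_bump_in[OF \<Omega>(1)] by blast
    have "AE x in lborel. x \<in> ball p r \<longrightarrow> g x = 0"
    proof -
      have "AE x in lborel. \<eta> x * g x = 0"
        by (rule fundamental_lemma_cutoff[OF \<Omega>(2) g _ r(2)]) (rule orth)
      then show ?thesis by eventually_elim (use r(3) in force)
    qed
    then have "ball p r \<in> F" unfolding F_def using open_ball by blast
    moreover have "p \<in> ball p r" using r(1) by (rule centre_in_ball[THEN iffD2])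
    ultimately show "p \<in> \<Union>F" by (rule UnionI)
  qed
  obtain F' where F': "F' \<subseteq> F" "countable F'" "\<Union>F' = \<Union>F"
    using Lindelof[of F] by (auto simp: F_def)
  have "AE x in lborel. \<forall>S\<in>F'. x \<in> S \<longrightarrow> g x = 0"
    using F'(1) by (subst AE_ball_countable[OF F'(2)]) (auto simp: F_def)
  moreover have "AE x in lborel. x \<notin> \<Omega> \<longrightarrow> g x = 0" using g by (simp add: L2_def)
  ultimately show ?thesis
  proof eventually_elim
    case (elim x)
    show ?case
    proof (cases "x \<in> \<Omega>")
      case True
      then have "x \<in> \<Union>F'" unfolding F'(3) using cover by (rule rev_subsetD)
      then obtain S where S: "S \<in> F'" "x \<in> S" by (rule UnionE)
      show ?thesis using bspec[OF elim(1) S(1)] S(2) by (rule mp)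
    qed (use elim(2) in simp)
  qed
qed

lemma is_weak_gradient_ip:
  assumes "is_weak_gradient \<Omega> u g" "u \<in> L2 \<Omega>" "open \<Omega>" "\<psi> \<in> test_functions \<Omega>"
  shows "ip u (partial_deriv i \<psi>) = - ip (\<lambda>x. g x $ i) \<psi>"
  using assms set_integral_L2[of \<Omega> u "partial_deriv i \<psi>"] set_integral_L2[of \<Omega> "\<lambda>x. g x $ i" \<psi>]
    test_functions_measurable[OF assms(4)] test_functions_measurable[OF test_functions_partial[OF assms(4)]]
  unfolding is_weak_gradient_def by simp

lemma is_weak_gradientI:
  assumes "open \<Omega>" "u \<in> L2 \<Omega>" "\<And>i. (\<lambda>x. g x $ i) \<in> L2 \<Omega>"
    "\<And>i \<psi>. \<psi> \<in> test_functions \<Omega> \<Longrightarrow> ip u (partial_deriv i \<psi>) = - ip (\<lambda>x. g x $ i) \<psi>"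
  shows "is_weak_gradient \<Omega> u g"
  unfolding is_weak_gradient_def
proof (intro conjI allI ballI)
  fix \<phi> i assume \<phi>: "\<phi> \<in> test_functions \<Omega>"
  have \<Omega>: "\<Omega> \<in> sets borel" using assms(1) by simp
  show "(LINT x:\<Omega>|lborel. u x * partial_deriv i \<phi> x) = - (LINT x:\<Omega>|lborel. g x $ i * \<phi> x)"
    using assms(4)[OF \<phi>]
    unfolding set_integral_L2[OF \<Omega> assms(2) test_functions_measurable[OF test_functions_partial[OF \<phi>]]]
      set_integral_L2[OF \<Omega> assms(3) test_functions_measurable[OF \<phi>]] .
qed (rule assms(3))

lemma weak_gradient_unique:
  assumes "open \<Omega>" "bounded \<Omega>" "u \<in> L2 \<Omega>" "is_weak_gradient \<Omega> u g" "is_weak_gradient \<Omega> u h"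
  shows "AE x in lborel. g x $ i = h x $ i"
proof -
  have L: "(\<lambda>x. g x $ i) \<in> L2 \<Omega>" "(\<lambda>x. h x $ i) \<in> L2 \<Omega>"
    using assms(4,5) by (auto simp: is_weak_gradient_def)
  have "AE x in lborel. g x $ i - h x $ i = 0"
  proof (rule fundamental_lemma[OF assms(1,2) L2_diff[OF L]])
    fix \<psi> assume \<psi>: "\<psi> \<in> test_functions \<Omega>"
    have "ip (\<lambda>x. g x $ i - h x $ i) \<psi> = ip (\<lambda>x. g x $ i) \<psi> - ip (\<lambda>x. h x $ i) \<psi>"
      by (rule ip_diff_left[OF L test_functions_L2[OF \<psi>]])
    also have "\<dots> = 0"
      using is_weak_gradient_ip[OF assms(4,3,1) \<psi>, of i] is_weak_gradient_ip[OF assms(5,3,1) \<psi>, of i] by simp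
    finally show "ip (\<lambda>x. g x $ i - h x $ i) \<psi> = 0" .
  qed
  then show ?thesis by simp
qed

lemma is_weak_gradient_add:
  assumes "open \<Omega>" "u \<in> L2 \<Omega>" "v \<in> L2 \<Omega>" "is_weak_gradient \<Omega> u g" "is_weak_gradient \<Omega> v h"
  shows "is_weak_gradient \<Omega> (\<lambda>x. u x + c * v x) (\<lambda>x. g x + c *\<^sub>R h x)"
proof (rule is_weak_gradientI[OF assms(1)])
  have L: "(\<lambda>x. g x $ i) \<in> L2 \<Omega>" "(\<lambda>x. h x $ i) \<in> L2 \<Omega>" for i
    using assms(4,5) by (auto simp: is_weak_gradient_def)
  show "(\<lambda>x. u x + c * v x) \<in> L2 \<Omega>" by (intro L2_add L2_cmult assms)
  show "(\<lambda>x. (g x + c *\<^sub>R h x) $ i) \<in> L2 \<Omega>" for i using L2_add[OF L(1) L2_cmult[OF L(2)]] by simp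
  fix i \<psi> assume \<psi>: "\<psi> \<in> test_functions \<Omega>"
  have "ip (\<lambda>x. u x + c * v x) (partial_deriv i \<psi>) = ip u (partial_deriv i \<psi>) + c * ip v (partial_deriv i \<psi>)"
    using ip_add_left[OF assms(2) L2_cmult[OF assms(3), of c] test_functions_L2[OF test_functions_partial[OF \<psi>]]]
    by (simp add: ip_cmult_left)
  moreover have "ip (\<lambda>x. g x $ i + c * h x $ i) \<psi> = ip (\<lambda>x. g x $ i) \<psi> + c * ip (\<lambda>x. h x $ i) \<psi>"
    using ip_add_left[OF L(1) L2_cmult[OF L(2), of c] test_functions_L2[OF \<psi>]] by (simp add: ip_cmult_left)
  ultimately show "ip (\<lambda>x. u x + c * v x) (partial_deriv i \<psi>) = - ip (\<lambda>x. (g x + c *\<^sub>R h x) $ i) \<psi>"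
    using is_weak_gradient_ip[OF assms(4,2,1) \<psi>] is_weak_gradient_ip[OF assms(5,3,1) \<psi>] by simp
qed

lemma is_weak_gradient_test:
  assumes "open \<Omega>" "\<phi> \<in> test_functions \<Omega>"
  shows "is_weak_gradient \<Omega> \<phi> (\<lambda>x. \<chi> i. partial_deriv i \<phi> x)"
  using ip_partial_deriv[OF test_functions_UNIV[OF assms(2)]] test_functions_L2[OF test_functions_partial[OF assms(2)]]
  by (intro is_weak_gradientI assms test_functions_L2[OF assms(2)]) (simp_all add: test_functions_UNIV)

text \<open>Eliminates the choice in \<open>weak_gradient\<close>: by uniqueness almost everywhere,
  any weak gradient computes the same norm.\<close>

lemma L2_norm_weak_gradient:
  assumes "open \<Omega>" "bounded \<Omega>" "u \<in> L2 \<Omega>" "is_weak_gradient \<Omega> u g"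
  shows "(L2_norm \<Omega> (weak_gradient \<Omega> u))\<^sup>2 = (\<Sum>i\<in>UNIV. (nrm (\<lambda>x. g x $ i))\<^sup>2)"
proof -
  have w: "is_weak_gradient \<Omega> u (weak_gradient \<Omega> u)"
    unfolding weak_gradient_def by (rule someI[of _ g]) (rule assms(4))
  have L: "(\<lambda>x. g x $ i) \<in> L2 \<Omega>" "(\<lambda>x. weak_gradient \<Omega> u x $ i) \<in> L2 \<Omega>" for i
    using assms(4) w by (auto simp: is_weak_gradient_def)
  have "nrm (\<lambda>x. weak_gradient \<Omega> u x $ i) = nrm (\<lambda>x. g x $ i)" for i
    using weak_gradient_unique[OF assms(1-3) w assms(4), of i] L2_measurable[OF L(1)] L2_measurable[OF L(2)]
    by (intro nrm_cong_AE)
  then show ?thesis using L2_norm_vec_sq[of \<Omega> "weak_gradient \<Omega> u"] L(2) assms(1) by simp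
qed

lemma H01_approx:
  assumes \<Omega>: "open \<Omega>" "bounded \<Omega>" and u: "u \<in> H01 \<Omega>" and g: "is_weak_gradient \<Omega> u g" and e: "\<epsilon> > 0"
  shows "\<exists>\<phi>\<in>test_functions \<Omega>. nrm (\<lambda>x. u x - \<phi> x) < \<epsilon> \<and> (\<forall>i. nrm (\<lambda>x. g x $ i - partial_deriv i \<phi> x) < \<epsilon>)"
proof -
  have uL: "u \<in> L2 \<Omega>" using u by (auto simp: H01_def H1_def)
  obtain \<phi> where \<phi>: "\<phi> \<in> test_functions \<Omega>" "H1_norm \<Omega> (\<lambda>x. u x - \<phi> x) < \<epsilon>"
    using u e by (auto simp: H01_def)
  note d = L2_diff[OF uL test_functions_L2[OF \<phi>(1)]]
  have w: "is_weak_gradient \<Omega> (\<lambda>x. u x - \<phi> x) (\<lambda>x. g x + (-1) *\<^sub>R (\<chi> i. partial_deriv i \<phi> x))"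
    using is_weak_gradient_add[OF \<Omega>(1) uL test_functions_L2[OF \<phi>(1)] g is_weak_gradient_test[OF \<Omega>(1) \<phi>(1)], of "-1"]
    by simp
  let ?S = "\<Sum>i\<in>UNIV. (nrm (\<lambda>x. g x $ i - partial_deriv i \<phi> x))\<^sup>2"
  have "?S \<ge> 0" by (intro sum_nonneg) simp
  then have "(H1_norm \<Omega> (\<lambda>x. u x - \<phi> x))\<^sup>2 = (nrm (\<lambda>x. u x - \<phi> x))\<^sup>2 + ?S"
    using L2_norm_weak_gradient[OF \<Omega> d w] L2_norm_eq_nrm[of \<Omega>, OF _ d] \<Omega>(1) by (simp add: H1_norm_def)
  moreover have "(H1_norm \<Omega> (\<lambda>x. u x - \<phi> x))\<^sup>2 < \<epsilon>\<^sup>2"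
    using \<phi>(2) by (intro power_strict_mono) (auto simp: H1_norm_def)
  ultimately have s: "(nrm (\<lambda>x. u x - \<phi> x))\<^sup>2 + ?S < \<epsilon>\<^sup>2" by simp
  have "?S \<ge> 0" by (intro sum_nonneg) simp
  then have "(nrm (\<lambda>x. u x - \<phi> x))\<^sup>2 < \<epsilon>\<^sup>2" using s by linarith
  moreover have "(nrm (\<lambda>x. g x $ i - partial_deriv i \<phi> x))\<^sup>2 < \<epsilon>\<^sup>2" for i
  proof -
    have "(nrm (\<lambda>x. g x $ i - partial_deriv i \<phi> x))\<^sup>2 \<le> ?S" by (rule member_le_sum) auto
    then show ?thesis using s zero_le_power2[of "nrm (\<lambda>x. u x - \<phi> x)"] by linarith
  qed
  ultimately show ?thesis using \<phi>(1) e by (intro bexI[of _ \<phi>]) (auto intro: power2_less_imp_less)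
qed

text \<open>Here the zero boundary values enter: the extensions of u and g by zero satisfy the weak
  gradient identity against test functions that do not vanish near the boundary. For the
  approximating test functions this is integration by parts, and both sides are continuous in the
  H^1 norm.\<close>

lemma H01_weak_gradient_UNIV:
  assumes \<Omega>: "open \<Omega>" "bounded \<Omega>" and u: "u \<in> H01 \<Omega>" and g: "is_weak_gradient \<Omega> u g"
    and \<psi>: "\<psi> \<in> test_functions UNIV"
  shows "ip u (partial_deriv i \<psi>) = - ip (\<lambda>x. g x $ i) \<psi>"
proof -
  have uL: "u \<in> L2 \<Omega>" using u by (auto simp: H01_def H1_def)
  have gL: "(\<lambda>x. g x $ i) \<in> L2 \<Omega>" using g by (simp add: is_weak_gradient_def)
  let ?d = "partial_deriv i \<psi>"
  let ?N = "nrm ?d + nrm \<psi> + 1"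
  note \<psi>L = test_functions_L2[OF \<psi>] test_functions_L2[OF test_functions_partial[OF \<psi>, of i]]
  have N: "?N > 0" using nrm_nonneg[of ?d] nrm_nonneg[of \<psi>] by linarith
  have "\<bar>ip u ?d + ip (\<lambda>x. g x $ i) \<psi>\<bar> \<le> 0"
  proof (rule field_le_epsilon)
    fix \<epsilon> :: real assume e: "\<epsilon> > 0"
    have "\<epsilon> / ?N > 0" using e N by simp
    then obtain \<phi> where \<phi>: "\<phi> \<in> test_functions \<Omega>" "nrm (\<lambda>x. u x - \<phi> x) < \<epsilon> / ?N"
      "nrm (\<lambda>x. g x $ i - partial_deriv i \<phi> x) < \<epsilon> / ?N"
      using H01_approx[OF \<Omega> u g] by blast
    note \<phi>L = test_functions_L2[OF \<phi>(1)] test_functions_L2[OF test_functions_partial[OF \<phi>(1), of i]]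
    have "ip u ?d + ip (\<lambda>x. g x $ i) \<psi> = ip (\<lambda>x. u x - \<phi> x) ?d + ip (\<lambda>x. g x $ i - partial_deriv i \<phi> x) \<psi>"
      using ip_diff_left[OF uL \<phi>L(1) \<psi>L(2)] ip_diff_left[OF gL \<phi>L(2) \<psi>L(1)]
        ip_partial_deriv[OF test_functions_UNIV[OF \<phi>(1)] \<psi>, of i] by simp
    also have "\<bar>\<dots>\<bar> \<le> nrm (\<lambda>x. u x - \<phi> x) * nrm ?d + nrm (\<lambda>x. g x $ i - partial_deriv i \<phi> x) * nrm \<psi>"
      using ip_Cauchy_Schwarz[OF L2_diff[OF uL \<phi>L(1)] \<psi>L(2)] ip_Cauchy_Schwarz[OF L2_diff[OF gL \<phi>L(2)] \<psi>L(1)]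
      by linarith
    also have "\<dots> \<le> (\<epsilon> / ?N) * nrm ?d + (\<epsilon> / ?N) * nrm \<psi>"
      using \<phi>(2,3) by (intro add_mono mult_right_mono) auto
    also have "\<dots> = (\<epsilon> / ?N) * (nrm ?d + nrm \<psi>)" by (simp add: distrib_left)
    also have "\<dots> \<le> (\<epsilon> / ?N) * ?N" using e N by (intro mult_left_mono) auto
    also have "\<dots> = 0 + \<epsilon>" using N by simp
    finally show "\<bar>ip u ?d + ip (\<lambda>x. g x $ i) \<psi>\<bar> \<le> 0 + \<epsilon>" .
  qed
  then show ?thesis by linarith
qed

section \<open>Boundary charts\<close>

text \<open>Translating by \<open>t *\<^sub>R e\<close> pushes \<open>\<Omega>\<close> into itself near \<open>p\<close>, with a margin \<open>\<delta>\<close>; at an interior point \<open>e = 0\<close> works.\<close>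

lemma lipschitz_chart:
  fixes \<Omega> :: "(real^'n) set"
  assumes L: "lipschitz_domain \<Omega>" and p: "p \<in> closure \<Omega>"
  shows "\<exists>r>0. \<exists>e. norm e \<le> 1 \<and> (\<forall>t. 0 < t \<and> t < r \<longrightarrow> (\<exists>\<delta>>0. \<forall>x\<in>\<Omega>. \<forall>y\<in>ball p r.
    norm (y - x - t *\<^sub>R e) < \<delta> \<longrightarrow> y \<in> \<Omega>))"
proof (cases "p \<in> \<Omega>")
  case True
  obtain r where r: "r > 0" "ball p r \<subseteq> \<Omega>"
    using L True unfolding lipschitz_domain_def by (meson openE)
  then show ?thesis by (intro exI[of _ r] conjI exI[of _ 0]) (auto intro: exI[of _ 1])
next
  case False
  then have "p \<in> frontier \<Omega>"
    using p L by (simp add: frontier_def lipschitz_domain_def interior_open)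
  then obtain R e \<gamma> K where R: "R > 0" and e: "norm e = 1" and \<gamma>: "K-lipschitz_on {v. v \<bullet> e = 0} \<gamma>"
    and eq: "\<Omega> \<inter> ball p R = {x \<in> ball p R. x \<bullet> e > \<gamma> (x - (x \<bullet> e) *\<^sub>R e)}"
    using L unfolding lipschitz_domain_def by blast
  have K: "K \<ge> 0" using lipschitz_on_nonneg[OF \<gamma>] .
  have ee: "e \<bullet> e = 1" using e by (simp add: dot_square_norm)
  have main: "\<exists>\<delta>>0. \<forall>x\<in>\<Omega>. \<forall>y\<in>ball p (R / 3). norm (y - x - t *\<^sub>R e) < \<delta> \<longrightarrow> y \<in> \<Omega>"
    if t: "0 < t \<and> t < R / 3" for t
  proof -
    \<comment> \<open>With |y - p| and t below R / 3, the first bound keeps x in the ball of radius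
      R, where the graph describes \<Omega>. The second is the Lipschitz margin: an error z lowers
      the height by at most |z| and raises the graph by at most 2 K |z|, since the projection of z
      has norm at most 2 |z|; the gain in height is t.\<close>
    let ?\<delta> = "min (R / 3) (t / (2 + 2 * K))"
    show ?thesis
    proof (intro exI[of _ ?\<delta>] conjI ballI impI)
      show "?\<delta> > 0" using t R K by simp
      fix x y assume x: "x \<in> \<Omega>" and y: "y \<in> ball p (R / 3)" and d: "norm (y - x - t *\<^sub>R e) < ?\<delta>"
      define z where "z = y - x - t *\<^sub>R e"
      have yz: "y = x + t *\<^sub>R e + z" by (simp add: z_def)
      have "x - p = (y - p) - z - t *\<^sub>R e" by (simp add: z_def)
      then have "norm (x - p) = norm ((y - p) - z - t *\<^sub>R e)" by (rule arg_cong)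
      then have "norm (x - p) \<le> norm (y - p) + norm z + norm (t *\<^sub>R e)"
        using norm_triangle_ineq4[of "(y - p) - z" "t *\<^sub>R e"] norm_triangle_ineq4[of "y - p" z] by linarith
      then have "x \<in> ball p R" using y d t e by (simp add: dist_norm norm_minus_commute z_def)
      then have xe: "x \<bullet> e > \<gamma> (x - (x \<bullet> e) *\<^sub>R e)" using x eq by blast
      have ye: "y \<bullet> e = x \<bullet> e + t + z \<bullet> e" by (simp add: yz inner_add_left ee)
      have ze: "\<bar>z \<bullet> e\<bar> \<le> norm z" using Cauchy_Schwarz_ineq2[of z e] e by simp
      let ?P = "\<lambda>x. x - (x \<bullet> e) *\<^sub>R e"
      have orth: "?P v \<in> {v. v \<bullet> e = 0}" for v by (simp add: inner_diff_left ee)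
      have "?P y - ?P x = z - (z \<bullet> e) *\<^sub>R e" unfolding ye by (simp add: yz scaleR_left_distrib)
      then have "norm (?P y - ?P x) \<le> norm z + \<bar>z \<bullet> e\<bar>"
        using norm_triangle_ineq4[of z "(z \<bullet> e) *\<^sub>R e"] e by simp
      then have n2: "norm (?P y - ?P x) \<le> 2 * norm z" using ze by linarith
      have "\<bar>\<gamma> (?P y) - \<gamma> (?P x)\<bar> \<le> K * norm (?P y - ?P x)"
        using lipschitz_onD[OF \<gamma> orth orth, of y x] by (simp add: dist_norm)
      also have "\<dots> \<le> K * (2 * norm z)" using n2 K by (rule mult_left_mono)
      finally have g: "\<gamma> (?P y) \<le> \<gamma> (?P x) + 2 * K * norm z" by linarith
      have "norm z < t / (2 + 2 * K)" using d by (simp add: z_def)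
      then have "(2 + 2 * K) * norm z < t" using K by (simp add: field_simps)
      moreover have "(2 + 2 * K) * norm z = 2 * norm z + 2 * K * norm z" by (simp add: algebra_simps)
      ultimately have "2 * K * norm z + norm z < t" using norm_ge_zero[of z] by linarith
      then have "y \<bullet> e > \<gamma> (?P y)" using xe g ye ze by linarith
      moreover have "y \<in> ball p R" using y R by simp
      ultimately show "y \<in> \<Omega>" using eq by blast
    qed
  qed
  show ?thesis
    by (rule exI[of _ "R / 3"], rule conjI, use R in simp, rule exI[of _ e]) (use e main in simp)
qed

text \<open>On the support of an admissible cutoff, a mollification with kernel concentrated near \<open>e\<close> reads
  values of functions on \<open>\<Omega>\<close> from inside \<open>\<Omega>\<close> only.\<close>

definition adm :: "(real^'n) set \<Rightarrow> (real^'n \<Rightarrow> real) \<Rightarrow> bool" where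
  "adm \<Omega> \<eta> \<longleftrightarrow> smooth_fun \<eta> \<and> (\<exists>S. compact S \<and> (\<forall>x. x \<notin> S \<longrightarrow> \<eta> x = 0) \<and>
     (\<forall>r>0. \<exists>e \<delta>. \<delta> > 0 \<and> norm e + \<delta> \<le> r \<and>
        (\<forall>x\<in>\<Omega>. \<forall>y\<in>S. norm (y - x - e) < \<delta> \<longrightarrow> y \<in> \<Omega>)))"

lemma adm_test_functions: "adm \<Omega> \<eta> \<Longrightarrow> \<eta> \<in> test_functions UNIV"
  unfolding adm_def test_functions_iff by blast

lemma adm_mult: "adm \<Omega> \<eta> \<Longrightarrow> smooth_fun f \<Longrightarrow> adm \<Omega> (\<lambda>x. \<eta> x * f x)"
  unfolding adm_def by (auto simp: smooth_fun_mult)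

text \<open>The cutoff is supported in half of the ball of the chart, so a single compact set S
  serves for arbitrarily short shifts.\<close>

lemma ex_adm_at:
  fixes \<Omega> :: "(real^'n) set"
  assumes "lipschitz_domain \<Omega>" "p \<in> closure \<Omega>"
  shows "\<exists>r>0. \<exists>\<eta>. adm \<Omega> \<eta> \<and> (\<forall>x\<in>ball p r. \<eta> x = 1)"
proof -
  obtain R e where R: "R > 0" and e: "norm e \<le> 1"
    and ch: "\<And>t. 0 < t \<Longrightarrow> t < R \<Longrightarrow> \<exists>\<delta>>0. \<forall>x\<in>\<Omega>. \<forall>y\<in>ball p R. norm (y - x - t *\<^sub>R e) < \<delta> \<longrightarrow> y \<in> \<Omega>"
    using lipschitz_chart[OF assms] by blast
  obtain \<eta> where \<eta>: "\<eta> \<in> test_functions UNIV" "\<And>x. norm (x - p) \<le> R / 4 \<Longrightarrow> \<eta> x = 1"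
    "\<And>x. norm (x - p) \<ge> R / 2 \<Longrightarrow> \<eta> x = 0"
    using ex_cutoff[of "R / 4" "R / 2" p] R by auto
  have "adm \<Omega> \<eta>"
    unfolding adm_def
  proof (intro conjI exI[of _ "cball p (R / 2)"] allI impI)
    show "smooth_fun \<eta>" by (rule test_functions_smooth[OF \<eta>(1)])
    show "\<eta> x = 0" if "x \<notin> cball p (R / 2)" for x
      using \<eta>(3)[of x] that by (simp add: dist_norm norm_minus_commute)
    fix r :: real assume r: "r > 0"
    \<comment> \<open>Half of the allowance r goes to the shift, the other half to the margin; the
      bound by R / 2 keeps t in the range of the chart.\<close>
    define t where "t = min (r / 2) (R / 2)"
    have t: "0 < t" "t < R" "t \<le> r / 2" using r R by (auto simp: t_def)
    obtain \<delta> where \<delta>: "\<delta> > 0" "\<And>x y. x \<in> \<Omega> \<Longrightarrow> y \<in> ball p R \<Longrightarrow> norm (y - x - t *\<^sub>R e) < \<delta> \<Longrightarrow> y \<in> \<Omega>"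
      using ch[OF t(1,2)] by blast
    have "norm (t *\<^sub>R e) \<le> t * 1" using t(1) e unfolding norm_scaleR by (intro mult_mono) auto
    then have "norm (t *\<^sub>R e) + min \<delta> (r / 2) \<le> r" using t by linarith
    moreover have "y \<in> \<Omega>" if "x \<in> \<Omega>" "y \<in> cball p (R / 2)" "norm (y - x - t *\<^sub>R e) < min \<delta> (r / 2)" for x y
      using \<delta>(2)[OF that(1), of y] that(2,3) R by auto
    ultimately show "\<exists>e \<delta>. \<delta> > 0 \<and> norm e + \<delta> \<le> r \<and>
        (\<forall>x\<in>\<Omega>. \<forall>y\<in>cball p (R / 2). norm (y - x - e) < \<delta> \<longrightarrow> y \<in> \<Omega>)"
      using \<delta>(1) r by (intro exI[of _ "t *\<^sub>R e"] exI[of _ "min \<delta> (r / 2)"]) auto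
  qed (rule compact_cball)
  moreover have "\<forall>x\<in>ball p (R / 4). \<eta> x = 1"
    using \<eta>(2) by (auto simp: dist_norm norm_minus_commute)
  ultimately show ?thesis using R by (intro exI[of _ "R / 4"]) auto
qed

text \<open>Telescoping: \<open>1 - \<Sum> \<eta> = \<Prod> (1 - f)\<close>, so no normalization by a sum is needed.\<close>

lemma adm_partition_finite:
  assumes "finite F" "\<And>f. f \<in> F \<Longrightarrow> adm \<Omega> f"
  shows "\<exists>n (\<eta> :: nat \<Rightarrow> _). (\<forall>i<n. adm \<Omega> (\<eta> i)) \<and> (\<forall>x. (\<exists>f\<in>F. f x = 1) \<longrightarrow> (\<Sum>i<n. \<eta> i x) = 1)"
  using assms
proof (induction rule: finite_induct)
  case empty
  show ?case by (intro exI[of _ 0]) auto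
next
  case (insert f F)
  then obtain n and \<eta> :: "nat \<Rightarrow> _" where \<eta>: "\<And>i. i < n \<Longrightarrow> adm \<Omega> (\<eta> i)"
    "\<And>x. \<exists>f\<in>F. f x = 1 \<Longrightarrow> (\<Sum>i<n. \<eta> i x) = 1" by auto
  let ?g = "\<lambda>x. f x * (1 - (\<Sum>i<n. \<eta> i x))"
  have "smooth_fun (\<lambda>x. 1 - (\<Sum>i<n. \<eta> i x))"
    using \<eta>(1) by (intro smooth_fun_diff smooth_fun_sum) (auto simp: adm_def)
  then have "adm \<Omega> ?g" using adm_mult insert.prems by auto
  let ?\<eta> = "\<eta>(n := ?g)"
  have sum: "(\<Sum>i<Suc n. ?\<eta> i x) = (\<Sum>i<n. \<eta> i x) + ?g x" for x by simp
  have "(\<Sum>i<Suc n. ?\<eta> i x) = 1" if x: "\<exists>f'\<in>insert f F. f' x = 1" for x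
  proof (cases "\<exists>f'\<in>F. f' x = 1")
    case True
    then show ?thesis unfolding sum \<eta>(2)[OF True] by simp
  next
    case False
    then have "f x = 1" using x by auto
    then show ?thesis unfolding sum by simp
  qed
  moreover have "\<forall>i<Suc n. adm \<Omega> (?\<eta> i)" using \<eta>(1) \<open>adm \<Omega> ?g\<close> by (auto simp: less_Suc_eq)
  ultimately show ?case by blast
qed

lemma adm_partition:
  fixes \<Omega> :: "(real^'n) set"
  assumes "lipschitz_domain \<Omega>" "bounded \<Omega>"
  shows "\<exists>n (\<eta> :: nat \<Rightarrow> _). (\<forall>i<n. adm \<Omega> (\<eta> i)) \<and> (\<forall>x\<in>\<Omega>. (\<Sum>i<n. \<eta> i x) = 1)"
proof -
  have "\<forall>p\<in>closure \<Omega>. \<exists>r \<eta>. r > 0 \<and> adm \<Omega> \<eta> \<and> (\<forall>x\<in>ball p r. \<eta> x = 1)"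
    using ex_adm_at[OF assms(1)] by blast
  then obtain r \<eta> where r: "\<And>p. p \<in> closure \<Omega> \<Longrightarrow> r p > 0 \<and> adm \<Omega> (\<eta> p) \<and> (\<forall>x\<in>ball p (r p). \<eta> p x = 1)"
    by metis
  have cpt: "compact (closure \<Omega>)" using assms(2) by (simp add: compact_closure)
  have cov: "closure \<Omega> \<subseteq> (\<Union>p\<in>closure \<Omega>. ball p (r p))" using r by force
  obtain P where P: "P \<subseteq> closure \<Omega>" "finite P" "closure \<Omega> \<subseteq> (\<Union>p\<in>P. ball p (r p))"
    by (rule compactE_image[OF cpt _ cov]) auto
  have ad: "adm \<Omega> f" if "f \<in> \<eta> ` P" for f using that P(1) r by auto
  have "\<exists>n (\<eta>' :: nat \<Rightarrow> real^'n \<Rightarrow> real). (\<forall>i<n. adm \<Omega> (\<eta>' i)) \<and>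
      (\<forall>x. (\<exists>f\<in>\<eta> ` P. f x = 1) \<longrightarrow> (\<Sum>i<n. \<eta>' i x) = 1)"
    by (rule adm_partition_finite[OF finite_imageI[OF P(2)]]) (rule ad)
  then obtain n where "\<exists>\<eta>' :: nat \<Rightarrow> real^'n \<Rightarrow> real. (\<forall>i<n. adm \<Omega> (\<eta>' i)) \<and>
      (\<forall>x. (\<exists>f\<in>\<eta> ` P. f x = 1) \<longrightarrow> (\<Sum>i<n. \<eta>' i x) = 1)" ..
  then obtain \<eta>' :: "nat \<Rightarrow> real^'n \<Rightarrow> real" where n': "(\<forall>i<n. adm \<Omega> (\<eta>' i)) \<and>
      (\<forall>x. (\<exists>f\<in>\<eta> ` P. f x = 1) \<longrightarrow> (\<Sum>i<n. \<eta>' i x) = 1)" ..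
  note n = n'[THEN conjunct1] n'[THEN conjunct2]
  have "(\<Sum>i<n. \<eta>' i x) = 1" if x: "x \<in> \<Omega>" for x
  proof -
    have "x \<in> (\<Union>p\<in>P. ball p (r p))" using x P(3) closure_subset[of \<Omega>] by (meson subsetD)
    then obtain p where p: "p \<in> P" "x \<in> ball p (r p)" by (rule UN_E)
    then have "\<eta> p x = 1" using r[of p] P(1) by auto
    then show ?thesis using n(2)[rule_format, of x] p(1) by (meson imageI)
  qed
  then show ?thesis using n(1) by (intro exI[of _ n] exI[of _ \<eta>'] conjI ballI) simp_all
qed


section \<open>Approximation by test functions with controlled Laplacian\<close>

definition Lap :: "(real^'n \<Rightarrow> real) \<Rightarrow> real^'n \<Rightarrow> real" where
  "Lap \<phi> x = (\<Sum>i\<in>UNIV. partial_deriv i (partial_deriv i \<phi>) x)"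

lemma test_functions_sum:
  "finite A \<Longrightarrow> (\<And>a. a \<in> A \<Longrightarrow> f a \<in> test_functions \<Omega>) \<Longrightarrow> (\<lambda>x. \<Sum>a\<in>A. f a x) \<in> test_functions \<Omega>"
  by (induction rule: finite_induct) (auto intro: test_functions_add test_functions_zero)

lemma Lap_test_functions:
  assumes "\<phi> \<in> test_functions \<Omega>"
  shows "Lap \<phi> \<in> test_functions \<Omega>"
proof -
  have "(\<lambda>x. \<Sum>i\<in>UNIV. partial_deriv i (partial_deriv i \<phi>) x) \<in> test_functions \<Omega>"
    by (rule test_functions_sum[OF finite]) (rule test_functions_partial[OF test_functions_partial[OF assms]])
  moreover have "Lap \<phi> = (\<lambda>x. \<Sum>i\<in>UNIV. partial_deriv i (partial_deriv i \<phi>) x)"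
    by (rule ext) (rule Lap_def)
  ultimately show ?thesis by simp
qed

lemma partial_deriv_sum:
  "finite A \<Longrightarrow> (\<And>a. a \<in> A \<Longrightarrow> smooth_fun (f a)) \<Longrightarrow>
    partial_deriv i (\<lambda>x. \<Sum>a\<in>A. f a x) = (\<lambda>x. \<Sum>a\<in>A. partial_deriv i (f a) x)"
proof (induction rule: finite_induct)
  case (insert a A)
  have "smooth_fun (\<lambda>x. \<Sum>a\<in>A. f a x)" using insert by (intro smooth_fun_sum) auto
  then have "partial_deriv i (\<lambda>x. f a x + (\<Sum>a\<in>A. f a x)) x
      = partial_deriv i (f a) x + partial_deriv i (\<lambda>x. \<Sum>a\<in>A. f a x) x" for x
    using insert.prems by (intro partial_deriv_add smooth_fun_differentiable) auto
  then show ?case using insert by auto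
qed simp

lemma Lap_sum:
  assumes "finite A" "\<And>a. a \<in> A \<Longrightarrow> smooth_fun (f a)"
  shows "Lap (\<lambda>x. \<Sum>a\<in>A. f a x) = (\<lambda>x. \<Sum>a\<in>A. Lap (f a) x)"
proof
  fix x
  have "partial_deriv i (partial_deriv i (\<lambda>x. \<Sum>a\<in>A. f a x))
      = (\<lambda>x. \<Sum>a\<in>A. partial_deriv i (partial_deriv i (f a)) x)" for i
    by (simp add: partial_deriv_sum assms smooth_fun_partial)
  then show "Lap (\<lambda>x. \<Sum>a\<in>A. f a x) x = (\<Sum>a\<in>A. Lap (f a) x)"
    unfolding Lap_def by (simp add: sum.swap[of _ A])
qed

lemma partial_deriv_const_on:
  assumes "open \<Omega>" "\<And>x. x \<in> \<Omega> \<Longrightarrow> F x = c" "x \<in> \<Omega>"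
  shows "partial_deriv i F x = 0"
proof -
  have "(F has_derivative (\<lambda>h. 0)) (at x)"
    by (rule has_derivative_transform_within_open[where f = "\<lambda>x. c", OF _ assms(1,3)])
       (use assms(2) in auto)
  from partial_deriv_eqI[OF this] show ?thesis by simp
qed

text \<open>The product rule for \<open>\<eta> * u\<close>, carried out on the side of the test
  function by inserting \<open>\<eta> * \<psi>\<close> into the weak gradient identity.\<close>

lemma cutoff_weak_derivative:
  assumes u: "u \<in> L2 \<Omega>" and g: "g \<in> L2 \<Omega>"
    and wg: "\<And>\<psi>. \<psi> \<in> test_functions UNIV \<Longrightarrow> ip u (partial_deriv i \<psi>) = - ip g \<psi>"
    and \<eta>: "\<eta> \<in> test_functions UNIV" and \<psi>: "\<psi> \<in> test_functions UNIV"
  shows "ip u (\<lambda>x. \<eta> x * partial_deriv i \<psi> x) = - ip g (\<lambda>x. \<eta> x * \<psi> x) - ip u (\<lambda>x. partial_deriv i \<eta> x * \<psi> x)"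
proof -
  note s = smooth_fun_differentiable[OF test_functions_smooth[OF \<eta>]] smooth_fun_differentiable[OF test_functions_smooth[OF \<psi>]]
  have p: "(\<lambda>x. \<eta> x * \<psi> x) \<in> test_functions UNIV"
    by (rule test_functions_mult[OF \<psi> test_functions_smooth[OF \<eta>]])
  have q: "(\<lambda>x. partial_deriv i \<eta> x * \<psi> x) \<in> test_functions UNIV"
    by (rule test_functions_mult[OF \<psi> smooth_fun_partial[OF test_functions_smooth[OF \<eta>]]])
  have "(\<lambda>x. \<eta> x * partial_deriv i \<psi> x)
      = (\<lambda>x. partial_deriv i (\<lambda>x. \<eta> x * \<psi> x) x - partial_deriv i \<eta> x * \<psi> x)"
    unfolding partial_deriv_mult[OF s] by simp
  then have "ip u (\<lambda>x. \<eta> x * partial_deriv i \<psi> x)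
      = ip u (partial_deriv i (\<lambda>x. \<eta> x * \<psi> x)) - ip u (\<lambda>x. partial_deriv i \<eta> x * \<psi> x)"
    using ip_diff_right[OF test_functions_L2[OF test_functions_partial[OF p]] test_functions_L2[OF q] u] by simp
  then show ?thesis using wg[OF p] by simp
qed

section \<open>Localizing a function whose Laplacian in \<Omega> is a given functional\<close>

context
  fixes \<Omega> :: "(real^'n) set" and u :: "real^'n \<Rightarrow> real" and g :: "'n \<Rightarrow> real^'n \<Rightarrow> real"
    and l :: "(real^'n \<Rightarrow> real) \<Rightarrow> real"
  assumes u: "u \<in> L2 \<Omega>" and g: "\<And>i. g i \<in> L2 \<Omega>" and b: "bounded \<Omega>"
    and wg: "\<And>i \<psi>. \<psi> \<in> test_functions UNIV \<Longrightarrow> ip u (partial_deriv i \<psi>) = - ip (g i) \<psi>"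
    and eq: "\<And>\<psi>. \<psi> \<in> test_functions \<Omega> \<Longrightarrow> (\<Sum>i\<in>UNIV. ip (g i) (partial_deriv i \<psi>)) = - l \<psi>"
begin

definition cut_grad :: "(real^'n \<Rightarrow> real) \<Rightarrow> 'n \<Rightarrow> real^'n \<Rightarrow> real" where
  "cut_grad \<eta> i x = \<eta> x * g i x + partial_deriv i \<eta> x * u x"

text \<open>The Laplacian of \<open>\<eta> u\<close> if \<open>u\<close> had Laplacian \<open>f\<close>.\<close>

definition cut_Lap :: "(real^'n \<Rightarrow> real) \<Rightarrow> (real^'n \<Rightarrow> real) \<Rightarrow> real^'n \<Rightarrow> real" where
  "cut_Lap f \<eta> x = \<eta> x * f x + 2 * (\<Sum>i\<in>UNIV. partial_deriv i \<eta> x * g i x) + Lap \<eta> x * u x"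

lemma cut_grad_L2: "\<eta> \<in> test_functions UNIV \<Longrightarrow> cut_grad \<eta> i \<in> L2 \<Omega>"
  unfolding cut_grad_def[abs_def]
  by (rule L2_add[OF L2_mult_test[OF g] L2_mult_test[OF u test_functions_partial]])

lemma cut_Lap_L2: "\<eta> \<in> test_functions UNIV \<Longrightarrow> f \<in> L2 \<Omega> \<Longrightarrow> cut_Lap f \<eta> \<in> L2 \<Omega>"
  unfolding cut_Lap_def[abs_def]
  by (rule L2_add[OF L2_add[OF L2_mult_test L2_cmult[OF L2_sum[OF finite L2_mult_test[OF g test_functions_partial]]]]
        L2_mult_test[OF u Lap_test_functions]])

lemma cut_grad_weak:
  assumes \<eta>: "\<eta> \<in> test_functions UNIV" and \<psi>: "\<psi> \<in> test_functions UNIV"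
  shows "ip (\<lambda>x. \<eta> x * u x) (partial_deriv i \<psi>) = - ip (cut_grad \<eta> i) \<psi>"
proof -
  have "ip (cut_grad \<eta> i) \<psi> = ip (\<lambda>x. \<eta> x * g i x) \<psi> + ip (\<lambda>x. partial_deriv i \<eta> x * u x) \<psi>"
    unfolding cut_grad_def[abs_def]
    by (rule ip_add_left[OF L2_mult_test[OF g \<eta>] L2_mult_test[OF u test_functions_partial[OF \<eta>]] test_functions_L2[OF \<psi>]])
  then show ?thesis
    using cutoff_weak_derivative[OF u g wg \<eta> \<psi>, of i] by (simp add: ip_mult_shift)
qed

text \<open>The left-hand side is the distributional Laplacian of \<open>\<eta> * u\<close> tested
  with W. The equation in \<Omega> may be used once \<open>\<eta> * W\<close> is a test function of
  \<Omega>, and then only the mismatch of l and f on it remains. The factor 2 of the mixed term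
  comes half from the product rule on the test function and half from moving the derivative off W in
  the term with u.\<close>

lemma cut_Lap_identity:
  assumes \<eta>: "\<eta> \<in> test_functions UNIV" and W: "W \<in> test_functions UNIV"
    and \<eta>W: "(\<lambda>x. \<eta> x * W x) \<in> test_functions \<Omega>" and f: "f \<in> L2 \<Omega>"
  shows "- (\<Sum>i\<in>UNIV. ip (cut_grad \<eta> i) (partial_deriv i W))
    = l (\<lambda>x. \<eta> x * W x) - ip f (\<lambda>x. \<eta> x * W x) + ip (cut_Lap f \<eta>) W"
proof -
  let ?d = "\<lambda>i. partial_deriv i \<eta>"
  have d: "?d i \<in> test_functions UNIV" for i by (rule test_functions_partial[OF \<eta>])
  note WL = test_functions_L2[OF W]
  note \<eta>W' = test_functions_UNIV[OF \<eta>W]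
  have 1: "ip (cut_grad \<eta> i) (partial_deriv i W) = ip (g i) (partial_deriv i (\<lambda>x. \<eta> x * W x))
      - 2 * ip (\<lambda>x. ?d i x * g i x) W - ip (\<lambda>x. partial_deriv i (?d i) x * u x) W" for i
  proof -
    note s = smooth_fun_differentiable[OF test_functions_smooth[OF \<eta>]] smooth_fun_differentiable[OF test_functions_smooth[OF W]]
    have q: "(\<lambda>x. ?d i x * W x) \<in> test_functions UNIV"
      by (rule test_functions_mult[OF W test_functions_smooth[OF d]])
    have "(\<lambda>x. \<eta> x * partial_deriv i W x) = (\<lambda>x. partial_deriv i (\<lambda>x. \<eta> x * W x) x - ?d i x * W x)"
      unfolding partial_deriv_mult[OF s] by simp
    then have "ip (g i) (\<lambda>x. \<eta> x * partial_deriv i W x)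
        = ip (g i) (partial_deriv i (\<lambda>x. \<eta> x * W x)) - ip (g i) (\<lambda>x. ?d i x * W x)"
      using ip_diff_right[OF test_functions_L2[OF test_functions_partial[OF \<eta>W']] test_functions_L2[OF q] g] by simp
    moreover have "ip (cut_grad \<eta> i) (partial_deriv i W)
        = ip (\<lambda>x. \<eta> x * g i x) (partial_deriv i W) + ip (\<lambda>x. ?d i x * u x) (partial_deriv i W)"
      unfolding cut_grad_def[abs_def]
      by (rule ip_add_left[OF L2_mult_test[OF g \<eta>] L2_mult_test[OF u d] test_functions_L2[OF test_functions_partial[OF W]]])
    moreover have "ip u (\<lambda>x. ?d i x * partial_deriv i W x)
        = - ip (g i) (\<lambda>x. ?d i x * W x) - ip u (\<lambda>x. partial_deriv i (?d i) x * W x)"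
      by (rule cutoff_weak_derivative[OF u g wg d W])
    ultimately show ?thesis by (simp add: ip_mult_shift)
  qed
  have dd: "(\<lambda>x. partial_deriv i (?d i) x * u x) \<in> L2 \<Omega>" for i
    by (rule L2_mult_test[OF u test_functions_partial[OF d]])
  have "(\<lambda>x. Lap \<eta> x * u x) = (\<lambda>x. \<Sum>i\<in>UNIV. partial_deriv i (?d i) x * u x)"
    by (simp add: Lap_def sum_distrib_right)
  then have 2: "ip (\<lambda>x. Lap \<eta> x * u x) W = (\<Sum>i\<in>UNIV. ip (\<lambda>x. partial_deriv i (?d i) x * u x) W)"
    using ip_sum_left[OF finite dd WL] by simp
  note L = L2_mult_test[OF f \<eta>] L2_sum[OF finite L2_mult_test[OF g d]] L2_mult_test[OF u Lap_test_functions[OF \<eta>]]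
  have "ip (cut_Lap f \<eta>) W = ip (\<lambda>x. \<eta> x * f x + 2 * (\<Sum>i\<in>UNIV. ?d i x * g i x)) W + ip (\<lambda>x. Lap \<eta> x * u x) W"
    unfolding cut_Lap_def[abs_def] by (rule ip_add_left[OF L2_add[OF L(1) L2_cmult[OF L(2)]] L(3) WL])
  also have "ip (\<lambda>x. \<eta> x * f x + 2 * (\<Sum>i\<in>UNIV. ?d i x * g i x)) W
      = ip (\<lambda>x. \<eta> x * f x) W + 2 * ip (\<lambda>x. \<Sum>i\<in>UNIV. ?d i x * g i x) W"
    using ip_add_left[OF L(1) L2_cmult[OF L(2)] WL, of 2] by (simp only: ip_cmult_left)
  also have "ip (\<lambda>x. \<Sum>i\<in>UNIV. ?d i x * g i x) W = (\<Sum>i\<in>UNIV. ip (\<lambda>x. ?d i x * g i x) W)"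
    by (rule ip_sum_left[OF finite L2_mult_test[OF g d] WL])
  finally have 3: "ip (cut_Lap f \<eta>) W = ip f (\<lambda>x. \<eta> x * W x) + 2 * (\<Sum>i\<in>UNIV. ip (\<lambda>x. ?d i x * g i x) W)
      + (\<Sum>i\<in>UNIV. ip (\<lambda>x. partial_deriv i (?d i) x * u x) W)"
    unfolding 2 by (simp add: ip_mult_shift)
  show ?thesis unfolding 3 1 sum_subtractf eq[OF \<eta>W] by (simp add: sum_distrib_left)
qed

text \<open>The gradient identity holds against all test functions, the equation only against those
  of \<Omega>; the shifted kernel bridges this gap. Testing the Laplacian of the mollified piece
  with w in \<open>L2 \<Omega>\<close> amounts to testing the Laplacian of the piece with W, the
  mollification of w by the reflected kernel. W lives near the shift of \<Omega>, and on the support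
  of \<open>\<eta>\<close> this shift lies inside \<Omega> with a margin, so
  \<open>\<eta> * W\<close> is admissible in the equation. The term B * c is the price of replacing
  l by f.\<close>

lemma approx_adm:
  assumes f: "f \<in> L2 \<Omega>" and lf: "\<And>w. w \<in> L2 \<Omega> \<Longrightarrow> \<bar>l w - ip f w\<bar> \<le> c * nrm w" and c: "c \<ge> 0"
    and ad: "adm \<Omega> \<eta>" and B: "\<And>x. \<bar>\<eta> x\<bar> \<le> B" and e: "\<epsilon> > 0"
  shows "\<exists>\<phi>\<in>test_functions UNIV. (\<forall>i. nrm (\<lambda>x. partial_deriv i \<phi> x - cut_grad \<eta> i x) \<le> \<epsilon>) \<and>
    (\<forall>w\<in>L2 \<Omega>. \<bar>ip (Lap \<phi>) w - ip (cut_Lap f \<eta>) w\<bar> \<le> (\<epsilon> + B * c) * nrm w)"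
proof -
  note \<eta> = adm_test_functions[OF ad]
  have "\<exists>r>0. \<forall>k. kernel r k \<longrightarrow> nrm (\<lambda>x. moll k (cut_grad \<eta> i) x - cut_grad \<eta> i x) \<le> \<epsilon>" for i
    by (rule moll_approx[OF b cut_grad_L2[OF \<eta>] e])
  then obtain r1 where r1: "\<And>i. r1 i > 0"
    "\<And>i k. kernel (r1 i) k \<Longrightarrow> nrm (\<lambda>x. moll k (cut_grad \<eta> i) x - cut_grad \<eta> i x) \<le> \<epsilon>"
    by metis
  obtain r2 where r2: "r2 > 0"
    "\<And>k. kernel r2 k \<Longrightarrow> nrm (\<lambda>x. moll k (cut_Lap f \<eta>) x - cut_Lap f \<eta> x) \<le> \<epsilon>"
    using moll_approx[OF b cut_Lap_L2[OF \<eta> f] e] by blast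
  define r where "r = min r2 (Min (range r1))"
  have r: "r > 0" "r \<le> r2" "r \<le> r1 i" for i
    using r1(1) r2(1) Min_le[of "range r1" "r1 i"] by (auto simp: r_def min_le_iff_disj)
  obtain S where S: "compact S" "\<And>x. x \<notin> S \<Longrightarrow> \<eta> x = 0"
    "\<forall>r>0. \<exists>e \<delta>. \<delta> > 0 \<and> norm e + \<delta> \<le> r \<and> (\<forall>x\<in>\<Omega>. \<forall>y\<in>S. norm (y - x - e) < \<delta> \<longrightarrow> y \<in> \<Omega>)"
    using ad unfolding adm_def by blast
  obtain a \<delta> where a: "\<delta> > 0" "norm a + \<delta> \<le> r"
    "\<And>x y. x \<in> \<Omega> \<Longrightarrow> y \<in> S \<Longrightarrow> norm (y - x - a) < \<delta> \<Longrightarrow> y \<in> \<Omega>"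
    using S(3) r(1) by blast
  \<comment> \<open>Only half of the margin is given to the kernel; the other half is used when
    passing to the closure of the set T.\<close>
  obtain k where k: "kernel (norm a + \<delta> / 2) k" "\<And>z. norm (z - a) \<ge> \<delta> / 2 \<Longrightarrow> k z = 0"
    using ex_kernel[of "\<delta> / 2" a] a(1) by auto
  note kt = kernel_test_function[OF k(1)]
  have kr: "kernel r k" by (rule kernel_mono[OF k(1)]) (use a in linarith)
  let ?v = "\<lambda>x. \<eta> x * u x"
  let ?h = "cut_grad \<eta>"
  let ?F = "cut_Lap f \<eta>"
  let ?\<phi> = "moll k ?v"
  let ?k = "\<lambda>z. k (- z)"
  note h = cut_grad_L2[OF \<eta>]
  note F = cut_Lap_L2[OF \<eta> f]
  have v: "?v \<in> L2 \<Omega>" by (rule L2_mult_test[OF u \<eta>])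
  have \<phi>: "?\<phi> \<in> test_functions UNIV" by (rule moll_test_functions[OF kt b v])
  have d\<phi>: "partial_deriv i ?\<phi> = moll k (?h i)" for i
  proof
    fix x
    have "moll (partial_deriv i k) ?v x = - moll k (?h i) x"
      by (rule moll_weak_derivative[OF kt cut_grad_weak[OF \<eta>]])
    then show "partial_deriv i ?\<phi> x = moll k (?h i) x"
      by (simp add: partial_deriv_moll[OF kt L2_integrable[OF b v]])
  qed
  have "nrm (\<lambda>x. partial_deriv i ?\<phi> x - ?h i x) \<le> \<epsilon>" for i
    unfolding d\<phi> by (rule r1(2)[OF kernel_mono[OF kr r(3)]])
  moreover have "\<bar>ip (Lap ?\<phi>) w - ip ?F w\<bar> \<le> (\<epsilon> + B * c) * nrm w" if w: "w \<in> L2 \<Omega>" for w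
  proof -
    let ?W = "moll ?k w"
    note kt' = test_functions_reflect[OF kt]
    have W: "?W \<in> test_functions UNIV" by (rule moll_test_functions[OF kt' b w])
    have dW: "partial_deriv i ?W = moll (\<lambda>z. partial_deriv i k (- z)) w" for i
      unfolding partial_deriv_moll[OF kt' L2_integrable[OF b w]] partial_deriv_reflect[OF test_functions_smooth[OF kt]]
      by (simp add: moll_def fun_eq_iff)
    have L1: "ip (partial_deriv i (partial_deriv i ?\<phi>)) w = - ip (?h i) (partial_deriv i ?W)" for i
    proof -
      have "partial_deriv i (partial_deriv i ?\<phi>) = (\<lambda>x. (-1) * moll (partial_deriv i k) (?h i) x)"
        unfolding d\<phi> by (rule partial_deriv_moll[OF kt L2_integrable[OF b h]])
      then have "ip (partial_deriv i (partial_deriv i ?\<phi>)) w = - ip (moll (partial_deriv i k) (?h i)) w"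
        by (simp only: ip_cmult_left)
      then show ?thesis unfolding dW by (simp add: ip_moll[OF test_functions_partial[OF kt] b h b w])
    qed
    have "ip (Lap ?\<phi>) w = (\<Sum>i\<in>UNIV. ip (partial_deriv i (partial_deriv i ?\<phi>)) w)"
      unfolding Lap_def[abs_def]
      by (rule ip_sum_left[OF finite test_functions_L2[OF test_functions_partial[OF test_functions_partial[OF \<phi>]]] w])
    then have Lw: "ip (Lap ?\<phi>) w = - (\<Sum>i\<in>UNIV. ip (?h i) (partial_deriv i ?W))"
      unfolding L1 by (simp add: sum_negf)
    \<comment> \<open>This is \<Omega> shifted by a and thickened by the radius of the kernel;
      outside it \<open>?W\<close> vanishes, because no point of \<Omega> is within reach.\<close>
    define T where "T = {x. \<exists>y\<in>\<Omega>. norm (x - y - a) < \<delta> / 2}"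
    have "(\<lambda>x. \<eta> x * ?W x) \<in> test_functions \<Omega>"
      unfolding test_functions_iff
    proof (intro conjI exI[of _ "S \<inter> closure T"] allI impI)
      show "smooth_fun (\<lambda>x. \<eta> x * ?W x)" by (intro smooth_fun_mult test_functions_smooth[OF \<eta>] test_functions_smooth[OF W])
      show "compact (S \<inter> closure T)" by (rule compact_Int_closed[OF S(1) closed_closure])
      show "S \<inter> closure T \<subseteq> \<Omega>"
      proof
        fix x assume x: "x \<in> S \<inter> closure T"
        then obtain x' where x': "x' \<in> T" "dist x' x < \<delta> / 2"
          using closure_approachable[of x T] a(1) by (meson IntD2 half_gt_zero)
        then obtain y where y: "y \<in> \<Omega>" "norm (x' - y - a) < \<delta> / 2" by (auto simp: T_def)
        have "x - y - a = (x' - y - a) - (x' - x)" by simp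
        then have "norm (x - y - a) \<le> norm (x' - y - a) + norm (x' - x)"
          using norm_triangle_ineq4 by metis
        then have "norm (x - y - a) < \<delta>" using y(2) x'(2) by (simp add: dist_norm)
        then show "x \<in> \<Omega>" using a(3)[OF y(1)] x by blast
      qed
      fix x assume "x \<notin> S \<inter> closure T"
      then have "x \<notin> S \<or> x \<notin> T" using closure_subset[of T] by blast
      then show "\<eta> x * ?W x = 0"
      proof
        assume "x \<notin> T"
        have "?W x = 0"
        proof (rule moll_eq_0[OF w])
          fix y assume "y \<in> \<Omega>"
          then have "norm (x - y - a) \<ge> \<delta> / 2" using \<open>x \<notin> T\<close> by (auto simp: T_def not_less)
          then show "k (- (y - x)) = 0" using k(2)[of "x - y"] by simp
        qed
        then show ?thesis by simp
      qed (use S(2) in simp)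
    qed
    note \<eta>W = this
    have "ip ?F ?W = ip (moll k ?F) w" by (rule ip_moll[OF kt b F b w, symmetric])
    then have "ip (Lap ?\<phi>) w - ip ?F w
        = (l (\<lambda>x. \<eta> x * ?W x) - ip f (\<lambda>x. \<eta> x * ?W x)) + (ip (moll k ?F) w - ip ?F w)"
      unfolding Lw cut_Lap_identity[OF \<eta> W \<eta>W f] by simp
    also have "ip (moll k ?F) w - ip ?F w = ip (\<lambda>x. moll k ?F x - ?F x) w"
      by (rule ip_diff_left[OF test_functions_L2[OF moll_test_functions[OF kt b F]] F w, symmetric])
    finally have E: "ip (Lap ?\<phi>) w - ip ?F w
        = (l (\<lambda>x. \<eta> x * ?W x) - ip f (\<lambda>x. \<eta> x * ?W x)) + ip (\<lambda>x. moll k ?F x - ?F x) w" .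
    have "\<bar>ip (Lap ?\<phi>) w - ip ?F w\<bar>
        \<le> \<bar>l (\<lambda>x. \<eta> x * ?W x) - ip f (\<lambda>x. \<eta> x * ?W x)\<bar> + \<bar>ip (\<lambda>x. moll k ?F x - ?F x) w\<bar>"
      unfolding E by (rule abs_triangle_ineq)
    also have "\<bar>l (\<lambda>x. \<eta> x * ?W x) - ip f (\<lambda>x. \<eta> x * ?W x)\<bar> \<le> c * (B * nrm w)"
    proof -
      have "B \<ge> 0" using B abs_ge_zero order_trans by blast
      have "\<bar>l (\<lambda>x. \<eta> x * ?W x) - ip f (\<lambda>x. \<eta> x * ?W x)\<bar> \<le> c * nrm (\<lambda>x. \<eta> x * ?W x)"
        by (rule lf[OF test_functions_L2[OF \<eta>W]])
      also have "nrm (\<lambda>x. \<eta> x * ?W x) \<le> B * nrm ?W"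
        by (rule nrm_mult_bounded[OF test_functions_L2[OF W] test_functions_measurable[OF \<eta>] B])
      also have "nrm ?W \<le> nrm w" by (rule nrm_moll_le[OF kernel_reflect[OF kr] b w])
      finally show ?thesis using c \<open>B \<ge> 0\<close> by (simp add: mult_left_mono)
    qed
    also have "\<bar>ip (\<lambda>x. moll k ?F x - ?F x) w\<bar> \<le> nrm (\<lambda>x. moll k ?F x - ?F x) * nrm w"
      by (rule ip_Cauchy_Schwarz[OF L2_diff[OF test_functions_L2[OF moll_test_functions[OF kt b F]] L2_UNIV[OF F]] w])
    also have "\<dots> \<le> \<epsilon> * nrm w"
      by (rule mult_right_mono[OF r2(2)[OF kernel_mono[OF kr r(2)]] nrm_nonneg])
    finally show ?thesis by (simp add: algebra_simps)
  qed
  ultimately show ?thesis using \<phi> by blast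
qed

text \<open>The cutoffs sum to 1 on the open set \<Omega>, so the sums of their first and second
  derivatives vanish there, and the localized gradients and Laplacians add up to g and f. Outside
  \<Omega> all the functions involved are zero almost everywhere.\<close>

lemma approx_Lap:
  assumes lip: "lipschitz_domain \<Omega>"
    and riesz: "\<And>\<epsilon>. \<epsilon> > 0 \<Longrightarrow> \<exists>f\<in>L2 \<Omega>. \<forall>w\<in>L2 \<Omega>. \<bar>l w - ip f w\<bar> \<le> \<epsilon> * nrm w"
    and e: "\<epsilon> > 0"
  shows "\<exists>\<phi>\<in>test_functions UNIV. (\<forall>i. nrm (\<lambda>x. partial_deriv i \<phi> x - g i x) \<le> \<epsilon>) \<and>
    (\<forall>w\<in>L2 \<Omega>. \<bar>ip (Lap \<phi>) w - l w\<bar> \<le> \<epsilon> * nrm w)"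
proof -
  have op: "open \<Omega>" using lip by (simp add: lipschitz_domain_def)
  obtain n and \<eta> :: "nat \<Rightarrow> real^'n \<Rightarrow> real" where ad: "\<And>j. j < n \<Longrightarrow> adm \<Omega> (\<eta> j)"
    and one: "\<And>x. x \<in> \<Omega> \<Longrightarrow> (\<Sum>j<n. \<eta> j x) = 1"
    using adm_partition[OF lip b] by blast
  note \<eta> = adm_test_functions[OF ad]
  have "\<forall>j. \<exists>B. j < n \<longrightarrow> B > 0 \<and> (\<forall>x. \<bar>\<eta> j x\<bar> \<le> B)"
    using test_functions_bounded[OF \<eta>] by blast
  from choice[OF this] obtain B where B: "\<And>j. j < n \<Longrightarrow> B j > 0" "\<And>j x. j < n \<Longrightarrow> \<bar>\<eta> j x\<bar> \<le> B j" by blast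
  have SB: "(\<Sum>j<n. B j) \<ge> 0" using B(1) by (intro sum_nonneg) (simp add: less_imp_le)
  \<comment> \<open>The partition and its bounds depend on \<Omega> alone and are fixed before f is
    chosen. Hence the accuracy of f can compensate the bounds of the cutoffs: the errors through l -
    f add up to \<epsilon> / 2, and so do at most the n mollification errors.\<close>
  define c where "c = \<epsilon> / (2 * (1 + (\<Sum>j<n. B j)))"
  have c: "c > 0" using e SB by (simp add: c_def)
  obtain f where f: "f \<in> L2 \<Omega>" "\<And>w. w \<in> L2 \<Omega> \<Longrightarrow> \<bar>l w - ip f w\<bar> \<le> c * nrm w"
    using riesz[OF c] by blast
  define e' where "e' = \<epsilon> / (2 * (real n + 1))"
  have e': "e' > 0" using e by (simp add: e'_def)
  have ne: "real n * e' \<le> \<epsilon> / 2" using e by (simp add: e'_def field_simps)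
  let ?P = "\<lambda>j \<phi>. \<phi> \<in> test_functions UNIV \<and> (\<forall>i. nrm (\<lambda>x. partial_deriv i \<phi> x - cut_grad (\<eta> j) i x) \<le> e') \<and>
    (\<forall>w\<in>L2 \<Omega>. \<bar>ip (Lap \<phi>) w - ip (cut_Lap f (\<eta> j)) w\<bar> \<le> (e' + B j * c) * nrm w)"
  have "\<exists>\<phi>. j < n \<longrightarrow> ?P j \<phi>" for j
    using approx_adm[OF f less_imp_le[OF c] ad B(2) e', of j] by blast
  then have "\<forall>j. \<exists>\<phi>. j < n \<longrightarrow> ?P j \<phi>" by (rule allI)
  from choice[OF this] obtain \<phi> where \<phi>P: "\<forall>j. j < n \<longrightarrow> ?P j (\<phi> j)" ..
  then have \<phi>: "\<And>j. j < n \<Longrightarrow> \<phi> j \<in> test_functions UNIV"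
    "\<And>j i. j < n \<Longrightarrow> nrm (\<lambda>x. partial_deriv i (\<phi> j) x - cut_grad (\<eta> j) i x) \<le> e'"
    "\<And>j w. j < n \<Longrightarrow> w \<in> L2 \<Omega> \<Longrightarrow> \<bar>ip (Lap (\<phi> j)) w - ip (cut_Lap f (\<eta> j)) w\<bar> \<le> (e' + B j * c) * nrm w"
    by simp_all
  let ?\<phi> = "\<lambda>x. \<Sum>j<n. \<phi> j x"
  have sm: "smooth_fun (\<eta> j)" "smooth_fun (\<phi> j)" if "j < n" for j
    using \<eta>[OF that] \<phi>(1)[OF that] by (simp_all add: test_functions_smooth)
  have d1: "(\<Sum>j<n. partial_deriv i (\<eta> j) x) = 0" if "x \<in> \<Omega>" for x i
    using partial_deriv_const_on[of \<Omega> "\<lambda>x. \<Sum>j<n. \<eta> j x" 1 x i, OF op one that] partial_deriv_sum[of "{..<n}" \<eta> i] sm(1) by simp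
  have d2: "(\<Sum>j<n. partial_deriv i (partial_deriv i (\<eta> j)) x) = 0" if "x \<in> \<Omega>" for x i
    using partial_deriv_const_on[of \<Omega> "\<lambda>x. \<Sum>j<n. partial_deriv i (\<eta> j) x" 0 x i, OF op d1 that] partial_deriv_sum[of "{..<n}" "\<lambda>j. partial_deriv i (\<eta> j)" i]
      smooth_fun_partial[OF sm(1)] by simp
  have d3: "(\<Sum>j<n. Lap (\<eta> j) x) = 0" if "x \<in> \<Omega>" for x
    unfolding Lap_def by (subst sum.swap) (simp add: d2[OF that])
  have zero: "AE x in lborel. x \<notin> \<Omega> \<longrightarrow> v x = 0" if "v \<in> L2 \<Omega>" for v
    using that by (simp add: L2_def)
  have ae1: "AE x in lborel. (\<Sum>j<n. cut_grad (\<eta> j) i x) = g i x" for i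
    using zero[OF u] zero[OF g[of i]]
  proof eventually_elim
    case (elim x)
    have "(\<Sum>j<n. cut_grad (\<eta> j) i x) = (\<Sum>j<n. \<eta> j x) * g i x + (\<Sum>j<n. partial_deriv i (\<eta> j) x) * u x"
      by (simp add: cut_grad_def sum.distrib sum_distrib_right)
    then show ?case using elim one d1 by (cases "x \<in> \<Omega>") auto
  qed
  have "AE x in lborel. \<forall>i. x \<notin> \<Omega> \<longrightarrow> g i x = 0"
    by (rule AE_finite_allI[OF finite, of UNIV, simplified]) (rule zero[OF g])
  with zero[OF u] zero[OF f(1)] have ae2: "AE x in lborel. (\<Sum>j<n. cut_Lap f (\<eta> j) x) = f x"
  proof eventually_elim
    case (elim x)
    have "(\<Sum>j<n. cut_Lap f (\<eta> j) x) = (\<Sum>j<n. \<eta> j x) * f x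
        + 2 * (\<Sum>j<n. \<Sum>i\<in>UNIV. partial_deriv i (\<eta> j) x * g i x) + (\<Sum>j<n. Lap (\<eta> j) x) * u x"
      by (simp add: cut_Lap_def sum.distrib sum_distrib_right sum_distrib_left)
    also have "(\<Sum>j<n. \<Sum>i\<in>UNIV. partial_deriv i (\<eta> j) x * g i x)
        = (\<Sum>i\<in>UNIV. (\<Sum>j<n. partial_deriv i (\<eta> j) x) * g i x)"
      by (subst sum.swap) (simp add: sum_distrib_right)
    finally show ?case using elim one d1 d3 by (cases "x \<in> \<Omega>") auto
  qed
  have p\<phi>: "?\<phi> \<in> test_functions UNIV" by (rule test_functions_sum) (use \<phi>(1) in auto)
  have Ld: "(\<lambda>x. partial_deriv i (\<phi> j) x - cut_grad (\<eta> j) i x) \<in> L2 UNIV" if "j < n" for i j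
    by (rule L2_diff[OF test_functions_L2[OF test_functions_partial[OF \<phi>(1)[OF that]]] L2_UNIV[OF cut_grad_L2[OF \<eta>[OF that]]]])
  have "nrm (\<lambda>x. partial_deriv i ?\<phi> x - g i x) \<le> \<epsilon>" for i
  proof -
    have pd: "partial_deriv i ?\<phi> = (\<lambda>x. \<Sum>j<n. partial_deriv i (\<phi> j) x)"
      by (rule partial_deriv_sum) (use sm(2) in auto)
    have "nrm (\<lambda>x. partial_deriv i ?\<phi> x - g i x)
        = nrm (\<lambda>x. \<Sum>j<n. partial_deriv i (\<phi> j) x - cut_grad (\<eta> j) i x)"
    proof (rule nrm_cong_AE)
      show "AE x in lborel. partial_deriv i ?\<phi> x - g i x
          = (\<Sum>j<n. partial_deriv i (\<phi> j) x - cut_grad (\<eta> j) i x)"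
        using ae1[of i] by eventually_elim (simp add: pd sum_subtractf)
      show "(\<lambda>x. partial_deriv i ?\<phi> x - g i x) \<in> borel_measurable borel"
        by (rule borel_measurable_diff[OF test_functions_measurable[OF test_functions_partial[OF p\<phi>]] L2_measurable[OF g]])
      show "(\<lambda>x. \<Sum>j<n. partial_deriv i (\<phi> j) x - cut_grad (\<eta> j) i x) \<in> borel_measurable borel"
        by (rule L2_measurable[OF L2_sum]) (use Ld in auto)
    qed
    also have "\<dots> \<le> (\<Sum>j<n. nrm (\<lambda>x. partial_deriv i (\<phi> j) x - cut_grad (\<eta> j) i x))"
      by (rule nrm_sum_le) (use Ld in auto)
    also have "\<dots> \<le> (\<Sum>j<n. e')" by (rule sum_mono) (use \<phi>(2) in auto)
    also have "\<dots> \<le> \<epsilon>" using ne e by simp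
    finally show ?thesis .
  qed
  moreover have "\<bar>ip (Lap ?\<phi>) w - l w\<bar> \<le> \<epsilon> * nrm w" if w: "w \<in> L2 \<Omega>" for w
  proof -
    have "ip (Lap ?\<phi>) w = (\<Sum>j<n. ip (Lap (\<phi> j)) w)"
    proof -
      have "Lap ?\<phi> = (\<lambda>x. \<Sum>j<n. Lap (\<phi> j) x)" by (rule Lap_sum) (use sm(2) in auto)
      then show ?thesis
        using ip_sum_left[of "{..<n}" "\<lambda>j. Lap (\<phi> j)" UNIV w \<Omega>] w test_functions_L2[OF Lap_test_functions[OF \<phi>(1)]] by simp
    qed
    moreover have "ip f w = (\<Sum>j<n. ip (cut_Lap f (\<eta> j)) w)"
    proof -
      have L: "cut_Lap f (\<eta> j) \<in> L2 \<Omega>" if "j \<in> {..<n}" for j using cut_Lap_L2[OF \<eta> f(1)] that by simp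
      have "ip f w = ip (\<lambda>x. \<Sum>j<n. cut_Lap f (\<eta> j) x) w"
        by (rule ip_cong_AE)
           (use ae2 L2_measurable[OF w] L2_measurable[OF f(1)] L2_measurable[OF L2_sum[OF finite_lessThan L]] in auto)
      then show ?thesis using ip_sum_left[OF finite_lessThan L w] by simp
    qed
    ultimately have E: "ip (Lap ?\<phi>) w - l w
        = (\<Sum>j<n. ip (Lap (\<phi> j)) w - ip (cut_Lap f (\<eta> j)) w) - (l w - ip f w)"
      by (simp add: sum_subtractf)
    have "\<bar>ip (Lap ?\<phi>) w - l w\<bar> \<le> \<bar>\<Sum>j<n. ip (Lap (\<phi> j)) w - ip (cut_Lap f (\<eta> j)) w\<bar> + \<bar>l w - ip f w\<bar>"
      unfolding E by (rule abs_triangle_ineq4)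
    also have "\<dots> \<le> (\<Sum>j<n. \<bar>ip (Lap (\<phi> j)) w - ip (cut_Lap f (\<eta> j)) w\<bar>) + c * nrm w"
      by (rule add_mono[OF sum_abs f(2)[OF w]])
    also have "(\<Sum>j<n. \<bar>ip (Lap (\<phi> j)) w - ip (cut_Lap f (\<eta> j)) w\<bar>) \<le> (\<Sum>j<n. (e' + B j * c) * nrm w)"
      by (rule sum_mono) (use \<phi>(3) w in auto)
    also have "(\<Sum>j<n. (e' + B j * c) * nrm w) = (real n * e' + (\<Sum>j<n. B j) * c) * nrm w"
      by (simp add: sum_distrib_right[symmetric] sum.distrib)
    also have "\<dots> + c * nrm w = (real n * e' + (1 + (\<Sum>j<n. B j)) * c) * nrm w"
      by (simp add: algebra_simps)
    also have "(1 + (\<Sum>j<n. B j)) * c = \<epsilon> / 2"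
    proof -
      have "D * (\<epsilon> / (2 * D)) = \<epsilon> / 2" if "D > 0" for D using that by simp
      then show ?thesis unfolding c_def by this (use SB in linarith)
    qed
    also have "(real n * e' + \<epsilon> / 2) * nrm w \<le> \<epsilon> * nrm w" using ne by (intro mult_right_mono) auto
    finally show ?thesis by simp
  qed
  ultimately show ?thesis using p\<phi> by blast
qed

end


section \<open>Moments of the kernel\<close>

definition shell :: "real \<Rightarrow> (real^'n) set" where
  "shell a = {h. a \<le> norm h \<and> norm h < 2 * a}"

text \<open>Values in \<open>ennreal\<close> allow scaling and summing over shells before finiteness
  is known; finiteness then comes out of the geometric series.\<close>

definition radial :: "(real^'n) set \<Rightarrow> real \<Rightarrow> ennreal" where
  "radial A q = (\<integral>\<^sup>+h. ennreal (norm h powr q) * indicator A h \<partial>lborel)"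

lemma shell_measurable [measurable]: "shell a \<in> sets borel"
  unfolding shell_def by measurable

text \<open>The substitution by a dilation contributes a^N from the volume and a^q from the
  integrand.\<close>

lemma radial_shell:
  assumes "a > 0"
  shows "radial (shell a :: (real^'n) set) q = ennreal (a powr (real CARD('n) + q)) * radial (shell 1 :: (real^'n) set) q"
proof -
  let ?f = "\<lambda>h::real^'n. ennreal (norm h powr q) * indicator (shell a) h"
  have "radial (shell a :: (real^'n) set) q
      = (\<integral>\<^sup>+h. ?f h \<partial>density (distr lborel borel (\<lambda>x. 0 + a *\<^sub>R x)) (\<lambda>_. ennreal (\<bar>a\<bar> ^ DIM(real^'n))))"
    using lborel_affine[of a "0 :: real^'n"] assms unfolding radial_def by simp
  also have "\<dots> = (\<integral>\<^sup>+h. ennreal (a ^ CARD('n)) * ?f (a *\<^sub>R h) \<partial>lborel)"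
    using assms by (subst nn_integral_density) (auto simp: nn_integral_distr)
  also have "\<dots> = (\<integral>\<^sup>+h. ennreal (a powr (real CARD('n) + q)) * (ennreal (norm h powr q) * indicator (shell 1) (h::real^'n)) \<partial>lborel)"
  proof (rule nn_integral_cong)
    fix h :: "real^'n"
    have "a ^ CARD('n) * norm (a *\<^sub>R h) powr q = a powr (real CARD('n) + q) * norm h powr q"
      using assms by (simp add: powr_mult powr_add powr_realpow)
    moreover have "indicator (shell a) (a *\<^sub>R h) = (indicator (shell 1) h :: ennreal)"
      using assms by (simp add: indicator_def shell_def)
    ultimately show "ennreal (a ^ CARD('n)) * ?f (a *\<^sub>R h)
        = ennreal (a powr (real CARD('n) + q)) * (ennreal (norm h powr q) * indicator (shell 1) h)"
      using assms by (simp add: mult.assoc[symmetric] ennreal_mult[symmetric])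
  qed
  also have "\<dots> = ennreal (a powr (real CARD('n) + q)) * radial (shell 1 :: (real^'n) set) q"
    unfolding radial_def by (rule nn_integral_cmult) measurable
  finally show ?thesis .
qed

text \<open>Countable additivity of the measure with density |h|^q.\<close>

lemma radial_Union:
  assumes "disjoint_family A" "\<And>k::nat. A k \<in> sets borel"
  shows "radial (\<Union>k. A k) q = (\<Sum>k. radial (A k) q)"
proof -
  let ?M = "density lborel (\<lambda>h::real^'a. ennreal (norm h powr q))"
  have "radial X q = emeasure ?M X" if "X \<in> sets borel" for X :: "(real^'a) set"
    unfolding radial_def using that by (subst emeasure_density) auto
  moreover have "(\<Sum>k. emeasure ?M (A k)) = emeasure ?M (\<Union>k. A k)"
    by (rule suminf_emeasure) (use assms in auto)
  ultimately show ?thesis using assms(2) by simp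
qed

lemma disjoint_shells_in: "disjoint_family (\<lambda>k. shell ((1 / 2) ^ Suc k) :: (real^'n) set)"
  unfolding disjoint_family_on_def
proof (intro ballI impI)
  have aux: "shell ((1 / 2) ^ Suc j) \<inter> shell ((1 / 2) ^ Suc k) = ({} :: (real^'n) set)" if "j < k" for j k
  proof -
    have "(1 / 2 :: real) ^ k \<le> (1 / 2) ^ Suc j" using that by (intro power_decreasing) auto
    then show ?thesis by (auto simp: shell_def)
  qed
  fix j k :: nat assume "j \<noteq> k"
  then show "shell ((1 / 2) ^ Suc j) \<inter> shell ((1 / 2) ^ Suc k) = ({} :: (real^'n) set)"
    using aux[of j k] aux[of k j] by (auto simp: neq_iff)
qed

lemma disjoint_shells_out: "disjoint_family (\<lambda>k. shell (2 ^ k) :: (real^'n) set)"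
  unfolding disjoint_family_on_def
proof (intro ballI impI)
  have aux: "shell (2 ^ j) \<inter> shell (2 ^ k) = ({} :: (real^'n) set)" if "j < k" for j k
  proof -
    have "(2 :: real) ^ Suc j \<le> 2 ^ k" using that by (intro power_increasing) auto
    then show ?thesis by (auto simp: shell_def)
  qed
  fix j k :: nat assume "j \<noteq> k"
  then show "shell (2 ^ j) \<inter> shell (2 ^ k) = ({} :: (real^'n) set)"
    using aux[of j k] aux[of k j] by (auto simp: neq_iff)
qed

lemma Union_shells_in: "(\<Union>k. shell ((1 / 2) ^ Suc k)) = (ball 0 1 - {0} :: (real^'n) set)"
proof (intro equalityI subsetI)
  fix h :: "real^'n" assume "h \<in> (\<Union>k. shell ((1 / 2) ^ Suc k))"
  then obtain k where k: "(1 / 2) ^ Suc k \<le> norm h" "norm h < (1 / 2) ^ k" by (auto simp: shell_def)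
  have "(1 / 2 :: real) ^ k \<le> 1" by (intro power_le_one) auto
  moreover have "0 < (1 / 2 :: real) ^ Suc k" by simp
  ultimately have "0 < norm h" "norm h < 1" using k by linarith+
  then show "h \<in> ball 0 1 - {0}" by simp
next
  fix h :: "real^'n" assume h: "h \<in> ball 0 1 - {0}"
  then have "\<exists>k. (1 / 2) ^ k < norm h" using real_arch_pow_inv[of "norm h" "1 / 2"] by auto
  then have ex: "\<exists>k. (1 / 2) ^ k \<le> norm h" using less_imp_le by blast
  define k where "k = (LEAST k. (1 / 2) ^ k \<le> norm h)"
  have k: "(1 / 2) ^ k \<le> norm h" unfolding k_def by (rule LeastI_ex[OF ex])
  have "k \<noteq> 0"
  proof
    assume "k = 0"
    with k h show False by simp
  qed
  then obtain j where j: "k = Suc j" using not0_implies_Suc by blast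
  have "\<not> (1 / 2) ^ j \<le> norm h" using not_less_Least[of j "\<lambda>k. (1 / 2) ^ k \<le> norm h"] j k_def by simp
  then show "h \<in> (\<Union>k. shell ((1 / 2) ^ Suc k))" using k j by (auto simp: shell_def)
qed

lemma Union_shells_out: "(\<Union>k. shell (2 ^ k)) = (- ball 0 1 :: (real^'n) set)"
proof (intro equalityI subsetI)
  fix h :: "real^'n" assume "h \<in> (\<Union>k. shell (2 ^ k))"
  then obtain k :: nat where k: "2 ^ k \<le> norm h" by (auto simp: shell_def)
  have "(1 :: real) \<le> 2 ^ k" by (rule one_le_power) simp
  then have "1 \<le> norm h" using k by linarith
  then show "h \<in> - ball 0 1" by simp
next
  fix h :: "real^'n" assume h: "h \<in> - ball 0 1"
  have ex: "\<exists>k. norm h < 2 ^ k" using real_arch_pow[of 2 "norm h"] by auto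
  define k where "k = (LEAST k. norm h < 2 ^ k)"
  have k: "norm h < 2 ^ k" unfolding k_def by (rule LeastI_ex[OF ex])
  have "k \<noteq> 0"
  proof
    assume "k = 0"
    with k h show False by simp
  qed
  then obtain j where j: "k = Suc j" using not0_implies_Suc by blast
  have "\<not> norm h < 2 ^ j" using not_less_Least[of j "\<lambda>k. norm h < 2 ^ k"] j k_def by simp
  then show "h \<in> (\<Union>k. shell (2 ^ k))" using k j by (auto simp: shell_def not_less intro!: exI[of _ j])
qed

lemma suminf_geometric_ennreal:
  assumes "0 \<le> x" "x < 1"
  shows "(\<Sum>k. ennreal (x ^ k) * c) = ennreal (1 / (1 - x)) * c"
proof -
  have "(\<Sum>k. ennreal (x ^ k)) = ennreal (\<Sum>k. x ^ k)"
    using assms by (intro suminf_ennreal2 summable_geometric) auto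
  then show ?thesis using assms suminf_geometric[of x] by (simp add: ennreal_suminf_multc)
qed

text \<open>A geometric series over the shells of inner radius 2^(-k-1), with ratio x. The outermost
  shell already carries one factor x, whence the numerator; for the exterior of the ball the series
  starts at the unit shell and the numerator is 1.\<close>

lemma radial_ball:
  fixes q :: real
  assumes "real CARD('n) + q > 0"
  defines "x \<equiv> 2 powr (- (real CARD('n) + q))"
  shows "radial (ball 0 1 :: (real^'n) set) q = ennreal (x / (1 - x)) * radial (shell 1 :: (real^'n) set) q"
proof -
  have x: "0 < x" "x < 1" using assms by (auto simp: x_def powr_less_one)
  \<comment> \<open>At the origin the integrand is 0 by the convention for \<open>powr\<close> with
    base 0, so removing this point changes nothing for any q.\<close>
  have "radial (ball 0 1 :: (real^'n) set) q = radial (ball 0 1 - {0} :: (real^'n) set) q"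
    unfolding radial_def by (rule nn_integral_cong) (auto simp: indicator_def)
  also have "\<dots> = (\<Sum>k. radial (shell ((1 / 2) ^ Suc k) :: (real^'n) set) q)"
    unfolding Union_shells_in[symmetric] by (rule radial_Union[OF disjoint_shells_in]) simp
  also have "\<dots> = (\<Sum>k. ennreal (x ^ k) * (ennreal x * radial (shell 1 :: (real^'n) set) q))"
  proof (rule suminf_cong)
    fix k
    have "((1 / 2 :: real) ^ Suc k) powr (real CARD('n) + q) = x ^ Suc k"
    proof -
      have "(1 / 2 :: real) ^ Suc k = 2 powr (- real (Suc k))"
        by (simp add: powr_minus powr_realpow power_one_over inverse_eq_divide del: power_Suc of_nat_Suc)
      moreover have "x ^ Suc k = 2 powr (- (real CARD('n) + q) * real (Suc k))"
        using x(1) by (subst powr_realpow[symmetric]) (simp_all only: x_def powr_powr)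
      ultimately show ?thesis by (simp only: powr_powr minus_mult_left[symmetric] minus_mult_right[symmetric] mult.commute)
    qed
    then show "radial (shell ((1 / 2) ^ Suc k) :: (real^'n) set) q
        = ennreal (x ^ k) * (ennreal x * radial (shell 1 :: (real^'n) set) q)"
      using x by (subst radial_shell) (auto simp: ennreal_mult mult_ac)
  qed
  also have "\<dots> = ennreal (1 / (1 - x)) * (ennreal x * radial (shell 1 :: (real^'n) set) q)"
    by (rule suminf_geometric_ennreal) (use x in auto)
  also have "\<dots> = ennreal (x / (1 - x)) * radial (shell 1 :: (real^'n) set) q"
    using x by (simp add: mult.assoc[symmetric] ennreal_mult[symmetric])
  finally show ?thesis .
qed

lemma radial_outside:
  fixes q :: real
  assumes "real CARD('n) + q < 0"
  defines "x \<equiv> 2 powr (real CARD('n) + q)"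
  shows "radial (- ball 0 1 :: (real^'n) set) q = ennreal (1 / (1 - x)) * radial (shell 1 :: (real^'n) set) q"
proof -
  have x: "0 < x" "x < 1" using assms by (auto simp: x_def powr_less_one)
  have "radial (- ball 0 1 :: (real^'n) set) q = (\<Sum>k. radial (shell (2 ^ k) :: (real^'n) set) q)"
    unfolding Union_shells_out[symmetric] by (rule radial_Union[OF disjoint_shells_out]) simp
  also have "\<dots> = (\<Sum>k. ennreal (x ^ k) * radial (shell 1 :: (real^'n) set) q)"
  proof (rule suminf_cong)
    fix k :: nat
    have "((2 :: real) ^ k) powr (real CARD('n) + q) = x ^ k"
      unfolding x_def by (simp add: powr_realpow[symmetric] powr_powr mult.commute)
    then show "radial (shell (2 ^ k) :: (real^'n) set) q = ennreal (x ^ k) * radial (shell 1 :: (real^'n) set) q"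
      by (subst radial_shell) auto
  qed
  also have "\<dots> = ennreal (1 / (1 - x)) * radial (shell 1 :: (real^'n) set) q"
    by (rule suminf_geometric_ennreal) (use x in auto)
  finally show ?thesis .
qed

lemma radial_shell_mono:
  assumes "q \<le> q'"
  shows "radial (shell 1 :: (real^'n) set) q \<le> radial (shell 1 :: (real^'n) set) q'"
  unfolding radial_def
  using assms by (intro nn_integral_mono) (auto simp: indicator_def shell_def intro!: ennreal_leI powr_mono)

text \<open>On the unit shell the norm is below 2, so one more power costs at most this
  factor.\<close>

lemma radial_shell_Suc:
  "radial (shell 1 :: (real^'n) set) (q + 1) \<le> 2 * radial (shell 1 :: (real^'n) set) q"
proof -
  have "radial (shell 1 :: (real^'n) set) (q + 1)
      \<le> (\<integral>\<^sup>+h. 2 * (ennreal (norm h powr q) * indicator (shell 1 :: (real^'n) set) h) \<partial>lborel)"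
    unfolding radial_def
  proof (rule nn_integral_mono)
    fix h :: "real^'n"
    have "norm h powr (q + 1) \<le> 2 * norm h powr q" if "h \<in> shell 1"
      using that mult_left_mono[of "norm h" 2 "norm h powr q"] by (simp add: powr_add shell_def mult.commute)
    then show "ennreal (norm h powr (q + 1)) * indicator (shell 1) h \<le> 2 * (ennreal (norm h powr q) * indicator (shell 1) h)"
      using ennreal_leI[of "norm h powr (q + 1)" "2 * norm h powr q"]
      by (auto simp: indicator_def ennreal_mult')
  qed
  also have "\<dots> = 2 * radial (shell 1 :: (real^'n) set) q"
    unfolding radial_def by (rule nn_integral_cmult) measurable
  finally show ?thesis .
qed

lemma radial_shell_finite: "radial (shell 1 :: (real^'n) set) q < \<infinity>"
proof -
  have "norm h powr q \<le> 1 + 2 powr q" if "h \<in> shell 1" for h :: "real^'n"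
  proof (cases "q \<ge> 0")
    case True
    then have "norm h powr q \<le> 2 powr q" using that by (intro powr_mono2) (auto simp: shell_def)
    then show ?thesis by simp
  next
    case False
    then have "norm h powr q \<le> 1 powr q" using that by (intro powr_mono2') (auto simp: shell_def)
    then show ?thesis using powr_ge_zero[of 2 q] by (simp del: powr_ge_zero)
  qed
  then obtain C where "\<And>h :: real^'n. h \<in> shell 1 \<Longrightarrow> norm h powr q \<le> C" by blast
  then have "radial (shell 1 :: (real^'n) set) q \<le> (\<integral>\<^sup>+h. ennreal C * indicator (ball 0 2 :: (real^'n) set) h \<partial>lborel)"
    unfolding radial_def
    by (intro nn_integral_mono) (auto simp: indicator_def shell_def intro!: ennreal_leI)
  also have "\<dots> = ennreal C * emeasure lborel (ball 0 2 :: (real^'n) set)"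
    by (rule nn_integral_cmult_indicator) simp
  also have "\<dots> < \<infinity>" using emeasure_lborel_ball_finite[of "0::real^'n" 2] by (simp add: ennreal_mult_less_top)
  finally show ?thesis .
qed

lemma radial_shell_pos: "radial (shell 1 :: (real^'n) set) q > 0"
proof (rule ccontr)
  assume "\<not> radial (shell 1 :: (real^'n) set) q > 0"
  then have "(\<integral>\<^sup>+h. ennreal (norm h powr q) * indicator (shell 1 :: (real^'n) set) h \<partial>lborel) = 0"
    by (simp add: radial_def)
  then have "AE h in lborel. ennreal (norm h powr q) * indicator (shell 1 :: (real^'n) set) h = 0"
    by (subst (asm) nn_integral_0_iff_AE) auto
  then have "AE h in lborel. h \<notin> (shell 1 :: (real^'n) set)"
    by eventually_elim (auto simp: indicator_def shell_def split: if_splits)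
  then have "{h \<in> space lborel. \<not> h \<notin> (shell 1 :: (real^'n) set)} \<in> null_sets lborel"
    by (subst (asm) AE_iff_null) auto
  then have null: "(shell 1 :: (real^'n) set) \<in> null_sets lborel" by simp
  obtain i :: 'n where True by blast
  have "ball ((3 / 2) *\<^sub>R axis i 1) (1 / 2) \<subseteq> (shell 1 :: (real^'n) set)"
  proof
    fix h :: "real^'n" assume "h \<in> ball ((3 / 2) *\<^sub>R axis i 1) (1 / 2)"
    then have d: "norm ((3 / 2) *\<^sub>R axis i 1 - h) < 1 / 2" by (simp add: dist_norm)
    have n: "norm ((3 / 2) *\<^sub>R axis i (1::real)) = 3 / 2" by simp
    show "h \<in> shell 1"
      using norm_triangle_ineq2[of "(3 / 2) *\<^sub>R axis i 1" h] norm_triangle_ineq3[of h "(3 / 2) *\<^sub>R axis i 1"]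
        d norm_minus_commute[of h "(3 / 2) *\<^sub>R axis i 1"]
      unfolding shell_def n by auto
  qed
  then have "ball ((3 / 2) *\<^sub>R axis i 1) (1 / 2) \<in> null_sets (lborel :: (real^'n) measure)"
    using null_sets_subset[OF null] by simp
  then have "negligible (ball ((3 / 2) *\<^sub>R axis i 1) (1 / 2) :: (real^'n) set)"
    by (simp add: negligible_iff_null_sets null_sets_completionI)
  then show False using open_not_negligible[of "ball ((3 / 2) *\<^sub>R axis i 1) (1 / 2) :: (real^'n) set"] by simp
qed

text \<open>The moment of order r of the kernel |h|^(-N-2s) over the unit ball. The type argument
  carries the dimension N, which the other arguments do not determine.\<close>

definition mom :: "'n::finite itself \<Rightarrow> real \<Rightarrow> real \<Rightarrow> real" where
  "mom _ r s = (LINT h|lborel. norm (h::real^'n) powr (r - real CARD('n) - 2 * s) * indicator (ball 0 1) h)"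

definition tail :: "'n::finite itself \<Rightarrow> real \<Rightarrow> real" where
  "tail _ s = (LINT h|lborel. norm (h::real^'n) powr (- real CARD('n) - 2 * s) * indicator (- ball 0 1) h)"

text \<open>This is 4 (1 - x), where x = 2^(2s-2) is the ratio of the geometric series for the
  second moment x / (1 - x) * S, with S the integral over the unit shell. The product of the two is
  4 x S, hence at least 2 S for s \<ge> 1/2, and 2 S bounds both the third moment and the tail. It
  tends to 0, which expresses that relative to the second moment the kernel concentrates at the
  origin.\<close>

definition defect :: "real \<Rightarrow> real" where
  "defect s = 4 * (1 - 2 powr (2 * s - 2))"

lemma defect_tendsto: "(defect \<longlongrightarrow> 0) (at_left 1)"
proof -
  have "((\<lambda>s. 4 * (1 - 2 powr (2 * s - 2))) \<longlongrightarrow> 4 * (1 - 2 powr (2 * 1 - 2))) (at_left (1::real))"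
    by (intro tendsto_intros) auto
  then show ?thesis by (simp add: defect_def[abs_def])
qed

lemma radial_integral:
  fixes A :: "(real^'n) set"
  assumes "A \<in> sets borel" "radial A q < \<infinity>"
  shows "integrable lborel (\<lambda>h. norm h powr q * indicator A h)"
    "radial A q = ennreal (LINT h|lborel. norm h powr q * indicator A h)"
proof -
  have e: "radial A q = (\<integral>\<^sup>+h. ennreal (norm h powr q * indicator A h) \<partial>lborel)"
    unfolding radial_def by (rule nn_integral_cong) (auto simp: indicator_def)
  show i: "integrable lborel (\<lambda>h. norm h powr q * indicator A h)"
    by (rule integrableI_nonneg) (use assms e in auto)
  show "radial A q = ennreal (LINT h|lborel. norm h powr q * indicator A h)"
    unfolding e by (rule nn_integral_eq_integral[OF i]) simp
qed

text \<open>Dyadic scaling turns the three moments into geometric series over the integrals on one shell.\<close>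

lemma moments:
  assumes s: "1 / 2 \<le> s" "s < 1"
  shows "integrable lborel (\<lambda>h::real^'n. norm h powr (2 - real CARD('n) - 2 * s) * indicator (ball 0 1) h)"
    "integrable lborel (\<lambda>h::real^'n. norm h powr (3 - real CARD('n) - 2 * s) * indicator (ball 0 1) h)"
    "integrable lborel (\<lambda>h::real^'n. norm h powr (- real CARD('n) - 2 * s) * indicator (- ball 0 1) h)"
    "mom TYPE('n) 2 s > 0"
    "mom TYPE('n) 3 s \<le> defect s * mom TYPE('n) 2 s"
    "tail TYPE('n) s \<le> defect s * mom TYPE('n) 2 s"
proof -
  let ?n = "real CARD('n)"
  let ?S = "\<lambda>r. radial (shell 1 :: (real^'n) set) (r - ?n - 2 * s)"
  obtain S where S: "?S 2 = ennreal S" "S \<ge> 0"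
    using radial_shell_finite[where 'n = 'n, of "2 - ?n - 2 * s"] by (cases "?S 2") auto
  have S0: "S > 0" using radial_shell_pos[where 'n = 'n, of "2 - ?n - 2 * s"] S by simp
  define x where "x = 2 powr (2 * s - 2)"
  \<comment> \<open>Here and for z below, s \<ge> 1/2 gives the bound by 1/2; for y it is s < 1. All
    later constants are therefore independent of s.\<close>
  have x: "1 / 2 \<le> x" "x < 1"
  proof -
    have "2 powr (-1) \<le> x" unfolding x_def using s by (intro powr_mono) auto
    then show "1 / 2 \<le> x" by (simp add: powr_minus_divide)
    show "x < 1" unfolding x_def using s by (intro powr_less_one) auto
  qed
  define y where "y = 2 powr (2 * s - 3)"
  have y: "0 < y" "y \<le> 1 / 2"
  proof -
    have "y \<le> 2 powr (-1)" unfolding y_def using s by (intro powr_mono) auto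
    then show "y \<le> 1 / 2" by (simp add: powr_minus_divide)
  qed (simp add: y_def)
  define z where "z = 2 powr (- 2 * s)"
  have z: "0 < z" "z \<le> 1 / 2"
  proof -
    have "z \<le> 2 powr (-1)" unfolding z_def using s by (intro powr_mono) auto
    then show "z \<le> 1 / 2" by (simp add: powr_minus_divide)
  qed (simp add: z_def)
  have m2: "radial (ball 0 1 :: (real^'n) set) (2 - ?n - 2 * s) = ennreal (x / (1 - x) * S)"
  proof -
    have "radial (ball 0 1 :: (real^'n) set) (2 - ?n - 2 * s) = ennreal (x / (1 - x)) * ?S 2"
      using radial_ball[where 'n = 'n, of "2 - ?n - 2 * s"] s by (simp add: x_def)
    also have "\<dots> = ennreal (x / (1 - x) * S)"
      unfolding S(1) using x S(2) by (intro ennreal_mult[symmetric]) auto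
    finally show ?thesis .
  qed
  have "?S 3 \<le> 2 * ?S 2"
    using radial_shell_Suc[where 'n = 'n, of "2 - ?n - 2 * s"] by (simp add: algebra_simps)
  also have "\<dots> = ennreal (2 * S)" using S by (simp add: ennreal_mult)
  finally have S3: "?S 3 \<le> ennreal (2 * S)" .
  have "radial (ball 0 1 :: (real^'n) set) (3 - ?n - 2 * s) = ennreal (y / (1 - y)) * ?S 3"
    using radial_ball[where 'n = 'n, of "3 - ?n - 2 * s"] s by (simp add: y_def)
  also have "\<dots> \<le> ennreal 1 * ennreal (2 * S)"
    using y by (intro mult_mono ennreal_leI S3) (auto simp: field_simps)
  finally have m3: "radial (ball 0 1 :: (real^'n) set) (3 - ?n - 2 * s) \<le> ennreal (2 * S)" by simp
  have "radial (- ball 0 1 :: (real^'n) set) (- ?n - 2 * s) = ennreal (1 / (1 - z)) * ?S 0"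
    using radial_outside[where 'n = 'n, of "- ?n - 2 * s"] s by (simp add: z_def)
  also have "\<dots> \<le> ennreal 2 * ennreal S"
    using z radial_shell_mono[where 'n = 'n, of "0 - ?n - 2 * s" "2 - ?n - 2 * s"] S(1)
    by (intro mult_mono ennreal_leI) (auto simp: field_simps)
  finally have t: "radial (- ball 0 1 :: (real^'n) set) (- ?n - 2 * s) \<le> ennreal (2 * S)"
    using S(2) by (simp add: ennreal_mult)
  have fin: "radial (ball 0 1 :: (real^'n) set) (2 - ?n - 2 * s) < \<infinity>"
    "radial (ball 0 1 :: (real^'n) set) (3 - ?n - 2 * s) < \<infinity>"
    "radial (- ball 0 1 :: (real^'n) set) (- ?n - 2 * s) < \<infinity>"
    using m2 le_less_trans[OF m3] le_less_trans[OF t] by auto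
  have sets: "ball 0 1 \<in> sets (borel :: (real^'n) measure)" "- ball 0 1 \<in> sets (borel :: (real^'n) measure)"
    by auto
  note i2 = radial_integral[OF sets(1) fin(1)]
  note i3 = radial_integral[OF sets(1) fin(2)]
  note it = radial_integral[OF sets(2) fin(3)]
  show "integrable lborel (\<lambda>h::real^'n. norm h powr (2 - ?n - 2 * s) * indicator (ball 0 1) h)"
    "integrable lborel (\<lambda>h::real^'n. norm h powr (3 - ?n - 2 * s) * indicator (ball 0 1) h)"
    "integrable lborel (\<lambda>h::real^'n. norm h powr (- ?n - 2 * s) * indicator (- ball 0 1) h)"
    by (rule i2 i3 it)+
  have nonneg: "mom TYPE('n) r s \<ge> 0" "tail TYPE('n) s \<ge> 0" for r
    unfolding mom_def tail_def by (intro integral_nonneg_AE; simp)+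
  have pos: "x / (1 - x) * S > 0" using x S0 by simp
  have M2: "mom TYPE('n) 2 s = x / (1 - x) * S"
    using i2(2) m2 nonneg(1)[of 2] pos unfolding mom_def by simp
  have M3: "mom TYPE('n) 3 s \<le> 2 * S"
    using i3(2) m3 S0 unfolding mom_def by simp
  have T: "tail TYPE('n) s \<le> 2 * S"
    using it(2) t S0 unfolding tail_def by simp
  have D: "defect s * mom TYPE('n) 2 s = 4 * x * S"
  proof -
    have "4 * (1 - x) * (x / (1 - x) * S) = 4 * x * S" using x(2) by (simp add: divide_simps)
    then show ?thesis unfolding M2 defect_def x_def .
  qed
  have "2 * S \<le> 4 * x * S" using x(1) S0 by simp
  then show "mom TYPE('n) 3 s \<le> defect s * mom TYPE('n) 2 s" "tail TYPE('n) s \<le> defect s * mom TYPE('n) 2 s"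
    using M3 T D by linarith+
  show "mom TYPE('n) 2 s > 0" using M2 pos by simp
qed

section \<open>Symmetries of Lebesgue measure and the matrix of second moments\<close>

lemma prod_Basis_cart: "(\<Prod>b\<in>Basis. x \<bullet> b) = (\<Prod>i\<in>UNIV. (x::real^'n) $ i)"
proof -
  have B: "(Basis :: (real^'n) set) = (\<lambda>i. axis i 1) ` UNIV" by (auto simp: Basis_vec_def)
  have inj: "inj (\<lambda>i::'n. axis i (1::real))" by (auto simp: inj_def axis_eq_axis)
  show ?thesis unfolding B prod.reindex[OF inj] by (simp add: inner_axis)
qed

definition signed_perm :: "('n \<Rightarrow> real) \<Rightarrow> ('n \<Rightarrow> 'n) \<Rightarrow> real^'n \<Rightarrow> real^'n" where
  "signed_perm \<sigma> p h = (\<chi> k. \<sigma> k * h $ p k)"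

text \<open>The preimage of a box is the box with its sides permuted and, where the sign is
  negative, with end points negated and exchanged; its volume is the same, and Lebesgue measure is
  determined by its values on boxes. The permutation is an involution, which covers the identity and
  the swaps of two coordinates.\<close>

lemma signed_perm:
  fixes \<sigma> :: "'n::finite \<Rightarrow> real"
  assumes p: "\<And>k. p (p k) = k" and \<sigma>: "\<And>k. \<sigma> k = 1 \<or> \<sigma> k = -1"
  shows distr_signed_perm: "distr lborel borel (signed_perm \<sigma> p) = lborel"
    and norm_signed_perm: "norm (signed_perm \<sigma> p h) = norm h"
    and measurable_signed_perm: "signed_perm \<sigma> p \<in> borel_measurable borel"
proof -
  have bij: "bij p" by (rule involuntory_imp_bij) (rule p)
  have "continuous_on UNIV (signed_perm \<sigma> p)"
    unfolding signed_perm_def[abs_def] by (intro continuous_intros)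
  then show m: "signed_perm \<sigma> p \<in> borel_measurable borel" by (rule borel_measurable_continuous_onI)
  have t: "(\<sigma> k * h $ p k) * (\<sigma> k * h $ p k) = h $ p k * h $ p k" for k using \<sigma>[of k] by auto
  have "signed_perm \<sigma> p h \<bullet> signed_perm \<sigma> p h = (\<Sum>k\<in>UNIV. h $ p k * h $ p k)"
    by (simp add: signed_perm_def inner_vec_def t)
  also have "\<dots> = h \<bullet> h"
    using sum.reindex_bij_betw[OF bij, of "\<lambda>k. h $ k * h $ k"] by (simp add: inner_vec_def)
  finally show "norm (signed_perm \<sigma> p h) = norm h" by (simp add: norm_eq_sqrt_inner)
  show "distr lborel borel (signed_perm \<sigma> p) = lborel"
  proof (rule lborel_eqI[symmetric])
    fix l v :: "real^'n" assume lu: "\<And>b. b \<in> Basis \<Longrightarrow> l \<bullet> b \<le> v \<bullet> b"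
    define l' where "l' = (\<chi> m. if \<sigma> (p m) = 1 then l $ p m else - v $ p m)"
    define v' where "v' = (\<chi> m. if \<sigma> (p m) = 1 then v $ p m else - l $ p m)"
    have "l $ k \<le> v $ k" for k using lu[of "axis k 1"] by (auto simp: inner_axis Basis_vec_def)
    then have le: "l' \<bullet> b \<le> v' \<bullet> b" if "b \<in> Basis" for b
      using that by (auto simp: Basis_vec_def inner_axis l'_def v'_def)
    have "signed_perm \<sigma> p -` box l v = box l' v'"
    proof (rule set_eqI)
      fix h
      have s: "l $ k < \<sigma> k * h $ p k \<and> \<sigma> k * h $ p k < v $ k \<longleftrightarrow> l' $ p k < h $ p k \<and> h $ p k < v' $ p k" for k
        using \<sigma>[of k] by (auto simp: l'_def v'_def p)
      have "h \<in> signed_perm \<sigma> p -` box l v \<longleftrightarrow> (\<forall>k. l' $ p k < h $ p k \<and> h $ p k < v' $ p k)"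
        unfolding s[symmetric] by (simp add: mem_box_cart signed_perm_def)
      also have "\<dots> \<longleftrightarrow> (\<forall>m. l' $ m < h $ m \<and> h $ m < v' $ m)"
      proof (intro iffI allI)
        fix m assume A: "\<forall>k. l' $ p k < h $ p k \<and> h $ p k < v' $ p k"
        show "l' $ m < h $ m \<and> h $ m < v' $ m" using A[rule_format, of "p m"] unfolding p .
      next
        fix k assume A: "\<forall>m. l' $ m < h $ m \<and> h $ m < v' $ m"
        show "l' $ p k < h $ p k \<and> h $ p k < v' $ p k" by (rule A[rule_format])
      qed
      also have "\<dots> \<longleftrightarrow> h \<in> box l' v'" by (simp add: mem_box_cart)
      finally show "h \<in> signed_perm \<sigma> p -` box l v \<longleftrightarrow> h \<in> box l' v'" .
    qed
    then have "emeasure (distr lborel borel (signed_perm \<sigma> p)) (box l v) = emeasure lborel (box l' v')"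
      using m by (subst emeasure_distr) auto
    also have "\<dots> = ennreal (\<Prod>b\<in>Basis. (v' - l') \<bullet> b)" by (rule emeasure_lborel_box[OF le])
    also have "(\<Prod>b\<in>Basis. (v' - l') \<bullet> b) = (\<Prod>m\<in>UNIV. (v - l) $ p m)"
      unfolding prod_Basis_cart by (rule prod.cong) (auto simp: l'_def v'_def)
    also have "\<dots> = (\<Prod>b\<in>Basis. (v - l) \<bullet> b)"
      unfolding prod_Basis_cart by (rule prod.reindex_bij_betw[OF bij])
    finally show "emeasure (distr lborel borel (signed_perm \<sigma> p)) (box l v) = ennreal (\<Prod>b\<in>Basis. (v - l) \<bullet> b)" .
  qed simp
qed

lemma integral_signed_perm:
  fixes F :: "real^'n \<Rightarrow> real"
  assumes p: "\<And>k. p (p k) = k" and \<sigma>: "\<And>k. \<sigma> k = 1 \<or> \<sigma> k = -1" and "F \<in> borel_measurable borel"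
  shows "(LINT h|lborel. F (signed_perm \<sigma> p h)) = (LINT h|lborel. F h)"
proof -
  have "(LINT h|distr lborel borel (signed_perm \<sigma> p). F h) = (LINT h|lborel. F (signed_perm \<sigma> p h))"
    by (rule integral_distr) (use measurable_signed_perm[of p \<sigma>, OF p \<sigma>] assms(3) in simp_all)
  then show ?thesis unfolding distr_signed_perm[of p \<sigma>, OF p \<sigma>] by simp
qed

text \<open>Flipping the sign of one coordinate kills the off-diagonal entries, swapping two
  coordinates makes the diagonal entries equal, and their sum over the N coordinates is the radial
  second moment.\<close>

lemma second_moment:
  fixes s :: real
  assumes s: "1 / 2 \<le> s" "s < 1"
  defines "F \<equiv> \<lambda>i j (h::real^'n). norm h powr (- real CARD('n) - 2 * s) * indicator (ball 0 1) h * (h $ i * h $ j)"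
  shows "integrable lborel (F i j)"
    "(LINT h|lborel. F i j h) = (if i = j then mom TYPE('n) 2 s / real CARD('n) else 0)"
proof -
  let ?n = "real CARD('n)"
  have [measurable]: "F i j \<in> borel_measurable borel" for i j
  proof -
    have "(\<lambda>h::real^'n. norm h powr (- ?n - 2 * s)) \<in> borel_measurable borel" by measurable
    moreover have "(\<lambda>h::real^'n. h $ i) \<in> borel_measurable borel" for i
      by (intro borel_measurable_continuous_onI continuous_intros)
    ultimately show ?thesis
      unfolding F_def by (intro borel_measurable_times borel_measurable_indicator) auto
  qed
  have pw: "norm h powr (- ?n - 2 * s) * (norm h)\<^sup>2 = norm h powr (2 - ?n - 2 * s)" for h :: "real^'n"
  proof (cases "h = 0")
    case False
    then have "norm h powr (- ?n - 2 * s) * norm h powr 2 = norm h powr ((- ?n - 2 * s) + 2)" by (simp add: powr_add)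
    then show ?thesis using False by (simp add: powr_numeral algebra_simps)
  qed simp
  have int: "integrable lborel (F i j)" for i j
  proof (rule Bochner_Integration.integrable_bound[OF moments(1)[where 'n = 'n, OF s]])
    have "\<bar>F i j h\<bar> \<le> norm h powr (2 - ?n - 2 * s) * indicator (ball 0 1) h" for h
    proof -
      have "\<bar>h $ i * h $ j\<bar> \<le> norm h * norm h"
        unfolding abs_mult by (intro mult_mono component_le_norm_cart) auto
      then have "norm h powr (- ?n - 2 * s) * indicator (ball 0 1) h * \<bar>h $ i * h $ j\<bar>
          \<le> norm h powr (- ?n - 2 * s) * indicator (ball 0 1) h * (norm h)\<^sup>2"
        by (intro mult_left_mono) (auto simp: power2_eq_square)
      also have "\<dots> = norm h powr (2 - ?n - 2 * s) * indicator (ball 0 1) h"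
        using pw[of h] by (simp add: mult_ac)
      finally show ?thesis by (simp add: F_def abs_mult)
    qed
    then show "AE h in lborel. norm (F i j h) \<le> norm (norm h powr (2 - ?n - 2 * s) * indicator (ball 0 1) (h::real^'n))"
      by (intro AE_I2) (simp add: order_trans[OF _ abs_ge_self])
  qed simp
  then show "integrable lborel (F i j)" .
  show "(LINT h|lborel. F i j h) = (if i = j then mom TYPE('n) 2 s / ?n else 0)"
  proof (cases "i = j")
    case False
    let ?\<sigma> = "\<lambda>k. if k = i then - 1 else (1::real)"
    let ?f = "signed_perm ?\<sigma> (\<lambda>k. k)"
    have nf: "norm (?f h) = norm h" for h by (rule norm_signed_perm) auto
    have "(LINT h|lborel. F i j h) = (LINT h|lborel. F i j (?f h))"
      by (rule integral_signed_perm[symmetric]) auto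
    also have "\<dots> = (LINT h|lborel. - F i j h)"
      using False nf by (intro Bochner_Integration.integral_cong) (auto simp: F_def indicator_def signed_perm_def)
    finally show ?thesis using False by simp
  next
    case True
    have same: "(LINT h|lborel. F k k h) = (LINT h|lborel. F i i h)" for k
    proof -
      let ?f = "signed_perm (\<lambda>_. 1) (\<lambda>m. if m = i then k else if m = k then i else m)"
      have nf: "norm (?f h) = norm h" for h by (rule norm_signed_perm) auto
      have "(LINT h|lborel. F i i h) = (LINT h|lborel. F i i (?f h))"
        by (rule integral_signed_perm[symmetric]) auto
      also have "\<dots> = (LINT h|lborel. F k k h)"
        using nf by (intro Bochner_Integration.integral_cong) (auto simp: F_def indicator_def signed_perm_def)
      finally show ?thesis by simp
    qed
    have "mom TYPE('n) 2 s = (LINT h|lborel. (\<Sum>k\<in>UNIV. F k k h))"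
      unfolding mom_def
    proof (rule Bochner_Integration.integral_cong)
      fix h :: "real^'n"
      have "(\<Sum>k\<in>UNIV. F k k h) = norm h powr (- ?n - 2 * s) * indicator (ball 0 1) h * (norm h)\<^sup>2"
        by (simp add: F_def sum_distrib_left power2_norm_eq_inner inner_vec_def)
      then show "norm h powr (2 - ?n - 2 * s) * indicator (ball 0 1) h = (\<Sum>k\<in>UNIV. F k k h)"
        using pw[of h] by (simp add: mult_ac)
    qed simp
    also have "\<dots> = (\<Sum>k\<in>(UNIV::'n set). LINT h|lborel. F k k h)"
      using int by (intro Bochner_Integration.integral_sum) auto
    also have "\<dots> = (\<Sum>k\<in>(UNIV::'n set). LINT h|lborel. F i i h)" by (rule sum.cong[OF refl same])
    also have "\<dots> = ?n * (LINT h|lborel. F i i h)" by simp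
    finally show ?thesis using True by simp
  qed
qed


section \<open>The fractional energy against a test function\<close>

definition gag :: "real \<Rightarrow> (real^'n \<Rightarrow> real) \<Rightarrow> (real^'n \<Rightarrow> real) \<Rightarrow> real" where
  "gag s u v = (\<integral>p. (case p of (x, y) \<Rightarrow>
     (u x - u y) * (v x - v y) / norm (x - y) powr (real CARD('n) + 2 * s)) \<partial>(lborel \<Otimes>\<^sub>M lborel))"

lemma gagliardo_measurable:
  assumes [measurable]: "u \<in> borel_measurable borel" "v \<in> borel_measurable borel"
  shows "(\<lambda>(x, y). (u x - u y) * (v x - v y) / norm (x - y) powr q) \<in> borel_measurable (lborel \<Otimes>\<^sub>M lborel)"
  by measurable

lemma Hs_L2: "u \<in> Hs s \<Longrightarrow> u \<in> L2 UNIV"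
  by (simp add: Hs_def)

lemma energy_gag: "energy C s u = C s / 2 * gag s u u"
  unfolding energy_def gag_def gagliardo_def by (simp add: power2_eq_square abs_mult[symmetric] case_prod_unfold)

lemma gag_integrable:
  fixes u v :: "real^'n \<Rightarrow> real"
  assumes "u \<in> Hs s" "v \<in> Hs s"
  shows "integrable (lborel \<Otimes>\<^sub>M lborel)
    (\<lambda>(x, y). (u x - u y) * (v x - v y) / norm (x - y) powr (real CARD('n) + 2 * s))"
proof (rule Bochner_Integration.integrable_bound)
  show "integrable (lborel \<Otimes>\<^sub>M lborel) (\<lambda>p. gagliardo s u p + gagliardo s v p)"
    using assms by (simp add: Hs_def)
  show "(\<lambda>(x, y). (u x - u y) * (v x - v y) / norm (x - y) powr (real CARD('n) + 2 * s))
      \<in> borel_measurable (lborel \<Otimes>\<^sub>M lborel)"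
    using assms by (intro gagliardo_measurable) (auto dest!: Hs_L2 L2_measurable)
  have "\<bar>a * b\<bar> \<le> \<bar>a\<bar>\<^sup>2 + \<bar>b\<bar>\<^sup>2" for a b :: real
  proof -
    have "2 * (\<bar>a\<bar> * \<bar>b\<bar>) \<le> \<bar>a\<bar>\<^sup>2 + \<bar>b\<bar>\<^sup>2" using sum_squares_bound[of "\<bar>a\<bar>" "\<bar>b\<bar>"] by simp
    moreover have "0 \<le> \<bar>a\<bar> * \<bar>b\<bar>" by simp
    ultimately show ?thesis unfolding abs_mult by linarith
  qed
  then have "\<bar>a * b\<bar> / c \<le> \<bar>a\<bar>\<^sup>2 / c + \<bar>b\<bar>\<^sup>2 / c" if "c \<ge> 0" for a b c :: real
    using that by (simp add: add_divide_distrib[symmetric] divide_right_mono)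
  then have "norm (case p of (x, y) \<Rightarrow> (u x - u y) * (v x - v y) / norm (x - y) powr (real CARD('n) + 2 * s))
      \<le> norm (gagliardo s u p + gagliardo s v p)" for p :: "(real^'n) \<times> (real^'n)"
    by (cases p) (simp add: gagliardo_def order_trans[OF _ abs_ge_self])
  then show "AE p in lborel \<Otimes>\<^sub>M lborel. norm (case p of (x, y) \<Rightarrow> (u x - u y) * (v x - v y)
      / norm (x - y) powr (real CARD('n) + 2 * s)) \<le> norm (gagliardo s u p + gagliardo s v p)"
    by (rule AE_I2)
qed

lemma gagliardo_nonneg: "gagliardo s u p \<ge> 0"
  by (cases p) (simp add: gagliardo_def)

lemma Hs_I:
  assumes "u \<in> L2 UNIV" "(\<integral>\<^sup>+p. ennreal (gagliardo s u p) \<partial>(lborel \<Otimes>\<^sub>M lborel)) < \<infinity>"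
  shows "u \<in> Hs s"
proof -
  have "gagliardo s u \<in> borel_measurable (lborel \<Otimes>\<^sub>M lborel)"
    using gagliardo_measurable[OF L2_measurable[OF assms(1)] L2_measurable[OF assms(1)]]
    by (simp add: gagliardo_def power2_eq_square)
  then have "integrable (lborel \<Otimes>\<^sub>M lborel) (gagliardo s u)"
    by (rule integrableI_nonneg[OF _ AE_I2[OF gagliardo_nonneg] assms(2)])
  then show ?thesis using assms(1) by (simp add: Hs_def)
qed

lemma gag_commute: "gag s u v = gag s v u"
  by (simp add: gag_def mult.commute)

lemma gag_add_left:
  assumes "u \<in> Hs s" "v \<in> Hs s" "w \<in> Hs s"
  shows "gag s (\<lambda>x. u x + c * v x) w = gag s u w + c * gag s v w"
proof -
  note i = gag_integrable[OF assms(1,3)] gag_integrable[OF assms(2,3)]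
  have "gag s u w + c * gag s v w
      = (\<integral>p. (case p of (x, y) \<Rightarrow> (u x - u y) * (w x - w y) / norm (x - y) powr (real CARD('a) + 2 * s))
        + c * (case p of (x, y) \<Rightarrow> (v x - v y) * (w x - w y) / norm (x - y) powr (real CARD('a) + 2 * s)) \<partial>(lborel \<Otimes>\<^sub>M lborel))"
    unfolding gag_def using i by simp
  also have "\<dots> = gag s (\<lambda>x. u x + c * v x) w"
    unfolding gag_def by (rule Bochner_Integration.integral_cong) (auto simp: algebra_simps add_divide_distrib diff_divide_distrib)
  finally show ?thesis by simp
qed

lemma gag_self_nonneg: "gag s u u \<ge> 0"
  unfolding gag_def by (intro integral_nonneg_AE AE_I2) (simp add: case_prod_unfold)

lemma Hs_add:
  assumes u: "u \<in> Hs s" and v: "v \<in> Hs s"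
  shows "(\<lambda>x. u x + c * v x) \<in> Hs s"
proof -
  have L: "(\<lambda>x. u x + c * v x) \<in> L2 UNIV" by (rule L2_add[OF Hs_L2[OF u] L2_cmult[OF Hs_L2[OF v]]])
  have "integrable (lborel \<Otimes>\<^sub>M lborel) (gagliardo s (\<lambda>x. u x + c * v x))"
  proof (rule Bochner_Integration.integrable_bound)
    show "integrable (lborel \<Otimes>\<^sub>M lborel) (\<lambda>p. 2 * gagliardo s u p + 2 * c\<^sup>2 * gagliardo s v p)"
      using u v by (simp add: Hs_def)
    show "gagliardo s (\<lambda>x. u x + c * v x) \<in> borel_measurable (lborel \<Otimes>\<^sub>M lborel)"
      using gagliardo_measurable[OF L2_measurable[OF L] L2_measurable[OF L]]
      by (simp add: gagliardo_def power2_eq_square)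
    have "(a + c * b)\<^sup>2 / d \<le> 2 * (a\<^sup>2 / d) + 2 * c\<^sup>2 * (b\<^sup>2 / d)" if "d \<ge> 0" for a b d :: real
    proof -
      have "(a + c * b)\<^sup>2 \<le> 2 * a\<^sup>2 + 2 * c\<^sup>2 * b\<^sup>2"
        using sum_squares_bound[of a "c * b"] unfolding power2_sum power_mult_distrib by linarith
      then have "(a + c * b)\<^sup>2 / d \<le> (2 * a\<^sup>2 + 2 * c\<^sup>2 * b\<^sup>2) / d" using that by (rule divide_right_mono)
      then show ?thesis by (simp add: add_divide_distrib)
    qed
    note b = this
    have "norm (gagliardo s (\<lambda>x. u x + c * v x) p) \<le> norm (2 * gagliardo s u p + 2 * c\<^sup>2 * gagliardo s v p)" for p
    proof -
      obtain x y where p: "p = (x, y)" by (cases p)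
      have e: "u x + c * v x - (u y + c * v y) = (u x - u y) + c * (v x - v y)" by (simp add: algebra_simps)
      have "gagliardo s (\<lambda>x. u x + c * v x) p \<le> 2 * gagliardo s u p + 2 * c\<^sup>2 * gagliardo s v p"
        using b[of "norm (x - y) powr (real CARD('a) + 2 * s)" "u x - u y" "v x - v y"]
        by (simp add: p gagliardo_def e)
      then show ?thesis using gagliardo_nonneg[of s "\<lambda>x. u x + c * v x" p] by simp
    qed
    then show "AE p in lborel \<Otimes>\<^sub>M lborel. norm (gagliardo s (\<lambda>x. u x + c * v x) p)
        \<le> norm (2 * gagliardo s u p + 2 * c\<^sup>2 * gagliardo s v p)" by (rule AE_I2)
  qed
  with L show ?thesis by (simp add: Hs_def)
qed

lemma gag_expand:
  assumes "u \<in> Hs s" "v \<in> Hs s"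
  shows "gag s (\<lambda>x. u x + c * v x) (\<lambda>x. u x + c * v x) = gag s u u + 2 * c * gag s u v + c\<^sup>2 * gag s v v"
proof -
  let ?W = "\<lambda>x. u x + c * v x"
  have 1: "gag s ?W ?W = gag s u ?W + c * gag s v ?W" by (rule gag_add_left[OF assms Hs_add[OF assms]])
  have 2: "gag s u ?W = gag s u u + c * gag s v u"
    unfolding gag_commute[of s u ?W] by (rule gag_add_left[OF assms assms(1)])
  have 3: "gag s v ?W = gag s u v + c * gag s v v"
    unfolding gag_commute[of s v ?W] by (rule gag_add_left[OF assms assms(2)])
  show ?thesis unfolding 1 2 3 gag_commute[of s v u] by (simp add: power2_eq_square algebra_simps)
qed

text \<open>Nonnegativity of the form at u + v. It serves to absorb the pairing of
  \<open>\<psi> - \<phi>\<close> with w into the energy of w, at the cost of half the energy of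
  \<open>\<psi> - \<phi>\<close>.\<close>

lemma gag_lower:
  assumes "u \<in> Hs s" "v \<in> Hs s"
  shows "- gag s u v \<le> (gag s u u + gag s v v) / 2"
  using gag_expand[OF assms, of 1] gag_self_nonneg[of s "\<lambda>x. u x + 1 * v x"] by simp

text \<open>The substitution y = x + h followed by Fubini: with h as outer variable the kernel
  leaves the inner integral, which becomes an L^2 pairing.\<close>

lemma pair_shift:
  fixes F :: "(real^'n) \<times> (real^'n) \<Rightarrow> real"
  assumes F: "integrable (lborel \<Otimes>\<^sub>M lborel) F"
  shows "integrable (lborel \<Otimes>\<^sub>M lborel) (\<lambda>(x, h). F (x, x + h))"
    "(\<integral>p. F p \<partial>(lborel \<Otimes>\<^sub>M lborel)) = (LINT h|lborel. LINT x|lborel. F (x, x + h))"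
    "integrable lborel (\<lambda>h. LINT x|lborel. F (x, x + h))"
proof -
  have m: "F \<in> borel_measurable (borel \<Otimes>\<^sub>M borel)"
    using borel_measurable_integrable[OF F] by (simp cong: measurable_cong_sets)
  have [measurable]: "(\<lambda>y. F (x, y)) \<in> borel_measurable borel" for x
    using measurable_compose[OF measurable_Pair1' m] by simp
  have sh: "(\<lambda>(x, h). F (x, x + h)) \<in> borel_measurable (lborel \<Otimes>\<^sub>M lborel)"
  proof -
    have "(\<lambda>p::(real^'n)\<times>(real^'n). (fst p, fst p + snd p)) \<in> borel \<Otimes>\<^sub>M borel \<rightarrow>\<^sub>M borel \<Otimes>\<^sub>M borel"
      by measurable
    from measurable_compose[OF this m] show ?thesis by (simp add: case_prod_unfold cong: measurable_cong_sets)
  qed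
  have fin: "(\<integral>\<^sup>+x. \<integral>\<^sup>+y. ennreal \<bar>F (x, y)\<bar> \<partial>lborel \<partial>lborel) < \<infinity>"
    using F by (subst lborel.nn_integral_fst) (auto simp: integrable_iff_bounded)
  show i: "integrable (lborel \<Otimes>\<^sub>M lborel) (\<lambda>(x, h). F (x, x + h))"
  proof (rule integrable_pairI[OF sh _ fin])
    fix x
    show "(\<integral>\<^sup>+h. ennreal \<bar>case (x, h) of (x, h) \<Rightarrow> F (x, x + h)\<bar> \<partial>lborel) \<le> (\<integral>\<^sup>+y. ennreal \<bar>F (x, y)\<bar> \<partial>lborel)"
      using nn_integral_translate_left[of "\<lambda>y. ennreal \<bar>F (x, y)\<bar>" x] by simp
  qed
  have "(\<integral>p. F p \<partial>(lborel \<Otimes>\<^sub>M lborel)) = (LINT x|lborel. LINT y|lborel. F (x, y))"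
    using lborel_pair.integral_fst[of "\<lambda>x y. F (x, y)"] F by simp
  also have "\<dots> = (LINT x|lborel. LINT h|lborel. F (x, x + h))"
    by (rule Bochner_Integration.integral_cong[OF refl])
       (use integral_translate[of "\<lambda>y. F (_, y)"] in \<open>simp add: add.commute\<close>)
  also have "\<dots> = (LINT h|lborel. LINT x|lborel. F (x, x + h))"
    using lborel_pair.Fubini_integral[OF i] by simp
  finally show "(\<integral>p. F p \<partial>(lborel \<Otimes>\<^sub>M lborel)) = (LINT h|lborel. LINT x|lborel. F (x, x + h))" .
  show "integrable lborel (\<lambda>h. LINT x|lborel. F (x, x + h))"
    using lborel_pair.integrable_snd[OF i] by simp
qed

lemma nrm_bounded_support:
  fixes f :: "real^'n \<Rightarrow> real"
  assumes "f \<in> borel_measurable borel" "\<And>x. \<bar>f x\<bar> \<le> B" "\<And>x. norm x \<ge> R \<Longrightarrow> f x = 0"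
  shows "f \<in> L2 UNIV" "nrm f \<le> B * sqrt (measure lborel (ball (0::real^'n) R))"
proof -
  have B: "B \<ge> 0" using assms(2) abs_ge_zero order_trans by blast
  have m: "(\<lambda>x. (f x)\<^sup>2) \<in> borel_measurable borel" using assms(1) by (rule borel_measurable_power)
  have le: "\<bar>(f x)\<^sup>2\<bar> \<le> B\<^sup>2" for x using power_mono[OF assms(2)[of x] abs_ge_zero, of 2] by simp
  have z: "norm x \<ge> R \<Longrightarrow> (f x)\<^sup>2 = 0" for x using assms(3) by simp
  note b = integrable_bounded_support[OF m le z]
  show "f \<in> L2 UNIV" by (rule L2_I[OF assms(1) b(1)])
  have "ip f f \<le> B\<^sup>2 * measure lborel (ball (0::real^'n) R)"
    using b(2) by (simp add: ip_def power2_eq_square)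
  then have "sqrt (ip f f) \<le> sqrt (B\<^sup>2 * measure lborel (ball (0::real^'n) R))" by simp
  then show "nrm f \<le> B * sqrt (measure lborel (ball (0::real^'n) R))"
    using B by (simp add: nrm_def real_sqrt_mult)
qed

lemma powr_kernel:
  fixes h :: "'a::real_normed_vector"
  shows "1 / norm h powr (n + 2 * s) = norm h powr (- n - 2 * s)"
  by (simp add: powr_minus_divide[symmetric])

lemma powr_norm_power:
  fixes h :: "'a::real_normed_vector"
  assumes "m > 0"
  shows "norm h powr q * norm h ^ m = norm h powr (real m + q)"
  using assms by (cases "h = 0") (simp_all add: powr_add powr_realpow)

text \<open>The increment over h has an L^2 norm of order |h| for |h| < 1, by the Lipschitz bound
  and the compact support, and is bounded by twice the norm of the function elsewhere. The squares
  are integrable against the kernel by the second moment and the tail.\<close>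

lemma test_functions_Hs:
  fixes \<phi> :: "real^'n \<Rightarrow> real"
  assumes \<phi>: "\<phi> \<in> test_functions UNIV" and s: "1 / 2 \<le> s" "s < 1"
  shows "\<phi> \<in> Hs s"
proof (rule Hs_I[OF test_functions_L2[OF \<phi>]])
  note \<phi>L = test_functions_L2[OF \<phi>]
  obtain B where B: "B > 0" "\<And>x h. \<bar>\<phi> (x + h) - \<phi> x\<bar> \<le> B * norm h"
    using test_functions_Lipschitz[OF \<phi>] by blast
  obtain R where R: "R > 0" "\<And>x. norm x \<ge> R \<Longrightarrow> \<phi> x = 0" using test_functions_support[OF \<phi>] by blast
  let ?V = "sqrt (measure lborel (ball (0::real^'n) (R + 1)))"
  let ?q = "- real CARD('n) - 2 * s"
  let ?d = "\<lambda>h x. \<phi> (x + h) - \<phi> x"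
  have dL: "?d h \<in> L2 UNIV" for h by (rule L2_diff[OF L2_translate[OF \<phi>L] \<phi>L])
  have near: "nrm (?d h) \<le> B * ?V * norm h" if "norm h < 1" for h
  proof -
    have "nrm (?d h) \<le> (B * norm h) * ?V"
    proof (rule nrm_bounded_support(2))
      show "?d h \<in> borel_measurable borel" by (rule L2_measurable[OF dL])
      show "\<bar>?d h x\<bar> \<le> B * norm h" for x by (rule B)
      show "?d h x = 0" if x: "norm x \<ge> R + 1" for x
      proof -
        have "norm (x + h) \<ge> norm x - norm h" by (metis norm_diff_ineq)
        then show ?thesis using R(2) x \<open>norm h < 1\<close> by simp
      qed
    qed
    then show ?thesis by (simp add: mult_ac)
  qed
  have far: "nrm (?d h) \<le> 2 * nrm \<phi>" for h
    using nrm_triangle_diff[OF L2_translate[OF \<phi>L] \<phi>L, of h] nrm_translate[OF \<phi>L, of h] by simp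
  let ?K1 = "(B * ?V)\<^sup>2" and ?K2 = "(2 * nrm \<phi>)\<^sup>2"
  have m [measurable]: "\<phi> \<in> borel_measurable borel" by (rule test_functions_measurable[OF \<phi>])
  have inner: "(\<integral>\<^sup>+x. ennreal (gagliardo s \<phi> (x, x + h)) \<partial>lborel)
      \<le> ennreal (?K1 * (norm h powr (2 + ?q) * indicator (ball 0 1) h) + ?K2 * (norm h powr ?q * indicator (- ball 0 1) h))" for h
  proof -
    have "gagliardo s \<phi> (x, x + h) = norm h powr ?q * (?d h x * ?d h x)" for x
      using powr_kernel[of h "real CARD('n)" s]
      by (simp add: gagliardo_def power2_eq_square divide_inverse mult_ac algebra_simps)
    then have "(\<integral>\<^sup>+x. ennreal (gagliardo s \<phi> (x, x + h)) \<partial>lborel)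
        = (\<integral>\<^sup>+x. ennreal (norm h powr ?q * (?d h x * ?d h x)) \<partial>lborel)" by simp
    also have "\<dots> = ennreal (LINT x|lborel. norm h powr ?q * (?d h x * ?d h x))"
      by (rule nn_integral_eq_integral) (use integrable_L2_mult[OF dL dL] in auto)
    also have "(LINT x|lborel. norm h powr ?q * (?d h x * ?d h x)) = norm h powr ?q * (nrm (?d h))\<^sup>2"
      by (simp add: nrm_sq ip_def)
    also have "ennreal \<dots> \<le> ennreal (?K1 * (norm h powr (2 + ?q) * indicator (ball 0 1) h) + ?K2 * (norm h powr ?q * indicator (- ball 0 1) h))"
    proof (rule ennreal_leI)
      show "norm h powr ?q * (nrm (?d h))\<^sup>2 \<le> ?K1 * (norm h powr (2 + ?q) * indicator (ball 0 1) h) + ?K2 * (norm h powr ?q * indicator (- ball 0 1) h)"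
      proof (cases "norm h < 1")
        case True
        have "norm h powr ?q * (nrm (?d h))\<^sup>2 \<le> norm h powr ?q * (B * ?V * norm h)\<^sup>2"
          by (intro mult_left_mono power_mono near True) auto
        also have "\<dots> = ?K1 * (norm h powr ?q * norm h ^ 2)" by (simp add: power_mult_distrib mult_ac)
        also have "norm h powr ?q * norm h ^ 2 = norm h powr (2 + ?q)"
          using powr_norm_power[of 2 h ?q] by simp
        finally show ?thesis using True by simp
      next
        case False
        have "norm h powr ?q * (nrm (?d h))\<^sup>2 \<le> norm h powr ?q * ?K2"
          by (intro mult_left_mono power_mono far) auto
        then show ?thesis using False by (simp add: mult.commute)
      qed
    qed
    finally show ?thesis .
  qed
  have gm: "(\<lambda>p. ennreal (gagliardo s \<phi> p)) \<in> borel_measurable (lborel \<Otimes>\<^sub>M lborel)"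
  proof -
    have "gagliardo s \<phi> \<in> borel_measurable (lborel \<Otimes>\<^sub>M lborel)"
      using gagliardo_measurable[OF m m, of "real CARD('n) + 2 * s"] by (simp add: gagliardo_def power2_eq_square)
    then show ?thesis by simp
  qed
  have gm': "(\<lambda>p. ennreal (gagliardo s \<phi> p)) \<in> borel_measurable (borel \<Otimes>\<^sub>M borel)"
    using gm by (simp cong: measurable_cong_sets)
  have sh: "(\<lambda>(x, h). ennreal (gagliardo s \<phi> (x, x + h))) \<in> borel_measurable (lborel \<Otimes>\<^sub>M lborel)"
  proof -
    have "(\<lambda>p::(real^'n)\<times>(real^'n). (fst p, fst p + snd p)) \<in> borel \<Otimes>\<^sub>M borel \<rightarrow>\<^sub>M borel \<Otimes>\<^sub>M borel"
      by measurable
    from measurable_compose[OF this gm'] show ?thesis by (simp add: case_prod_unfold cong: measurable_cong_sets)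
  qed
  have "(\<integral>\<^sup>+p. ennreal (gagliardo s \<phi> p) \<partial>(lborel \<Otimes>\<^sub>M lborel))
      = (\<integral>\<^sup>+x. \<integral>\<^sup>+y. ennreal (gagliardo s \<phi> (x, y)) \<partial>lborel \<partial>lborel)"
    by (rule lborel.nn_integral_fst[OF gm, symmetric])
  also have "\<dots> = (\<integral>\<^sup>+x. \<integral>\<^sup>+h. ennreal (gagliardo s \<phi> (x, x + h)) \<partial>lborel \<partial>lborel)"
  proof (rule nn_integral_cong)
    fix x
    have "(\<lambda>y. ennreal (gagliardo s \<phi> (x, y))) \<in> borel_measurable borel"
      using measurable_compose[OF measurable_Pair1' gm'] by simp
    from nn_integral_translate_left[OF this, of x]
    show "(\<integral>\<^sup>+y. ennreal (gagliardo s \<phi> (x, y)) \<partial>lborel) = (\<integral>\<^sup>+h. ennreal (gagliardo s \<phi> (x, x + h)) \<partial>lborel)" by simp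
  qed
  also have "\<dots> = (\<integral>\<^sup>+h. \<integral>\<^sup>+x. ennreal (gagliardo s \<phi> (x, x + h)) \<partial>lborel \<partial>lborel)"
    using lborel_pair.Fubini[OF sh] by simp
  also have "\<dots> \<le> (\<integral>\<^sup>+h. ennreal (?K1 * (norm h powr (2 + ?q) * indicator (ball 0 1) h)
      + ?K2 * (norm h powr ?q * indicator (- ball 0 1) h)) \<partial>(lborel :: (real^'n) measure))"
    by (rule nn_integral_mono) (rule inner)
  also have "\<dots> < \<infinity>"
  proof -
    have "integrable lborel (\<lambda>h::real^'n. ?K1 * (norm h powr (2 + ?q) * indicator (ball 0 1) h)
      + ?K2 * (norm h powr ?q * indicator (- ball 0 1) h))"
      using moments(1,3)[where 'n = 'n, OF s]
      by (intro Bochner_Integration.integrable_add integrable_mult_right) (simp_all add: algebra_simps)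
    then show ?thesis by (subst nn_integral_eq_integral) (auto intro!: add_nonneg_nonneg mult_nonneg_nonneg)
  qed
  finally show "(\<integral>\<^sup>+p. ennreal (gagliardo s \<phi> p) \<partial>(lborel \<Otimes>\<^sub>M lborel)) < \<infinity>" .
qed

text \<open>Discrete integration by parts: translating the terms with w (x + h) back by h moves both
  differences onto v.\<close>

lemma ip_difference:
  assumes w: "w \<in> L2 UNIV" and v: "v \<in> L2 UNIV"
  shows "(LINT x|lborel. (w x - w (x + h)) * (v x - v (x + h)))
    = - ip w (\<lambda>x. v (x + h) + v (x - h) - 2 * v x)"
proof -
  note wh = L2_translate[OF w, of h]
  note vh = L2_translate[OF v, of h] L2_translate[OF v, of "- h"]
  have 1: "ip (\<lambda>x. w (x + h)) v = ip w (\<lambda>x. v (x - h))"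
    using ip_translate[OF wh v, of "- h"] by simp
  have "(LINT x|lborel. (w x - w (x + h)) * (v x - v (x + h))) = ip (\<lambda>x. w x - w (x + h)) (\<lambda>x. v x - v (x + h))"
    by (simp add: ip_def)
  also have "\<dots> = ip w v - ip w (\<lambda>x. v (x + h)) - (ip w (\<lambda>x. v (x - h)) - ip w v)"
    using 1 by (simp add: ip_diff_left[OF w wh L2_diff[OF v vh(1)]] ip_diff_right[OF v vh(1) w]
        ip_diff_right[OF v vh(1) wh] ip_translate[OF w v])
  also have "\<dots> = - ip w (\<lambda>x. v (x + h) + v (x - h) - 2 * v x)"
  proof -
    have vh2: "(\<lambda>x. v (x - h)) \<in> L2 UNIV" using vh(2) by simp
    show ?thesis
      using ip_diff_right[OF L2_add[OF vh(1) vh2] L2_cmult[OF v] w, of 2] ip_add_right[OF vh(1) vh2 w]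
      by (simp add: ip_cmult_right)
  qed
  finally show ?thesis .
qed

lemma hessian_form_L2: "\<phi> \<in> test_functions UNIV \<Longrightarrow> hessian_form \<phi> h \<in> L2 UNIV"
  unfolding hessian_form_def[abs_def]
  by (intro L2_sum[OF finite] L2_cmult test_functions_L2 test_functions_partial)

text \<open>The two bounds match the two error moments: the cubic one will be integrated against the
  third moment inside the unit ball, the constant one against the tail.\<close>

lemma second_difference_bound:
  fixes \<phi> :: "real^'n \<Rightarrow> real"
  assumes \<phi>: "\<phi> \<in> test_functions UNIV"
  shows "\<exists>C>0. (\<forall>h. norm h < 1 \<longrightarrow> nrm (\<lambda>x. (\<phi> (x + h) + \<phi> (x - h) - 2 * \<phi> x) - hessian_form \<phi> h x) \<le> C * norm h ^ 3)
    \<and> (\<forall>h. nrm (\<lambda>x. \<phi> (x + h) + \<phi> (x - h) - 2 * \<phi> x) \<le> C)"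
proof -
  note \<phi>L = test_functions_L2[OF \<phi>]
  have t2: "(\<lambda>x. \<phi> (x - h)) \<in> L2 UNIV" "nrm (\<lambda>x. \<phi> (x - h)) = nrm \<phi>" for h
    using L2_translate[OF \<phi>L, of "- h"] nrm_translate[OF \<phi>L, of "- h"] by simp_all
  obtain B where B: "B > 0" "\<And>x h. \<bar>\<phi> (x + h) + \<phi> (x - h) - 2 * \<phi> x - hessian_form \<phi> h x\<bar> \<le> B * (norm h) ^ 3"
    using test_functions_Taylor2[OF \<phi>] by blast
  obtain R where R: "R > 0" "\<And>x. norm x \<ge> R \<Longrightarrow> \<phi> x = 0" using test_functions_support[OF \<phi>] by blast
  have hz: "hessian_form \<phi> h x = 0" if x: "norm x > R" for h x
  proof -
    let ?U = "{y::real^'n. norm y > R}"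
    have op: "open ?U" by (intro open_Collect_less continuous_intros)
    have xU: "x \<in> ?U" using x by simp
    have "\<phi> y = 0" if "y \<in> ?U" for y using R(2)[of y] that by simp
    then have "partial_deriv i \<phi> y = 0" if "y \<in> ?U" for i y
      by (rule partial_deriv_const_on[OF op _ that])
    then have z: "partial_deriv j (partial_deriv i \<phi>) x = 0" for i j
      by (rule partial_deriv_const_on[OF op _ xU])
    show ?thesis by (simp add: hessian_form_def z)
  qed
  let ?V = "sqrt (measure lborel (ball (0::real^'n) (R + 1)))"
  let ?D = "\<lambda>h x. \<phi> (x + h) + \<phi> (x - h) - 2 * \<phi> x"
  have DL: "?D h \<in> L2 UNIV" for h
    by (intro L2_diff L2_add L2_cmult L2_translate[OF \<phi>L] \<phi>L t2)
  have near: "nrm (\<lambda>x. ?D h x - hessian_form \<phi> h x) \<le> (B * norm h ^ 3) * ?V" if h: "norm h < 1" for h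
  proof (rule nrm_bounded_support(2))
    show "(\<lambda>x. ?D h x - hessian_form \<phi> h x) \<in> borel_measurable borel"
      by (rule L2_measurable[OF L2_diff[OF DL hessian_form_L2[OF \<phi>]]])
    show "\<bar>?D h x - hessian_form \<phi> h x\<bar> \<le> B * norm h ^ 3" for x by (rule B)
    show "?D h x - hessian_form \<phi> h x = 0" if x: "norm x \<ge> R + 1" for x
    proof -
      have "norm (x + h) \<ge> norm x - norm h" "norm (x - h) \<ge> norm x - norm h"
        by (metis norm_diff_ineq) (metis norm_triangle_ineq2)
      then have "norm (x + h) \<ge> R" "norm (x - h) \<ge> R" "norm x > R" using x h by linarith+
      then show ?thesis using R(2) hz by simp
    qed
  qed
  have far: "nrm (?D h) \<le> 4 * nrm \<phi>" for h
  proof -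
    have "nrm (?D h) \<le> nrm (\<lambda>x. \<phi> (x + h) + \<phi> (x - h)) + nrm (\<lambda>x. 2 * \<phi> x)"
      by (rule nrm_triangle_diff[OF L2_add[OF L2_translate[OF \<phi>L] t2(1)] L2_cmult[OF \<phi>L]])
    also have "nrm (\<lambda>x. \<phi> (x + h) + \<phi> (x - h)) \<le> nrm (\<lambda>x. \<phi> (x + h)) + nrm (\<lambda>x. \<phi> (x - h))"
      by (rule nrm_triangle[OF L2_translate[OF \<phi>L] t2(1)])
    finally show ?thesis by (simp add: nrm_translate[OF \<phi>L] t2(2) nrm_cmult)
  qed
  let ?C = "B * ?V + 4 * nrm \<phi> + 1"
  have BV: "B * ?V \<ge> 0" using B(1) by simp
  have C: "?C > 0" using BV nrm_nonneg[of \<phi>] by linarith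
  have "nrm (\<lambda>x. ?D h x - hessian_form \<phi> h x) \<le> ?C * norm h ^ 3" if "norm h < 1" for h
  proof -
    have "(B * ?V) * norm h ^ 3 \<le> ?C * norm h ^ 3"
      using nrm_nonneg[of \<phi>] by (intro mult_right_mono) auto
    then show ?thesis using near[OF that] by (simp add: mult_ac)
  qed
  moreover have "nrm (?D h) \<le> ?C" for h using far[of h] BV by linarith
  ultimately show ?thesis using C by blast
qed

text \<open>By translation invariance the energy pairing of \<open>w\<close> with \<open>\<phi>\<close> integrates \<open>w\<close> against second
  differences of \<open>\<phi>\<close>. Close to the origin these are given by the Hessian, whose average over the symmetric kernel
  is a multiple of the Laplacian; the remainder and the tail are negligible relative to \<open>mom 2 s\<close>.\<close>

lemma gag_test_function:
  fixes \<phi> :: "real^'n \<Rightarrow> real"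
  assumes \<phi>: "\<phi> \<in> test_functions UNIV"
  shows "\<exists>C>0. \<forall>s w. 1 / 2 \<le> s \<longrightarrow> s < 1 \<longrightarrow> w \<in> Hs s \<longrightarrow>
    \<bar>gag s w \<phi> + mom TYPE('n) 2 s / real CARD('n) * ip w (Lap \<phi>)\<bar> \<le> C * defect s * mom TYPE('n) 2 s * nrm w"
proof -
  let ?D = "\<lambda>h x. \<phi> (x + h) + \<phi> (x - h) - 2 * \<phi> x"
  obtain C where C: "C > 0" "\<And>h. norm h < 1 \<Longrightarrow> nrm (\<lambda>x. ?D h x - hessian_form \<phi> h x) \<le> C * norm h ^ 3"
    "\<And>h. nrm (?D h) \<le> C"
    using second_difference_bound[OF \<phi>] by blast
  note \<phi>L = test_functions_L2[OF \<phi>]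
  have DL: "?D h \<in> L2 UNIV" for h
    using L2_translate[OF \<phi>L, of "- h"] by (intro L2_diff L2_add L2_cmult L2_translate[OF \<phi>L] \<phi>L) simp
  note HL = hessian_form_L2[OF \<phi>]
  have "\<bar>gag s w \<phi> + mom TYPE('n) 2 s / real CARD('n) * ip w (Lap \<phi>)\<bar> \<le> (2 * C) * defect s * mom TYPE('n) 2 s * nrm w"
    if s: "1 / 2 \<le> s" "s < 1" and w: "w \<in> Hs s" for s w
  proof -
    let ?n = "real CARD('n)"
    let ?q = "- ?n - 2 * s"
    note wL = Hs_L2[OF w]
    let ?P = "\<lambda>h. ip w (?D h)"
    let ?Q = "\<lambda>h. ip w (hessian_form \<phi> h)"
    let ?F = "\<lambda>p. case p of (x, y) \<Rightarrow> (w x - w y) * (\<phi> x - \<phi> y) / norm (x - y) powr (?n + 2 * s)"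
    note F = pair_shift[OF gag_integrable[OF w test_functions_Hs[OF \<phi> s]]]
    have inner: "(LINT x|lborel. ?F (x, x + h)) = - (norm h powr ?q * ?P h)" for h
    proof -
      have "?F (x, x + h) = norm h powr ?q * ((w x - w (x + h)) * (\<phi> x - \<phi> (x + h)))" for x
        using powr_kernel[of h ?n s] by (simp add: divide_inverse mult_ac)
      then have "(LINT x|lborel. ?F (x, x + h)) = norm h powr ?q * (LINT x|lborel. (w x - w (x + h)) * (\<phi> x - \<phi> (x + h)))"
        by simp
      then show ?thesis unfolding ip_difference[OF wL \<phi>L] by simp
    qed
    have iP: "integrable lborel (\<lambda>h. norm h powr ?q * ?P h)"
      using F(3) unfolding inner by simp
    have g: "gag s w \<phi> = - (LINT h|lborel. norm h powr ?q * ?P h)"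
      unfolding gag_def F(2) inner by simp
    define M where "M = (\<lambda>i j (h::real^'n). norm h powr ?q * indicator (ball 0 1) h * (h $ i * h $ j))"
    define c where "c = (\<lambda>i j. ip w (partial_deriv j (partial_deriv i \<phi>)))"
    have Q: "?Q h = (\<Sum>i\<in>UNIV. \<Sum>j\<in>UNIV. h $ i * h $ j * c i j)" for h
    proof -
      have L: "(\<lambda>x. h $ j * partial_deriv j (partial_deriv i \<phi>) x) \<in> L2 UNIV" for i j
        by (intro L2_cmult test_functions_L2 test_functions_partial \<phi>)
      have "?Q h = ip (\<lambda>x. \<Sum>i\<in>UNIV. h $ i * (\<Sum>j\<in>UNIV. h $ j * partial_deriv j (partial_deriv i \<phi>) x)) w"
        by (simp add: hessian_form_def[abs_def] ip_commute)
      also have "\<dots> = (\<Sum>i\<in>UNIV. h $ i * (\<Sum>j\<in>UNIV. h $ j * ip (partial_deriv j (partial_deriv i \<phi>)) w))"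
        by (simp add: ip_sum_left[OF finite L2_cmult[OF L2_sum[OF finite L]] wL] ip_cmult_left ip_sum_left[OF finite L wL])
      finally show ?thesis by (simp add: c_def ip_commute[of w] sum_distrib_left mult_ac)
    qed
    have M: "integrable lborel (M i j)" "(LINT h|lborel. M i j h) = (if i = j then mom TYPE('n) 2 s / ?n else 0)" for i j
      using second_moment[where 'n = 'n, OF s, of i j] unfolding M_def by simp_all
    have Msum: "norm h powr ?q * indicator (ball 0 1) h * ?Q h = (\<Sum>i\<in>UNIV. \<Sum>j\<in>UNIV. M i j h * c i j)" for h
      unfolding Q M_def by (simp add: sum_distrib_left mult_ac)
    have iQ: "integrable lborel (\<lambda>h. norm h powr ?q * indicator (ball 0 1) h * ?Q h)"
      unfolding Msum using M(1) by (intro Bochner_Integration.integrable_sum integrable_mult_left) auto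
    have lap: "(\<Sum>i\<in>UNIV. c i i) = ip w (Lap \<phi>)"
    proof -
      have "ip w (Lap \<phi>) = ip (\<lambda>x. \<Sum>i\<in>UNIV. partial_deriv i (partial_deriv i \<phi>) x) w"
        by (simp add: Lap_def[abs_def] ip_commute)
      also have "\<dots> = (\<Sum>i\<in>UNIV. ip (partial_deriv i (partial_deriv i \<phi>)) w)"
        by (rule ip_sum_left[OF finite test_functions_L2[OF test_functions_partial[OF test_functions_partial[OF \<phi>]]] wL])
      finally show ?thesis by (simp add: c_def ip_commute[of w])
    qed
    have IQ: "(LINT h|lborel. norm h powr ?q * indicator (ball 0 1) h * ?Q h) = mom TYPE('n) 2 s / ?n * ip w (Lap \<phi>)"
    proof -
      have "(LINT h|lborel. norm h powr ?q * indicator (ball 0 1) h * ?Q h) = (\<Sum>i\<in>UNIV. \<Sum>j\<in>UNIV. (LINT h|lborel. M i j h) * c i j)"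
        unfolding Msum using M(1) by (simp add: Bochner_Integration.integral_sum)
      also have "\<dots> = (\<Sum>i\<in>UNIV. mom TYPE('n) 2 s / ?n * c i i)"
        unfolding M(2) by (simp add: if_distribR if_distrib cong: if_cong)
      also have "\<dots> = mom TYPE('n) 2 s / ?n * ip w (Lap \<phi>)" by (simp add: lap[symmetric] sum_distrib_left)
      finally show ?thesis .
    qed
    \<comment> \<open>The Hessian term is subtracted only inside the unit ball; outside, the whole
      second difference counts as error.\<close>
    let ?E = "\<lambda>h. norm h powr ?q * ?P h - norm h powr ?q * indicator (ball 0 1) h * ?Q h"
    let ?G = "\<lambda>h::real^'n. C * nrm w * (norm h powr (3 + ?q) * indicator (ball 0 1) h)
        + C * nrm w * (norm h powr ?q * indicator (- ball 0 1) h)"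
    have iE: "integrable lborel ?E" by (rule Bochner_Integration.integrable_diff[OF iP iQ])
    have i3: "integrable lborel (\<lambda>h::real^'n. norm h powr (3 + ?q) * indicator (ball 0 1) h)"
      "(LINT h|lborel. norm (h::real^'n) powr (3 + ?q) * indicator (ball 0 1) h) = mom TYPE('n) 3 s"
      using moments(2)[where 'n = 'n, OF s] by (simp_all add: mom_def algebra_simps)
    have it: "integrable lborel (\<lambda>h::real^'n. norm h powr ?q * indicator (- ball 0 1) h)"
      "(LINT h|lborel. norm (h::real^'n) powr ?q * indicator (- ball 0 1) h) = tail TYPE('n) s"
      using moments(3)[where 'n = 'n, OF s] by (simp_all add: tail_def)
    have EG: "\<bar>?E h\<bar> \<le> ?G h" for h
    proof (cases "norm h < 1")
      case True
      have "?P h - ?Q h = ip w (\<lambda>x. ?D h x - hessian_form \<phi> h x)"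
        by (rule ip_diff_right[OF DL HL wL, symmetric])
      then have "\<bar>?P h - ?Q h\<bar> \<le> nrm w * nrm (\<lambda>x. ?D h x - hessian_form \<phi> h x)"
        using ip_Cauchy_Schwarz[OF wL L2_diff[OF DL HL]] by simp
      also have "\<dots> \<le> nrm w * (C * norm h ^ 3)" by (intro mult_left_mono C(2) True) simp
      finally have "norm h powr ?q * \<bar>?P h - ?Q h\<bar> \<le> norm h powr ?q * (nrm w * (C * norm h ^ 3))"
        by (rule mult_left_mono) simp
      also have "\<dots> = C * nrm w * (norm h powr ?q * norm h ^ 3)" by (simp add: mult_ac)
      also have "norm h powr ?q * norm h ^ 3 = norm h powr (3 + ?q)" using powr_norm_power[of 3 h ?q] by simp
      finally have a: "norm h powr ?q * \<bar>?P h - ?Q h\<bar> \<le> C * nrm w * norm h powr (3 + ?q)" .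
      have "\<bar>?E h\<bar> = norm h powr ?q * \<bar>?P h - ?Q h\<bar>"
        using True by (simp add: right_diff_distrib[symmetric] abs_mult)
      with a show ?thesis using True by simp
    next
      case False
      have "\<bar>?P h\<bar> \<le> nrm w * nrm (?D h)" by (rule ip_Cauchy_Schwarz[OF wL DL])
      also have "\<dots> \<le> nrm w * C" by (intro mult_left_mono C(3)) simp
      finally have "norm h powr ?q * \<bar>?P h\<bar> \<le> norm h powr ?q * (nrm w * C)" by (rule mult_left_mono) simp
      then show ?thesis using False by (simp add: abs_mult mult_ac)
    qed
    have iG: "integrable lborel ?G" using i3(1) it(1) by simp
    have "gag s w \<phi> + mom TYPE('n) 2 s / ?n * ip w (Lap \<phi>) = - (LINT h|lborel. ?E h)"
      unfolding g IQ[symmetric] Bochner_Integration.integral_diff[OF iP iQ] by simp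
    then have "\<bar>gag s w \<phi> + mom TYPE('n) 2 s / ?n * ip w (Lap \<phi>)\<bar> \<le> (LINT h|lborel. \<bar>?E h\<bar>)"
      using integral_norm_bound[of lborel ?E] by simp
    also have "\<dots> \<le> (LINT h|lborel. ?G h)" by (rule integral_mono[OF integrable_abs[OF iE] iG EG])
    also have "\<dots> = C * nrm w * mom TYPE('n) 3 s + C * nrm w * tail TYPE('n) s"
      using i3 it by simp
    also have "\<dots> \<le> C * nrm w * (defect s * mom TYPE('n) 2 s) + C * nrm w * (defect s * mom TYPE('n) 2 s)"
      using C(1) by (intro add_mono mult_left_mono moments(5,6) s) auto
    finally show ?thesis by (simp add: mult_ac)
  qed
  then show ?thesis using C(1) by (intro exI[of _ "2 * C"]) auto
qed


section \<open>The normalization\<close>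

lemma ip_Lap:
  assumes "\<phi> \<in> test_functions UNIV"
  shows "ip \<phi> (Lap \<phi>) = - (\<Sum>i\<in>UNIV. (nrm (partial_deriv i \<phi>))\<^sup>2)"
proof -
  note d = test_functions_partial[OF assms]
  have "ip \<phi> (Lap \<phi>) = ip (\<lambda>x. \<Sum>i\<in>UNIV. partial_deriv i (partial_deriv i \<phi>) x) \<phi>"
    by (simp add: Lap_def[abs_def] ip_commute)
  also have "\<dots> = (\<Sum>i\<in>UNIV. ip (partial_deriv i (partial_deriv i \<phi>)) \<phi>)"
    by (rule ip_sum_left[OF finite test_functions_L2[OF test_functions_partial[OF d]] test_functions_L2[OF assms]])
  also have "\<dots> = (\<Sum>i\<in>UNIV. - (nrm (partial_deriv i \<phi>))\<^sup>2)"
    using ip_partial_deriv[OF assms d] by (simp add: ip_commute[of _ \<phi>] nrm_sq)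
  finally show ?thesis by (simp add: sum_negf)
qed

lemma test_function_nrm_zero:
  fixes \<phi> :: "real^'n \<Rightarrow> real"
  assumes \<phi>: "\<phi> \<in> test_functions UNIV" and z: "nrm \<phi> = 0"
  shows "\<phi> x = 0"
proof -
  have m: "{x \<in> space lborel. \<not> \<phi> x = 0} \<in> sets lborel"
    using test_functions_measurable[OF \<phi>] by simp
  have "AE x in lborel. \<phi> x = 0" by (rule nrm_eq_0_AE[OF test_functions_L2[OF \<phi>] z])
  then have "{x \<in> space lborel. \<not> \<phi> x = 0} \<in> null_sets lborel" using AE_iff_null[OF m] by simp
  then have "negligible {x. \<phi> x \<noteq> 0}" by (simp add: negligible_iff_null_sets null_sets_completionI)
  moreover have "open {x. \<phi> x \<noteq> 0}"
    by (intro open_Collect_neq continuous_intros smooth_fun_continuous test_functions_smooth[OF \<phi>])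
  ultimately have "{x. \<phi> x \<noteq> 0} = {}" using open_not_negligible by blast
  then show ?thesis by blast
qed

text \<open>A bump that is positive at a point of \<Omega> cannot have a vanishing gradient: it
  would be constant, and compact support makes this constant 0. The function serves as a probe for
  the normalization constants.\<close>

lemma ex_test_gradient_pos:
  fixes \<Omega> :: "(real^'n) set"
  assumes "open \<Omega>" "\<Omega> \<noteq> {}"
  shows "\<exists>\<psi>\<in>test_functions \<Omega>. (\<Sum>i\<in>UNIV. (nrm (partial_deriv i \<psi>))\<^sup>2) > 0"
proof -
  obtain p where p: "p \<in> \<Omega>" using assms(2) by blast
  obtain r \<psi> where r: "r > 0" and \<psi>: "\<psi> \<in> test_functions \<Omega>" "\<forall>x\<in>ball p r. \<psi> x > 0"
    using ex_bump_in[OF assms(1) p] by blast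
  note \<psi>' = test_functions_UNIV[OF \<psi>(1)]
  have pos: "\<psi> p > 0" using \<psi>(2) r by simp
  have "(\<Sum>i\<in>UNIV. (nrm (partial_deriv i \<psi>))\<^sup>2) \<noteq> 0"
  proof
    assume "(\<Sum>i\<in>UNIV. (nrm (partial_deriv i \<psi>))\<^sup>2) = 0"
    then have "nrm (partial_deriv i \<psi>) = 0" for i by (simp add: sum_nonneg_eq_0_iff)
    then have d: "partial_deriv i \<psi> x = 0" for i x
      by (rule test_function_nrm_zero[OF test_functions_partial[OF \<psi>']])
    have mv: "\<exists>t>0. t < 1 \<and> \<psi> (p + 1 *\<^sub>R h) - \<psi> (p + 0 *\<^sub>R h)
        = (1 - 0) * (\<Sum>i\<in>UNIV. h $ i * partial_deriv i \<psi> (p + t *\<^sub>R h))" for h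
      by (rule MVT2) (simp_all add: line_derivative[OF test_functions_smooth[OF \<psi>']])
    have c: "\<psi> (p + h) = \<psi> p" for h using mv[of h] by (auto simp: d)
    obtain R where R: "\<forall>x. norm x \<ge> R \<longrightarrow> \<psi> x = 0" using test_functions_support[OF \<psi>'] by blast
    obtain i :: 'n where True by blast
    have "norm (\<bar>R\<bar> *\<^sub>R axis i (1::real)) \<ge> R" by simp
    then have "\<psi> (p + (\<bar>R\<bar> *\<^sub>R axis i 1 - p)) = 0" using R by simp
    then show False unfolding c using pos by simp
  qed
  moreover have "(\<Sum>i\<in>UNIV. (nrm (partial_deriv i \<psi>))\<^sup>2) \<ge> 0" by (intro sum_nonneg) simp
  ultimately show ?thesis using \<psi>(1) by (intro bexI[of _ \<psi>]) auto
qed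

lemma L2_norm_weak_gradient_test:
  assumes "open \<Omega>" "bounded \<Omega>" "\<psi> \<in> test_functions \<Omega>"
  shows "(L2_norm \<Omega> (weak_gradient \<Omega> \<psi>))\<^sup>2 = (\<Sum>i\<in>UNIV. (nrm (partial_deriv i \<psi>))\<^sup>2)"
  using L2_norm_weak_gradient[OF assms(1,2) test_functions_L2[OF assms(3)] is_weak_gradient_test[OF assms(1,3)]]
  by simp

lemma H01_add_test:
  assumes \<Omega>: "open \<Omega>" and u: "u \<in> H01 \<Omega>" and \<psi>: "\<psi> \<in> test_functions \<Omega>"
  shows "(\<lambda>x. u x + t * \<psi> x) \<in> H01 \<Omega>"
proof -
  from u obtain g where uL: "u \<in> L2 \<Omega>" and g: "is_weak_gradient \<Omega> u g" by (auto simp: H01_def H1_def)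
  have "(\<lambda>x. u x + t * \<psi> x) \<in> L2 \<Omega>" by (rule L2_add[OF uL L2_cmult[OF test_functions_L2[OF \<psi>]]])
  moreover have "\<exists>g. is_weak_gradient \<Omega> (\<lambda>x. u x + t * \<psi> x) g"
    using is_weak_gradient_add[OF \<Omega> uL test_functions_L2[OF \<psi>] g is_weak_gradient_test[OF \<Omega> \<psi>]] by blast
  moreover have "\<exists>\<phi>\<in>test_functions \<Omega>. H1_norm \<Omega> (\<lambda>x. u x + t * \<psi> x - \<phi> x) < \<epsilon>" if e: "\<epsilon> > 0" for \<epsilon>
  proof -
    obtain \<phi> where \<phi>: "\<phi> \<in> test_functions \<Omega>" "H1_norm \<Omega> (\<lambda>x. u x - \<phi> x) < \<epsilon>"
      using u e by (auto simp: H01_def)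
    have "(\<lambda>x. \<phi> x + t * \<psi> x) \<in> test_functions \<Omega>"
      by (rule test_functions_add[OF \<phi>(1) test_functions_cmult[OF \<psi>]])
    moreover have "(\<lambda>x. u x + t * \<psi> x - (\<phi> x + t * \<psi> x)) = (\<lambda>x. u x - \<phi> x)" by auto
    ultimately show ?thesis using \<phi>(2) by (intro bexI[of _ "\<lambda>x. \<phi> x + t * \<psi> x"]) simp_all
  qed
  ultimately show ?thesis by (simp add: H01_def H1_def)
qed

lemma zero_H01:
  assumes "open \<Omega>" "bounded \<Omega>"
  shows "(\<lambda>x. 0) \<in> H01 \<Omega>"
proof -
  note z = test_functions_zero[of \<Omega>]
  have n0: "nrm (\<lambda>x. 0) = 0" by (simp add: nrm_def ip_zero_left)
  have "L2_norm \<Omega> (\<lambda>x. 0 :: real) = 0" using L2_norm_eq_nrm[of \<Omega> "\<lambda>x. 0"] assms(1) n0 by simp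
  then have "H1_norm \<Omega> (\<lambda>x. 0) = 0"
    using L2_norm_weak_gradient_test[OF assms z] n0 by (simp add: H1_norm_def)
  then show ?thesis
    using z is_weak_gradient_test[OF assms(1) z] by (auto simp: H01_def H1_def intro!: bexI[of _ "\<lambda>x. 0"])
qed

lemma test_H01:
  assumes "open \<Omega>" "bounded \<Omega>" "\<psi> \<in> test_functions \<Omega>"
  shows "\<psi> \<in> H01 \<Omega>"
  using H01_add_test[OF assms(1) zero_H01[OF assms(1,2)] assms(3), of 1] by simp

text \<open>The factor in front of - \<open>ip w (Lap \<phi>)\<close> when
  \<open>C s / 2 * gag s w \<phi>\<close> is expanded for s close to 1.\<close>

definition normalized_mom :: "(real \<Rightarrow> real) \<Rightarrow> 'n::finite itself \<Rightarrow> real \<Rightarrow> real" where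
  "normalized_mom C n s = C s * mom n 2 s / (2 * real CARD('n))"

text \<open>The error is stated relative to \<open>normalized_mom\<close>: before this factor is
  known to converge there is no other control on C, and in this form the estimate can be used to
  determine the limit of the factor itself.\<close>

lemma energy_pairing:
  fixes \<phi> :: "real^'n \<Rightarrow> real"
  assumes \<phi>: "\<phi> \<in> test_functions UNIV" and C: "\<And>s. 0 < s \<Longrightarrow> s < 1 \<Longrightarrow> C s > 0"
  shows "\<exists>k>0. \<forall>s w. 1 / 2 \<le> s \<longrightarrow> s < 1 \<longrightarrow> w \<in> Hs s \<longrightarrow>
    \<bar>C s / 2 * gag s w \<phi> + normalized_mom C TYPE('n) s * ip w (Lap \<phi>)\<bar>
      \<le> normalized_mom C TYPE('n) s * (k * defect s) * nrm w"
proof -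
  let ?n = "real CARD('n)"
  obtain c where c: "c > 0" "\<And>s w. 1 / 2 \<le> s \<Longrightarrow> s < 1 \<Longrightarrow> w \<in> Hs s \<Longrightarrow>
    \<bar>gag s w \<phi> + mom TYPE('n) 2 s / ?n * ip w (Lap \<phi>)\<bar> \<le> c * defect s * mom TYPE('n) 2 s * nrm w"
    using gag_test_function[OF \<phi>] by blast
  have "\<bar>C s / 2 * gag s w \<phi> + normalized_mom C TYPE('n) s * ip w (Lap \<phi>)\<bar>
      \<le> normalized_mom C TYPE('n) s * ((?n * c) * defect s) * nrm w"
    if s: "1 / 2 \<le> s" "s < 1" and w: "w \<in> Hs s" for s w
  proof -
    have Cs: "C s > 0" using C s by simp
    have n: "?n > 0" by simp
    have E: "C s / 2 * gag s w \<phi> + normalized_mom C TYPE('n) s * ip w (Lap \<phi>)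
        = C s / 2 * (gag s w \<phi> + mom TYPE('n) 2 s / ?n * ip w (Lap \<phi>))"
      by (simp add: normalized_mom_def field_simps)
    have "\<bar>C s / 2 * gag s w \<phi> + normalized_mom C TYPE('n) s * ip w (Lap \<phi>)\<bar>
        = C s / 2 * \<bar>gag s w \<phi> + mom TYPE('n) 2 s / ?n * ip w (Lap \<phi>)\<bar>"
      unfolding E abs_mult using Cs by simp
    also have "\<dots> \<le> C s / 2 * (c * defect s * mom TYPE('n) 2 s * nrm w)"
      using Cs by (intro mult_left_mono c s w) simp
    also have "\<dots> = normalized_mom C TYPE('n) s * ((?n * c) * defect s) * nrm w"
      using n by (simp add: normalized_mom_def)
    finally show ?thesis .
  qed
  then show ?thesis using c(1) by (intro exI[of _ "?n * c"]) auto
qed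

lemma eventually_half_one: "\<forall>\<^sub>F s in at_left (1::real). 1 / 2 \<le> s \<and> s < 1"
  unfolding eventually_at_left_field by (intro exI[of _ "1 / 2"]) auto

lemma energy_test_squeeze:
  fixes \<phi> :: "real^'n \<Rightarrow> real"
  assumes \<phi>: "\<phi> \<in> test_functions UNIV" and C: "\<And>s. 0 < s \<Longrightarrow> s < 1 \<Longrightarrow> C s > 0"
  defines "D \<equiv> \<Sum>i\<in>UNIV. (nrm (partial_deriv i \<phi>))\<^sup>2"
  shows "\<exists>k\<ge>0. \<forall>s. 1 / 2 \<le> s \<longrightarrow> s < 1 \<longrightarrow>
    \<bar>energy C s \<phi> - normalized_mom C TYPE('n) s * D\<bar> \<le> normalized_mom C TYPE('n) s * (k * defect s)"
proof -
  obtain k where k: "k > 0" "\<And>s w. 1 / 2 \<le> s \<Longrightarrow> s < 1 \<Longrightarrow> w \<in> Hs s \<Longrightarrow>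
    \<bar>C s / 2 * gag s w \<phi> + normalized_mom C TYPE('n) s * ip w (Lap \<phi>)\<bar>
      \<le> normalized_mom C TYPE('n) s * (k * defect s) * nrm w"
    using energy_pairing[where C = C, OF \<phi> C] by blast
  have "\<bar>energy C s \<phi> - normalized_mom C TYPE('n) s * D\<bar> \<le> normalized_mom C TYPE('n) s * ((k * nrm \<phi>) * defect s)"
    if s: "1 / 2 \<le> s" "s < 1" for s
    using k(2)[OF s test_functions_Hs[OF \<phi> s]] unfolding ip_Lap[OF \<phi>] energy_gag D_def by (simp add: mult_ac)
  then show ?thesis using k(1) by (intro exI[of _ "k * nrm \<phi>"]) auto
qed

text \<open>For a probe with Dirichlet integral D > 0 the pairing estimate is solved for m =
  \<open>normalized_mom\<close>: m lies between energy / (D + k * defect) and energy / (D - k *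
  defect). The normalization sends the energy to D, and the defect tends to 0.\<close>

lemma normalized_mom_tendsto:
  fixes \<Omega> :: "(real^'n) set"
  assumes \<Omega>: "open \<Omega>" "bounded \<Omega>" "\<Omega> \<noteq> {}" and BBM: "BBM_normalized \<Omega> C"
  shows "(normalized_mom C TYPE('n) \<longlongrightarrow> 1) (at_left 1)"
proof -
  have C: "\<And>s. 0 < s \<Longrightarrow> s < 1 \<Longrightarrow> C s > 0" using BBM by (auto simp: BBM_normalized_def)
  obtain \<psi> where \<psi>: "\<psi> \<in> test_functions \<Omega>" and pos: "(\<Sum>i\<in>UNIV. (nrm (partial_deriv i \<psi>))\<^sup>2) > 0"
    using ex_test_gradient_pos[OF \<Omega>(1,3)] by blast
  define D where "D = (\<Sum>i\<in>UNIV. (nrm (partial_deriv i \<psi>))\<^sup>2)"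
  have D: "D > 0" using pos by (simp add: D_def)
  let ?m = "normalized_mom C TYPE('n)"
  have E: "((\<lambda>s. energy C s \<psi>) \<longlongrightarrow> D) (at_left 1)"
    using BBM test_H01[OF \<Omega>(1,2) \<psi>] L2_norm_weak_gradient_test[OF \<Omega>(1,2) \<psi>]
    by (auto simp: BBM_normalized_def D_def)
  obtain k where k: "k \<ge> 0" "\<And>s. 1 / 2 \<le> s \<Longrightarrow> s < 1 \<Longrightarrow> \<bar>energy C s \<psi> - ?m s * D\<bar> \<le> ?m s * (k * defect s)"
    using energy_test_squeeze[where C = C, OF test_functions_UNIV[OF \<psi>] C] unfolding D_def by blast
  have kd: "((\<lambda>s. k * defect s) \<longlongrightarrow> k * 0) (at_left 1)" by (intro tendsto_intros defect_tendsto)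
  have lo: "((\<lambda>s. energy C s \<psi> / (D + k * defect s)) \<longlongrightarrow> D / (D + k * 0)) (at_left 1)"
    by (intro tendsto_divide E tendsto_add tendsto_const kd) (use D in simp)
  have hi: "((\<lambda>s. energy C s \<psi> / (D - k * defect s)) \<longlongrightarrow> D / (D - k * 0)) (at_left 1)"
    by (intro tendsto_divide E tendsto_diff tendsto_const kd) (use D in simp)
  have small: "\<forall>\<^sub>F s in at_left 1. \<bar>k * defect s\<bar> < D"
    using order_tendstoD(2)[OF tendsto_rabs[OF kd], of D] D by simp
  have "\<forall>\<^sub>F s in at_left 1. energy C s \<psi> / (D + k * defect s) \<le> ?m s"
    using small eventually_half_one
  proof eventually_elim
    case (elim s)
    then have "energy C s \<psi> \<le> ?m s * (D + k * defect s)" "D + k * defect s > 0"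
      using k(2)[of s] by (auto simp: distrib_left)
    then show ?case by (simp add: pos_divide_le_eq)
  qed
  moreover have "\<forall>\<^sub>F s in at_left 1. ?m s \<le> energy C s \<psi> / (D - k * defect s)"
    using small eventually_half_one
  proof eventually_elim
    case (elim s)
    then have "?m s * (D - k * defect s) \<le> energy C s \<psi>" "D - k * defect s > 0"
      using k(2)[of s] by (auto simp: right_diff_distrib)
    then show ?case by (simp add: pos_le_divide_eq)
  qed
  ultimately show ?thesis
    by (rule tendsto_sandwich) (use lo hi D in simp_all)
qed

text \<open>The normalization speaks of H_0^1(\<Omega>) only. The limit of
  \<open>normalized_mom\<close> carries it over to test functions whose support leaves
  \<Omega>.\<close>

lemma energy_test_tendsto:
  fixes \<phi> :: "real^'n \<Rightarrow> real"
  assumes \<phi>: "\<phi> \<in> test_functions UNIV" and C: "\<And>s. 0 < s \<Longrightarrow> s < 1 \<Longrightarrow> C s > 0"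
    and m: "(normalized_mom C TYPE('n) \<longlongrightarrow> 1) (at_left 1)"
  shows "((\<lambda>s. energy C s \<phi>) \<longlongrightarrow> (\<Sum>i\<in>UNIV. (nrm (partial_deriv i \<phi>))\<^sup>2)) (at_left 1)"
proof -
  let ?m = "normalized_mom C TYPE('n)"
  define D where "D = (\<Sum>i\<in>UNIV. (nrm (partial_deriv i \<phi>))\<^sup>2)"
  obtain k where k: "k \<ge> 0" "\<And>s. 1 / 2 \<le> s \<Longrightarrow> s < 1 \<Longrightarrow> \<bar>energy C s \<phi> - ?m s * D\<bar> \<le> ?m s * (k * defect s)"
    using energy_test_squeeze[where C = C, OF \<phi> C] unfolding D_def by blast
  have "((\<lambda>s. ?m s * (k * defect s)) \<longlongrightarrow> 1 * (k * 0)) (at_left 1)"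
    by (intro tendsto_intros m defect_tendsto)
  then have z: "((\<lambda>s. ?m s * (k * defect s)) \<longlongrightarrow> 0) (at_left 1)" by simp
  have "((\<lambda>s. energy C s \<phi> - ?m s * D) \<longlongrightarrow> 0) (at_left 1)"
    by (rule Lim_null_comparison[OF _ z]) (use eventually_half_one k(2) in \<open>auto elim: eventually_mono\<close>)
  then have "((\<lambda>s. (energy C s \<phi> - ?m s * D) + ?m s * D) \<longlongrightarrow> 0 + 1 * D) (at_left 1)"
    by (intro tendsto_intros m)
  then show ?thesis by (simp add: D_def)
qed

section \<open>Euler--Lagrange equations\<close>

lemma nrm_expand:
  assumes "u \<in> L2 A" "v \<in> L2 B"
  shows "(nrm (\<lambda>x. u x + t * v x))\<^sup>2 = (nrm u)\<^sup>2 + 2 * t * ip u v + t\<^sup>2 * (nrm v)\<^sup>2"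
proof -
  note u = L2_UNIV[OF assms(1)] and v = L2_UNIV[OF assms(2)]
  have "ip (\<lambda>x. u x + t * v x) w = ip u w + t * ip v w" if "w \<in> L2 UNIV" for w
    using ip_add_left[OF u L2_cmult[OF v] that, of t] by (simp add: ip_cmult_left)
  note l = this
  have "ip (\<lambda>x. u x + t * v x) (\<lambda>x. u x + t * v x) = ip u (\<lambda>x. u x + t * v x) + t * ip v (\<lambda>x. u x + t * v x)"
    by (rule l[OF L2_add[OF u L2_cmult[OF v]]])
  also have "\<dots> = (ip u u + t * ip v u) + t * (ip u v + t * ip v v)"
    unfolding ip_commute[of u "\<lambda>x. u x + t * v x"] ip_commute[of v "\<lambda>x. u x + t * v x"] l[OF u] l[OF v] ..
  finally show ?thesis unfolding nrm_sq by (simp add: ip_commute[of v u] power2_eq_square algebra_simps)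
qed

text \<open>A near-minimizer of \<open>\<parallel>f\<parallel>\<^sup>2 / 2 - l f\<close> represents \<open>l\<close> approximately, which avoids completeness.\<close>

lemma approx_riesz:
  fixes l :: "(real^'n \<Rightarrow> real) \<Rightarrow> real"
  assumes add: "\<And>u v t. u \<in> L2 \<Omega> \<Longrightarrow> v \<in> L2 \<Omega> \<Longrightarrow> l (\<lambda>x. u x + t * v x) = l u + t * l v"
    and bd: "\<And>w. w \<in> L2 \<Omega> \<Longrightarrow> \<bar>l w\<bar> \<le> M * nrm w" and e: "\<epsilon> > 0"
  shows "\<exists>f\<in>L2 \<Omega>. \<forall>w\<in>L2 \<Omega>. \<bar>l w - ip f w\<bar> \<le> \<epsilon> * nrm w"
proof -
  define Q where "Q = (\<lambda>v. (nrm v)\<^sup>2 / 2 - l v)"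
  have low: "- (M\<^sup>2 / 2) \<le> Q v" if "v \<in> L2 \<Omega>" for v
  proof -
    have "l v \<le> M * nrm v" using bd[OF that] by linarith
    moreover have "2 * M * nrm v \<le> M\<^sup>2 + (nrm v)\<^sup>2" by (rule sum_squares_bound)
    ultimately show ?thesis unfolding Q_def by linarith
  qed
  have bb: "bdd_below (Q ` L2 \<Omega>)" using low by (auto intro!: bdd_belowI2)
  define I where "I = Inf (Q ` L2 \<Omega>)"
  have I: "I \<le> Q v" if "v \<in> L2 \<Omega>" for v unfolding I_def by (rule cINF_lower[OF bb that])
  have "I < I + \<epsilon>\<^sup>2 / 2" using e by simp
  then have "\<exists>v\<in>L2 \<Omega>. Q v < I + \<epsilon>\<^sup>2 / 2"
    unfolding I_def using cINF_less_iff[OF _ bb] L2_zero by blast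
  then obtain f where f: "f \<in> L2 \<Omega>" "Q f < I + \<epsilon>\<^sup>2 / 2" by blast
  have "\<bar>l w - ip f w\<bar> \<le> \<epsilon> * nrm w" if w: "w \<in> L2 \<Omega>" for w
  proof -
    have "\<epsilon>\<^sup>2 + 2 * t * (ip f w - l w) + t\<^sup>2 * (nrm w)\<^sup>2 \<ge> 0" for t
    proof -
      \<comment> \<open>Near-minimality of f against f + t w, doubled, is a nonnegative quadratic
        polynomial in t with constant term \<open>\<epsilon>\<^sup>2\<close>; its discriminant is
        the claim.\<close>
      have "Q f - \<epsilon>\<^sup>2 / 2 \<le> Q (\<lambda>x. f x + t * w x)"
        using f(2) I[OF L2_add[OF f(1) L2_cmult[OF w]], of t] by linarith
      also have "\<dots> = ((nrm f)\<^sup>2 + 2 * t * ip f w + t\<^sup>2 * (nrm w)\<^sup>2) / 2 - (l f + t * l w)"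
        unfolding Q_def nrm_expand[OF f(1) w] add[OF f(1) w] ..
      finally show ?thesis unfolding Q_def by (simp add: algebra_simps)
    qed
    then have "(ip f w - l w)\<^sup>2 \<le> \<epsilon>\<^sup>2 * (nrm w)\<^sup>2" by (rule discriminant_le) simp
    then have "\<bar>l w - ip f w\<bar>\<^sup>2 \<le> (\<epsilon> * nrm w)\<^sup>2" by (simp add: power_mult_distrib power2_commute)
    then show ?thesis by (rule power2_le_imp_le) (use e in simp)
  qed
  with f(1) show ?thesis by blast
qed

lemma bounded_linear_L2D:
  fixes \<Omega> :: "(real^'n) set"
  assumes K: "bounded_linear_L2 \<Omega> K" and \<Omega>: "open \<Omega>"
  shows "u \<in> L2 \<Omega> \<Longrightarrow> K u \<in> L2 \<Omega>"
    and "u \<in> L2 \<Omega> \<Longrightarrow> v \<in> L2 \<Omega> \<Longrightarrow> AE x in lborel. K (\<lambda>x. u x + t * v x) x = K u x + t * K v x"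
    and "\<exists>B\<ge>0. \<forall>u\<in>L2 \<Omega>. nrm (K u) \<le> B * nrm u"
proof -
  note K' = K[unfolded bounded_linear_L2_def]
  show K1: "K u \<in> L2 \<Omega>" if "u \<in> L2 \<Omega>" for u using K' that by blast
  show "AE x in lborel. K (\<lambda>x. u x + t * v x) x = K u x + t * K v x" if uv: "u \<in> L2 \<Omega>" "v \<in> L2 \<Omega>"
  proof -
    have "AE x in lborel. K (\<lambda>x. u x + t * v x) x = K u x + K (\<lambda>x. t * v x) x"
      using K'[THEN conjunct2, THEN conjunct1, THEN bspec, THEN bspec, OF uv(1) L2_cmult[OF uv(2)]] .
    moreover have "AE x in lborel. K (\<lambda>x. t * v x) x = t * K v x"
      using K'[THEN conjunct2, THEN conjunct2, THEN conjunct1, THEN spec, THEN bspec, OF uv(2)] .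
    ultimately show ?thesis by eventually_elim simp
  qed
  obtain B where B: "\<And>u. u \<in> L2 \<Omega> \<Longrightarrow> L2_norm \<Omega> (K u) \<le> B * L2_norm \<Omega> u" using K' by blast
  have "nrm (K u) \<le> \<bar>B\<bar> * nrm u" if u: "u \<in> L2 \<Omega>" for u
  proof -
    have "nrm (K u) \<le> B * nrm u"
      using B[OF u] L2_norm_eq_nrm[OF _ u] L2_norm_eq_nrm[OF _ K1[OF u]] \<Omega> by simp
    also have "\<dots> \<le> \<bar>B\<bar> * nrm u" by (rule mult_right_mono) simp_all
    finally show ?thesis .
  qed
  then show "\<exists>B\<ge>0. \<forall>u\<in>L2 \<Omega>. nrm (K u) \<le> B * nrm u" by (intro exI[of _ "\<bar>B\<bar>"]) auto
qed

text \<open>The regularizing energy along u + t v enters only through its coefficients e0, e1, e2,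
  so both functionals are covered. Minimality at t = 0 makes a quadratic polynomial without constant
  term nonnegative, which forces its linear coefficient to vanish.\<close>

lemma Euler_Lagrange:
  fixes \<Omega> :: "(real^'n) set"
  assumes K: "bounded_linear_L2 \<Omega> K" and \<Omega>: "open \<Omega>" and y: "y \<in> L2 \<Omega>"
    and u: "u \<in> L2 \<Omega>" and v: "v \<in> L2 \<Omega>" and \<alpha>: "\<alpha> > 0" and e2: "e2 \<ge> 0"
    and min: "\<And>t. 1/2 * (L2_norm \<Omega> (\<lambda>x. K u x - y x))\<^sup>2 + \<alpha>/2 * ((L2_norm \<Omega> u)\<^sup>2 + e0)
      \<le> 1/2 * (L2_norm \<Omega> (\<lambda>x. K (\<lambda>x. u x + t * v x) x - y x))\<^sup>2
        + \<alpha>/2 * ((L2_norm \<Omega> (\<lambda>x. u x + t * v x))\<^sup>2 + (e0 + 2 * t * e1 + t\<^sup>2 * e2))"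
  shows "ip (\<lambda>x. K u x - y x) (K v) + \<alpha> * (ip u v + e1) = 0"
proof -
  note KL = bounded_linear_L2D(1)[OF K \<Omega>]
  have \<Omega>b: "\<Omega> \<in> sets borel" using \<Omega> by simp
  let ?r = "\<lambda>x. K u x - y x"
  have r: "?r \<in> L2 \<Omega>" by (rule L2_diff[OF KL[OF u] y])
  have uv: "(\<lambda>x. u x + t * v x) \<in> L2 \<Omega>" for t by (rule L2_add[OF u L2_cmult[OF v]])
  have rt: "(L2_norm \<Omega> (\<lambda>x. K (\<lambda>x. u x + t * v x) x - y x))\<^sup>2
      = (nrm ?r)\<^sup>2 + 2 * t * ip ?r (K v) + t\<^sup>2 * (nrm (K v))\<^sup>2" for t
  proof -
    have L: "(\<lambda>x. K (\<lambda>x. u x + t * v x) x - y x) \<in> L2 \<Omega>" by (rule L2_diff[OF KL[OF uv] y])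
    have L': "(\<lambda>x. ?r x + t * K v x) \<in> L2 \<Omega>" by (rule L2_add[OF r L2_cmult[OF KL[OF v]]])
    have "AE x in lborel. K (\<lambda>x. u x + t * v x) x - y x = ?r x + t * K v x"
      using bounded_linear_L2D(2)[OF K \<Omega> u v, of t] by eventually_elim simp
    then have "nrm (\<lambda>x. K (\<lambda>x. u x + t * v x) x - y x) = nrm (\<lambda>x. ?r x + t * K v x)"
      by (rule nrm_cong_AE[OF _ L2_measurable[OF L] L2_measurable[OF L']])
    then show ?thesis unfolding L2_norm_eq_nrm[OF \<Omega>b L] by (simp only: nrm_expand[OF r KL[OF v]])
  qed
  let ?b = "ip ?r (K v) + \<alpha> * (ip u v + e1)"
  let ?c = "(nrm (K v))\<^sup>2 + \<alpha> * ((nrm v)\<^sup>2 + e2)"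
  have "0 + 2 * t * ?b + t\<^sup>2 * ?c \<ge> 0" for t
    using min[of t] unfolding rt L2_norm_eq_nrm[OF \<Omega>b uv] L2_norm_eq_nrm[OF \<Omega>b u] L2_norm_eq_nrm[OF \<Omega>b r]
      nrm_expand[OF u v] by (simp add: algebra_simps)
  then have "?b\<^sup>2 \<le> 0 * ?c" by (rule discriminant_le) (use \<alpha> e2 in simp)
  then show ?thesis by simp
qed

lemma is_arg_min_le:
  "is_arg_min J (\<lambda>v. v \<in> L2 \<Omega>) u \<Longrightarrow> v \<in> L2 \<Omega> \<Longrightarrow> (J u :: ereal) \<le> J v"
  unfolding is_arg_min_def by (meson not_less)

text \<open>Comparison with the zero function shows that the minimum is finite. Variations run along
  test functions of \<Omega>, the class in which \<open>approx_Lap\<close> reads the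
  equation.\<close>

lemma J_one_minimizer:
  fixes \<Omega> :: "(real^'n) set"
  assumes K: "bounded_linear_L2 \<Omega> K" and \<Omega>: "open \<Omega>" "bounded \<Omega>" and y: "y \<in> L2 \<Omega>" and \<alpha>: "\<alpha> > 0"
    and min: "is_arg_min (J_one \<Omega> K y \<alpha>) (\<lambda>v. v \<in> L2 \<Omega>) u"
  shows "u \<in> H01 \<Omega>"
    and "is_weak_gradient \<Omega> u g \<Longrightarrow> \<psi> \<in> test_functions \<Omega> \<Longrightarrow>
      ip (\<lambda>x. K u x - y x) (K \<psi>) + \<alpha> * (ip u \<psi> + (\<Sum>i\<in>UNIV. ip (\<lambda>x. g x $ i) (partial_deriv i \<psi>))) = 0"
proof -
  note le = is_arg_min_le[OF min]
  have uL: "u \<in> L2 \<Omega>" using min by (simp add: is_arg_min_def)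
  show u: "u \<in> H01 \<Omega>"
  proof (rule ccontr)
    assume "u \<notin> H01 \<Omega>"
    then have "J_one \<Omega> K y \<alpha> u = \<infinity>" by (simp add: J_one_def)
    moreover have "J_one \<Omega> K y \<alpha> (\<lambda>x. 0) \<noteq> \<infinity>" using zero_H01[OF \<Omega>] by (simp add: J_one_def)
    ultimately show False using le[OF L2_zero] by simp
  qed
  assume g: "is_weak_gradient \<Omega> u g" and \<psi>: "\<psi> \<in> test_functions \<Omega>"
  have gL: "(\<lambda>x. g x $ i) \<in> L2 \<Omega>" for i using g by (simp add: is_weak_gradient_def)
  note \<psi>L = test_functions_L2[OF \<psi>]
  let ?d = "\<lambda>i. partial_deriv i \<psi>"
  note dL = test_functions_L2[OF test_functions_partial[OF \<psi>]]
  have grad: "(L2_norm \<Omega> (weak_gradient \<Omega> (\<lambda>x. u x + t * \<psi> x)))\<^sup>2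
      = (\<Sum>i\<in>UNIV. (nrm (\<lambda>x. g x $ i))\<^sup>2) + 2 * t * (\<Sum>i\<in>UNIV. ip (\<lambda>x. g x $ i) (?d i)) + t\<^sup>2 * (\<Sum>i\<in>UNIV. (nrm (?d i))\<^sup>2)" for t
  proof -
    have uL': "(\<lambda>x. u x + t * \<psi> x) \<in> L2 \<Omega>" by (rule L2_add[OF uL L2_cmult[OF \<psi>L]])
    have "(L2_norm \<Omega> (weak_gradient \<Omega> (\<lambda>x. u x + t * \<psi> x)))\<^sup>2
        = (\<Sum>i\<in>UNIV. (nrm (\<lambda>x. g x $ i + t * ?d i x))\<^sup>2)"
      using L2_norm_weak_gradient[OF \<Omega> uL' is_weak_gradient_add[OF \<Omega>(1) uL \<psi>L g is_weak_gradient_test[OF \<Omega>(1) \<psi>]]]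
      by simp
    then show ?thesis unfolding nrm_expand[OF gL dL] by (simp add: sum.distrib sum_distrib_left)
  qed
  show "ip (\<lambda>x. K u x - y x) (K \<psi>) + \<alpha> * (ip u \<psi> + (\<Sum>i\<in>UNIV. ip (\<lambda>x. g x $ i) (?d i))) = 0"
  proof (rule Euler_Lagrange[OF K \<Omega>(1) y uL \<psi>L \<alpha>])
    show "(\<Sum>i\<in>UNIV. (nrm (?d i))\<^sup>2) \<ge> 0" by (intro sum_nonneg) simp
    fix t
    have "J_one \<Omega> K y \<alpha> u \<le> J_one \<Omega> K y \<alpha> (\<lambda>x. u x + t * \<psi> x)"
      by (rule le[OF L2_add[OF uL L2_cmult[OF \<psi>L]]])
    then show "1/2 * (L2_norm \<Omega> (\<lambda>x. K u x - y x))\<^sup>2 + \<alpha>/2 * ((L2_norm \<Omega> u)\<^sup>2 + (\<Sum>i\<in>UNIV. (nrm (\<lambda>x. g x $ i))\<^sup>2))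
      \<le> 1/2 * (L2_norm \<Omega> (\<lambda>x. K (\<lambda>x. u x + t * \<psi> x) x - y x))\<^sup>2
        + \<alpha>/2 * ((L2_norm \<Omega> (\<lambda>x. u x + t * \<psi> x))\<^sup>2 + ((\<Sum>i\<in>UNIV. (nrm (\<lambda>x. g x $ i))\<^sup>2)
          + 2 * t * (\<Sum>i\<in>UNIV. ip (\<lambda>x. g x $ i) (?d i)) + t\<^sup>2 * (\<Sum>i\<in>UNIV. (nrm (?d i))\<^sup>2)))"
      using u H01_add_test[OF \<Omega>(1) u \<psi>, of t] unfolding J_one_def grad L2_norm_weak_gradient[OF \<Omega> uL g]
      by simp
  qed
qed

lemma H0s_L2: "u \<in> H0s s \<Omega> \<Longrightarrow> u \<in> L2 \<Omega>"
  unfolding H0s_def using Hs_L2[of u s] L2_iff[of u \<Omega>] by blast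

lemma H0s_Hs: "u \<in> H0s s \<Omega> \<Longrightarrow> u \<in> Hs s"
  by (simp add: H0s_def)

lemma H0s_I: "u \<in> Hs s \<Longrightarrow> u \<in> L2 \<Omega> \<Longrightarrow> u \<in> H0s s \<Omega>"
  by (simp add: H0s_def L2_def)

lemma test_H0s: "\<phi> \<in> test_functions \<Omega> \<Longrightarrow> 1 / 2 \<le> s \<Longrightarrow> s < 1 \<Longrightarrow> \<phi> \<in> H0s s \<Omega>"
  by (intro H0s_I test_functions_Hs test_functions_L2 test_functions_UNIV[of \<phi> \<Omega>])

lemma H0s_add: "u \<in> H0s s \<Omega> \<Longrightarrow> v \<in> H0s s \<Omega> \<Longrightarrow> (\<lambda>x. u x + c * v x) \<in> H0s s \<Omega>"
  by (rule H0s_I[OF Hs_add[OF H0s_Hs H0s_Hs] L2_add[OF H0s_L2 L2_cmult[OF H0s_L2]]])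

text \<open>Variations run over all of \<open>H0s s \<Omega>\<close>, because the equation will be
  tested with the minimizer itself minus a test function.\<close>

lemma J_frac_minimizer:
  fixes \<Omega> :: "(real^'n) set"
  assumes K: "bounded_linear_L2 \<Omega> K" and \<Omega>: "open \<Omega>" and y: "y \<in> L2 \<Omega>" and \<alpha>: "\<alpha> > 0"
    and s: "1 / 2 \<le> s" "s < 1" and C: "C s > 0"
    and min: "is_arg_min (J_frac \<Omega> K y C \<alpha> s) (\<lambda>v. v \<in> L2 \<Omega>) u"
  shows "u \<in> H0s s \<Omega>"
    and "w \<in> H0s s \<Omega> \<Longrightarrow>
      ip (\<lambda>x. K u x - y x) (K w) + \<alpha> * (ip u w + C s / 2 * gag s u w) = 0"
proof -
  note le = is_arg_min_le[OF min]
  show u: "u \<in> H0s s \<Omega>"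
  proof (rule ccontr)
    assume "u \<notin> H0s s \<Omega>"
    then have "J_frac \<Omega> K y C \<alpha> s u = \<infinity>" by (simp add: J_frac_def)
    moreover have "J_frac \<Omega> K y C \<alpha> s (\<lambda>x. 0) \<noteq> \<infinity>"
      using test_H0s[OF test_functions_zero s, of \<Omega>] by (simp add: J_frac_def)
    ultimately show False using le[OF L2_zero] by simp
  qed
  assume w: "w \<in> H0s s \<Omega>"
  note uL = H0s_L2[OF u] and wL = H0s_L2[OF w]
  have en: "energy C s (\<lambda>x. u x + t * w x)
      = energy C s u + 2 * t * (C s / 2 * gag s u w) + t\<^sup>2 * energy C s w" for t
    unfolding energy_gag gag_expand[OF H0s_Hs[OF u] H0s_Hs[OF w]] by (simp add: algebra_simps)
  show "ip (\<lambda>x. K u x - y x) (K w) + \<alpha> * (ip u w + C s / 2 * gag s u w) = 0"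
  proof (rule Euler_Lagrange[OF K \<Omega> y uL wL \<alpha>])
    show "energy C s w \<ge> 0" unfolding energy_gag using C gag_self_nonneg[of s w] by simp
    fix t
    have "J_frac \<Omega> K y C \<alpha> s u \<le> J_frac \<Omega> K y C \<alpha> s (\<lambda>x. u x + t * w x)"
      by (rule le[OF L2_add[OF uL L2_cmult[OF wL]]])
    then show "1/2 * (L2_norm \<Omega> (\<lambda>x. K u x - y x))\<^sup>2 + \<alpha>/2 * ((L2_norm \<Omega> u)\<^sup>2 + energy C s u)
      \<le> 1/2 * (L2_norm \<Omega> (\<lambda>x. K (\<lambda>x. u x + t * w x) x - y x))\<^sup>2
        + \<alpha>/2 * ((L2_norm \<Omega> (\<lambda>x. u x + t * w x))\<^sup>2
          + (energy C s u + 2 * t * (C s / 2 * gag s u w) + t\<^sup>2 * energy C s w))"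
      using u H0s_add[OF u w, of t] unfolding J_frac_def en by simp
  qed
qed


section \<open>Convergence of the minimizers\<close>

text \<open>A counterexample x would exceed \<epsilon>, since a \<ge> 1. Then the last term is at
  most b * \<epsilon> * x, and the right-hand side is at most (a + b) * \<epsilon> * x, which is
  below the square of x.\<close>

lemma quadratic_bound:
  fixes x a b \<epsilon> :: real
  assumes "x\<^sup>2 \<le> a * \<epsilon> * x + b * \<epsilon>\<^sup>2" "a \<ge> 1" "b \<ge> 0" "\<epsilon> > 0"
  shows "x \<le> (a + b) * \<epsilon>"
proof (rule ccontr)
  assume "\<not> x \<le> (a + b) * \<epsilon>"
  then have x: "x > (a + b) * \<epsilon>" by simp
  have "\<epsilon> \<le> (a + b) * \<epsilon>" using assms by simp
  then have x1: "\<epsilon> < x" "x > 0" using x assms(4) by linarith+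
  have "b * \<epsilon> * \<epsilon> \<le> b * \<epsilon> * x" using x1 assms by (intro mult_left_mono) auto
  moreover have "(a + b) * \<epsilon> * x < x * x" using x x1 by (intro mult_strict_right_mono)
  ultimately show False using assms(1) by (simp add: power2_eq_square algebra_simps)
qed

theorem theorem5p11:
  fixes \<Omega> :: "(real^'n) set"
    and K :: "(real^'n \<Rightarrow> real) \<Rightarrow> (real^'n \<Rightarrow> real)"
    and y :: "real^'n \<Rightarrow> real"
    and C :: "real \<Rightarrow> real"
    and \<alpha> :: real
    and u_frac :: "real \<Rightarrow> real^'n \<Rightarrow> real"
    and u_one :: "real^'n \<Rightarrow> real"
  assumes "bounded \<Omega>" and "lipschitz_domain \<Omega>"
    and "bounded_linear_L2 \<Omega> K"
    and "y \<in> L2 \<Omega>"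
    and "\<alpha> > 0"
    and "BBM_normalized \<Omega> C"
    and "\<And>s. 0 < s \<Longrightarrow> s < 1 \<Longrightarrow> is_unique_minimizer \<Omega> (J_frac \<Omega> K y C \<alpha> s) (u_frac s)"
    and "is_unique_minimizer \<Omega> (J_one \<Omega> K y \<alpha>) u_one"
  shows "((\<lambda>s. L2_norm \<Omega> (\<lambda>x. u_frac s x - u_one x)) \<longlongrightarrow> 0) (at_left 1)"
proof -
  note b = assms(1) and lip = assms(2) and K = assms(3) and y = assms(4) and \<alpha> = assms(5) and BBM = assms(6)
  have \<Omega>: "open \<Omega>" "\<Omega> \<noteq> {}" using lip by (simp_all add: lipschitz_domain_def)
  have \<Omega>b: "\<Omega> \<in> sets borel" using \<Omega>(1) by simp
  have C: "\<And>s. 0 < s \<Longrightarrow> s < 1 \<Longrightarrow> C s > 0" using BBM by (auto simp: BBM_normalized_def)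
  let ?m = "normalized_mom C TYPE('n)"
  note m1 = normalized_mom_tendsto[OF \<Omega>(1) b \<Omega>(2) BBM]
  note KL = bounded_linear_L2D(1)[OF K \<Omega>(1)]
  note Klin = bounded_linear_L2D(2)[OF K \<Omega>(1)]
  obtain B where B: "B \<ge> 0" "\<And>u. u \<in> L2 \<Omega> \<Longrightarrow> nrm (K u) \<le> B * nrm u"
    using bounded_linear_L2D(3)[OF K \<Omega>(1)] by blast
  have min1: "is_arg_min (J_one \<Omega> K y \<alpha>) (\<lambda>v. v \<in> L2 \<Omega>) u_one"
    using assms(8) by (simp add: is_unique_minimizer_def)
  have u1: "u_one \<in> H01 \<Omega>" by (rule J_one_minimizer(1)[OF K \<Omega>(1) b y \<alpha> min1])
  then obtain g where uL: "u_one \<in> L2 \<Omega>" and g: "is_weak_gradient \<Omega> u_one g" by (auto simp: H01_def H1_def)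
  have gL: "(\<lambda>x. g x $ i) \<in> L2 \<Omega>" for i using g by (simp add: is_weak_gradient_def)
  let ?r = "\<lambda>x. K u_one x - y x"
  have rL: "?r \<in> L2 \<Omega>" by (rule L2_diff[OF KL[OF uL] y])
  \<comment> \<open>The equation for \<open>u_one\<close>, divided by \<alpha>, says that
    \<open>l\<close> is the Laplacian of \<open>u_one\<close> as a functional; by boundedness of
    \<open>K\<close> it extends to all of \<open>L2 \<Omega>\<close>.\<close>
  define l where "l = (\<lambda>w. ip ?r (K w) / \<alpha> + ip u_one w)"
  have EL: "(\<Sum>i\<in>UNIV. ip (\<lambda>x. g x $ i) (partial_deriv i \<psi>)) = - l \<psi>" if "\<psi> \<in> test_functions \<Omega>" for \<psi>
    using J_one_minimizer(2)[OF K \<Omega>(1) b y \<alpha> min1 g that] \<alpha> by (simp add: l_def field_simps)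
  have l_add: "l (\<lambda>x. v x + t * w x) = l v + t * l w" if v: "v \<in> L2 \<Omega>" and w: "w \<in> L2 \<Omega>" for v w t
  proof -
    have vw: "(\<lambda>x. v x + t * w x) \<in> L2 \<Omega>" by (rule L2_add[OF v L2_cmult[OF w]])
    have Kvw: "(\<lambda>x. K v x + t * K w x) \<in> L2 \<Omega>" by (rule L2_add[OF KL[OF v] L2_cmult[OF KL[OF w]]])
    have "ip ?r (K (\<lambda>x. v x + t * w x)) = ip ?r (\<lambda>x. K v x + t * K w x)"
      by (rule ip_cong_AE[OF _ Klin[OF v w]])
         (use L2_measurable[OF rL] L2_measurable[OF KL[OF vw]] L2_measurable[OF Kvw] in simp_all)
    also have "\<dots> = ip ?r (K v) + t * ip ?r (K w)"
      using ip_add_right[OF KL[OF v] L2_cmult[OF KL[OF w]] rL] by (simp add: ip_cmult_right)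
    finally have 1: "ip ?r (K (\<lambda>x. v x + t * w x)) = ip ?r (K v) + t * ip ?r (K w)" .
    have 2: "ip u_one (\<lambda>x. v x + t * w x) = ip u_one v + t * ip u_one w"
      using ip_add_right[OF v L2_cmult[OF w] uL] by (simp add: ip_cmult_right)
    show ?thesis unfolding l_def 1 2 by (simp add: add_divide_distrib algebra_simps)
  qed
  have l_bound: "\<bar>l w\<bar> \<le> (nrm ?r * B / \<alpha> + nrm u_one) * nrm w" if w: "w \<in> L2 \<Omega>" for w
  proof -
    have "\<bar>ip ?r (K w)\<bar> \<le> nrm ?r * nrm (K w)" by (rule ip_Cauchy_Schwarz[OF rL KL[OF w]])
    also have "\<dots> \<le> nrm ?r * (B * nrm w)" by (rule mult_left_mono[OF B(2)[OF w] nrm_nonneg])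
    finally have "\<bar>ip ?r (K w)\<bar> / \<alpha> \<le> nrm ?r * (B * nrm w) / \<alpha>" using \<alpha> by (simp add: divide_right_mono)
    moreover have "\<bar>ip u_one w\<bar> \<le> nrm u_one * nrm w" by (rule ip_Cauchy_Schwarz[OF uL w])
    moreover have "\<bar>l w\<bar> \<le> \<bar>ip ?r (K w)\<bar> / \<alpha> + \<bar>ip u_one w\<bar>"
      unfolding l_def using abs_triangle_ineq[of "ip ?r (K w) / \<alpha>" "ip u_one w"] \<alpha> by simp
    ultimately show ?thesis by (simp add: algebra_simps)
  qed
  \<comment> \<open>The data term contributes B^2 / \<alpha>. The summand 3 collects one \<epsilon>
    from the distance of \<open>\<psi>\<close> to \<open>u_one\<close> and two from the pairing with
    \<open>\<phi>\<close>. The constant c bounds half of the energy of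
    \<open>\<psi> - \<phi>\<close>, which is below 4 N + 1 in units of \<epsilon>^2.\<close>
  define a where "a = B\<^sup>2 / \<alpha> + 3"
  define c where "c = 2 * real CARD('n) + 1"
  have a: "a \<ge> 1" using \<alpha> by (simp add: a_def)
  have c: "c \<ge> 0" by (simp add: c_def)
  \<comment> \<open>\<open>\<psi>\<close> and \<open>\<phi>\<close> depend on \<epsilon> alone. Only
    after they are fixed does s approach 1, so the constants attached to them, which may be large
    for small \<epsilon>, are harmless.\<close>
  have main: "\<forall>\<^sub>F s in at_left 1. L2_norm \<Omega> (\<lambda>x. u_frac s x - u_one x) \<le> (a + c + 1) * \<epsilon>" if e: "\<epsilon> > 0" for \<epsilon>
  proof -
    obtain \<psi> where \<psi>: "\<psi> \<in> test_functions \<Omega>" "nrm (\<lambda>x. u_one x - \<psi> x) < \<epsilon>"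
      "\<And>i. nrm (\<lambda>x. g x $ i - partial_deriv i \<psi> x) < \<epsilon>"
      using H01_approx[OF \<Omega>(1) b u1 g e] by blast
    have "\<exists>\<phi>\<in>test_functions UNIV. (\<forall>i. nrm (\<lambda>x. partial_deriv i \<phi> x - g x $ i) \<le> \<epsilon>) \<and>
        (\<forall>w\<in>L2 \<Omega>. \<bar>ip (Lap \<phi>) w - l w\<bar> \<le> \<epsilon> * nrm w)"
      by (rule approx_Lap[OF uL gL b H01_weak_gradient_UNIV[OF \<Omega>(1) b u1 g] EL lip approx_riesz[OF l_add l_bound] e])
    then obtain \<phi> where \<phi>: "\<phi> \<in> test_functions UNIV" "\<And>i. nrm (\<lambda>x. partial_deriv i \<phi> x - g x $ i) \<le> \<epsilon>"
      "\<And>w. w \<in> L2 \<Omega> \<Longrightarrow> \<bar>ip (Lap \<phi>) w - l w\<bar> \<le> \<epsilon> * nrm w" by blast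
    note \<psi>U = test_functions_UNIV[OF \<psi>(1)] and \<psi>L = test_functions_L2[OF \<psi>(1)]
    let ?d = "\<lambda>x. \<psi> x - \<phi> x"
    have dU: "?d \<in> test_functions UNIV" by (rule test_functions_diff[OF \<psi>U \<phi>(1)])
    define E where "E = (\<Sum>i\<in>UNIV. (nrm (partial_deriv i ?d))\<^sup>2)"
    \<comment> \<open>Both gradients lie within \<epsilon> of g.\<close>
    have "(nrm (partial_deriv i ?d))\<^sup>2 \<le> (2 * \<epsilon>)\<^sup>2" for i
    proof -
      have p: "partial_deriv i ?d = (\<lambda>x. partial_deriv i \<psi> x - partial_deriv i \<phi> x)"
      proof
        fix x
        have "partial_deriv i (\<lambda>x. \<psi> x + (-1) * \<phi> x) x = partial_deriv i \<psi> x + partial_deriv i (\<lambda>x. (-1) * \<phi> x) x"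
          by (intro partial_deriv_add smooth_fun_differentiable test_functions_smooth[OF \<psi>U]
              test_functions_smooth[OF test_functions_cmult[OF \<phi>(1)]])
        also have "partial_deriv i (\<lambda>x. (-1) * \<phi> x) x = - partial_deriv i \<phi> x"
          using partial_deriv_mult[of "\<lambda>x. -1" x \<phi> i] smooth_fun_differentiable[OF test_functions_smooth[OF \<phi>(1)]] by simp
        finally show "partial_deriv i ?d x = partial_deriv i \<psi> x - partial_deriv i \<phi> x" by simp
      qed
      have "nrm (partial_deriv i ?d) \<le> nrm (\<lambda>x. partial_deriv i \<psi> x - g x $ i) + nrm (\<lambda>x. g x $ i - partial_deriv i \<phi> x)"
        unfolding p
        by (rule nrm_triangle_sub[OF test_functions_L2[OF test_functions_partial[OF \<psi>U]] L2_UNIV[OF gL]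
            test_functions_L2[OF test_functions_partial[OF \<phi>(1)]]])
      also have "\<dots> \<le> 2 * \<epsilon>"
        using \<psi>(3)[of i] \<phi>(2)[of i] nrm_minus_commute[of "partial_deriv i \<psi>" "\<lambda>x. g x $ i"]
          nrm_minus_commute[of "partial_deriv i \<phi>" "\<lambda>x. g x $ i"] by linarith
      finally show ?thesis by (intro power_mono) auto
    qed
    then have "E \<le> (\<Sum>i\<in>(UNIV::'n set). (2 * \<epsilon>)\<^sup>2)" unfolding E_def by (rule sum_mono)
    then have E: "E \<le> 4 * real CARD('n) * \<epsilon>\<^sup>2" by (simp add: power_mult_distrib)
    have "((\<lambda>s. energy C s ?d) \<longlongrightarrow> E) (at_left 1)"
      unfolding E_def by (rule energy_test_tendsto[where C = C, OF dU C m1])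
    then have ev1: "\<forall>\<^sub>F s in at_left 1. energy C s ?d < E + \<epsilon>\<^sup>2" using e by (intro order_tendstoD(2)) auto
    obtain k where k: "k > 0" "\<And>s w. 1 / 2 \<le> s \<Longrightarrow> s < 1 \<Longrightarrow> w \<in> Hs s \<Longrightarrow>
      \<bar>C s / 2 * gag s w \<phi> + ?m s * ip w (Lap \<phi>)\<bar> \<le> ?m s * (k * defect s) * nrm w"
      using energy_pairing[where C = C, OF \<phi>(1) C] by blast
    \<comment> \<open>The first summand is the cost of replacing \<open>?m s\<close> by 1 in front
      of the Laplacian, the second the error of the pairing estimate.\<close>
    have "((\<lambda>s. \<bar>?m s - 1\<bar> * nrm (Lap \<phi>) + ?m s * (k * defect s)) \<longlongrightarrow> \<bar>1 - 1\<bar> * nrm (Lap \<phi>) + 1 * (k * 0)) (at_left 1)"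
      by (intro tendsto_intros m1 defect_tendsto)
    then have ev2: "\<forall>\<^sub>F s in at_left 1. \<bar>?m s - 1\<bar> * nrm (Lap \<phi>) + ?m s * (k * defect s) < \<epsilon>"
      using e by (intro order_tendstoD(2)) auto
    show ?thesis
      using ev1 ev2 eventually_half_one
    proof eventually_elim
      case (elim s)
      then have s: "1 / 2 \<le> s" "s < 1" by auto
      have Cs: "C s > 0" using C s by simp
      have "is_arg_min (J_frac \<Omega> K y C \<alpha> s) (\<lambda>v. v \<in> L2 \<Omega>) (u_frac s)"
        using assms(7)[of s] s by (simp add: is_unique_minimizer_def)
      note J = J_frac_minimizer[OF K \<Omega>(1) y \<alpha> s Cs this]
      let ?u = "u_frac s"
      note uH = J(1)
      define w where "w = (\<lambda>x. ?u x + (-1) * \<psi> x)"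
      have wH: "w \<in> H0s s \<Omega>" unfolding w_def by (rule H0s_add[OF uH test_H0s[OF \<psi>(1) s]])
      note wL = H0s_L2[OF wH] and wHs = H0s_Hs[OF wH]
      have uw: "?u = (\<lambda>x. \<psi> x + 1 * w x)" by (auto simp: w_def)
      note \<psi>H = test_functions_Hs[OF \<psi>U s] and \<phi>H = test_functions_Hs[OF \<phi>(1) s] and dH = test_functions_Hs[OF dU s]
      let ?N = "nrm w"
      have N: "?N \<ge> 0" by simp
      have eq: "ip (\<lambda>x. K ?u x - y x) (K w) + \<alpha> * (ip ?u w + C s / 2 * gag s ?u w) = 0" by (rule J(2)[OF wH])
      have e1: "ip ?u w = ip \<psi> w + ?N\<^sup>2"
        unfolding uw using ip_add_left[OF \<psi>L L2_cmult[OF wL] wL, of 1] by (simp add: nrm_sq)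
      have e2: "gag s ?u w = gag s \<psi> w + gag s w w"
        using gag_add_left[OF \<psi>H wHs wHs, of 1] unfolding uw by simp
      have e3: "gag s \<psi> w = gag s w \<phi> + gag s ?d w"
      proof -
        have "gag s (\<lambda>x. ?d x + 1 * \<phi> x) w = gag s ?d w + 1 * gag s \<phi> w" by (rule gag_add_left[OF dH \<phi>H wHs])
        moreover have "(\<lambda>x. ?d x + 1 * \<phi> x) = \<psi>" by auto
        ultimately show ?thesis by (simp add: gag_commute[of s \<phi> w])
      qed
      let ?q = "\<lambda>x. \<psi> x - u_one x"
      have qL: "?q \<in> L2 \<Omega>" by (rule L2_diff[OF \<psi>L uL])
      have qn: "nrm ?q \<le> \<epsilon>" using \<psi>(2) nrm_minus_commute[of \<psi> u_one] by simp
      have ae: "AE x in lborel. K ?u x - y x = ?r x + (K ?q x + K w x)"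
      proof -
        have "AE x in lborel. K (\<lambda>x. \<psi> x + 1 * w x) x = K \<psi> x + 1 * K w x" by (rule Klin[OF \<psi>L wL])
        moreover have "AE x in lborel. K (\<lambda>x. u_one x + 1 * ?q x) x = K u_one x + 1 * K ?q x" by (rule Klin[OF uL qL])
        moreover have "(\<lambda>x. u_one x + 1 * ?q x) = \<psi>" by auto
        ultimately show ?thesis unfolding uw[symmetric] by (auto elim!: eventually_elim2)
      qed
      note KqL = KL[OF qL] and KwL = KL[OF wL]
      have e4: "ip (\<lambda>x. K ?u x - y x) (K w) = ip ?r (K w) + ip (K ?q) (K w) + (nrm (K w))\<^sup>2"
      proof -
        note L = L2_diff[OF KL[OF H0s_L2[OF uH]] y] L2_add[OF rL L2_add[OF KqL KwL]]
        have "ip (\<lambda>x. K ?u x - y x) (K w) = ip (\<lambda>x. ?r x + (K ?q x + K w x)) (K w)"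
          by (rule ip_cong_AE[OF ae]) (use L2_measurable[OF L(1)] L2_measurable[OF L(2)] L2_measurable[OF KwL] in simp_all)
        also have "\<dots> = ip ?r (K w) + (ip (K ?q) (K w) + ip (K w) (K w))"
          unfolding ip_add_left[OF rL L2_add[OF KqL KwL] KwL] ip_add_left[OF KqL KwL KwL] ..
        finally show ?thesis by (simp add: nrm_sq)
      qed
      have lw: "ip ?r (K w) = \<alpha> * l w - \<alpha> * ip u_one w" using \<alpha> by (simp add: l_def algebra_simps)
      have e5: "ip \<psi> w = ip u_one w + ip ?q w" using ip_diff_left[OF \<psi>L uL wL] by simp
      \<comment> \<open>The equation for \<open>?u\<close>, tested with w. The terms with
        \<open>u_one\<close> cancel, and from the residual of \<open>u_one\<close> only
        \<open>l w\<close> survives; the pairing with \<open>\<phi>\<close> will compensate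
        it.\<close>
      have "(nrm (K w))\<^sup>2 + ip (K ?q) (K w)
          + \<alpha> * (l w + ip ?q w + ?N\<^sup>2 + C s / 2 * gag s w \<phi> + C s / 2 * gag s ?d w + C s / 2 * gag s w w) = 0"
        using eq unfolding e1 e2 e3 e4 e5 lw by (simp add: algebra_simps)
      moreover have "- (B\<^sup>2 * \<epsilon> * ?N) \<le> ip (K ?q) (K w)"
      proof -
        have "\<bar>ip (K ?q) (K w)\<bar> \<le> nrm (K ?q) * nrm (K w)" by (rule ip_Cauchy_Schwarz[OF KqL KwL])
        also have "\<dots> \<le> (B * \<epsilon>) * (B * ?N)"
          using B(2)[OF qL] B(2)[OF wL] mult_left_mono[OF qn B(1)] B(1) e by (intro mult_mono) auto
        finally show ?thesis by (simp add: power2_eq_square mult_ac)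
      qed
      moreover have "(nrm (K w))\<^sup>2 \<ge> 0" by simp
      moreover have "- (\<epsilon> * ?N) \<le> ip ?q w"
      proof -
        have "\<bar>ip ?q w\<bar> \<le> nrm ?q * ?N" by (rule ip_Cauchy_Schwarz[OF qL wL])
        also have "\<dots> \<le> \<epsilon> * ?N" by (rule mult_right_mono[OF qn N])
        finally show ?thesis by simp
      qed
      \<comment> \<open>One \<epsilon> comes from the distance of the Laplacian of
        \<open>\<phi>\<close> to \<open>l\<close>, the other from the choice of s close to
        1.\<close>
      moreover have "- l w - 2 * \<epsilon> * ?N \<le> C s / 2 * gag s w \<phi>"
      proof -
        let ?L = "ip w (Lap \<phi>)"
        have L1: "\<bar>?L - l w\<bar> \<le> \<epsilon> * ?N" using \<phi>(3)[OF wL] by (simp add: ip_commute[of w])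
        have "\<bar>?L\<bar> \<le> ?N * nrm (Lap \<phi>)" by (rule ip_Cauchy_Schwarz[OF wL test_functions_L2[OF Lap_test_functions[OF \<phi>(1)]]])
        then have "\<bar>?m s - 1\<bar> * \<bar>?L\<bar> \<le> \<bar>?m s - 1\<bar> * (?N * nrm (Lap \<phi>))" by (rule mult_left_mono) simp
        then have L2: "\<bar>?m s * ?L - ?L\<bar> \<le> \<bar>?m s - 1\<bar> * nrm (Lap \<phi>) * ?N"
          by (simp add: abs_mult[symmetric] algebra_simps)
        have L3: "\<bar>C s / 2 * gag s w \<phi> + ?m s * ?L\<bar> \<le> ?m s * (k * defect s) * ?N" by (rule k(2)[OF s wHs])
        have "(\<bar>?m s - 1\<bar> * nrm (Lap \<phi>) + ?m s * (k * defect s)) * ?N \<le> \<epsilon> * ?N"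
          using elim(2) by (intro mult_right_mono) auto
        then have L4: "\<bar>?m s - 1\<bar> * nrm (Lap \<phi>) * ?N + ?m s * (k * defect s) * ?N \<le> \<epsilon> * ?N" by (simp add: distrib_right)
        show ?thesis using L1 L2 L3 L4 by linarith
      qed
      \<comment> \<open>The cross term takes at most half of the energy of w, which is still
        available in full; the half that remains is nonnegative and dropped.\<close>
      moreover have "- (energy C s ?d / 2) \<le> C s / 2 * gag s ?d w + C s / 2 * gag s w w"
      proof -
        have "C s / 2 * (- gag s ?d w) \<le> C s / 2 * ((gag s ?d ?d + gag s w w) / 2)"
          using Cs by (intro mult_left_mono gag_lower dH wHs) simp
        moreover have "C s / 2 * gag s w w \<ge> 0" using Cs gag_self_nonneg[of s w] by simp
        ultimately show ?thesis unfolding energy_gag by (simp add: add_divide_distrib distrib_left)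
      qed
      ultimately have "\<alpha> * (?N\<^sup>2 - 3 * \<epsilon> * ?N - energy C s ?d / 2) \<le> B\<^sup>2 * \<epsilon> * ?N"
      proof -
        assume A: "(nrm (K w))\<^sup>2 + ip (K ?q) (K w)
            + \<alpha> * (l w + ip ?q w + ?N\<^sup>2 + C s / 2 * gag s w \<phi> + C s / 2 * gag s ?d w + C s / 2 * gag s w w) = 0"
          and A1: "- (B\<^sup>2 * \<epsilon> * ?N) \<le> ip (K ?q) (K w)" "(nrm (K w))\<^sup>2 \<ge> 0"
          and A2: "- (\<epsilon> * ?N) \<le> ip ?q w" "- l w - 2 * \<epsilon> * ?N \<le> C s / 2 * gag s w \<phi>"
            "- (energy C s ?d / 2) \<le> C s / 2 * gag s ?d w + C s / 2 * gag s w w"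
        have "\<alpha> * (?N\<^sup>2 - 3 * \<epsilon> * ?N - energy C s ?d / 2)
            \<le> \<alpha> * (l w + ip ?q w + ?N\<^sup>2 + C s / 2 * gag s w \<phi> + C s / 2 * gag s ?d w + C s / 2 * gag s w w)"
          using A2 \<alpha> by (intro mult_left_mono) linarith+
        also have "\<dots> \<le> B\<^sup>2 * \<epsilon> * ?N" using A A1 by linarith
        finally show ?thesis .
      qed
      then have "?N\<^sup>2 - 3 * \<epsilon> * ?N - energy C s ?d / 2 \<le> B\<^sup>2 * \<epsilon> * ?N / \<alpha>"
        using \<alpha> by (simp add: pos_le_divide_eq mult.commute)
      moreover have "energy C s ?d / 2 \<le> c * \<epsilon>\<^sup>2"
      proof -
        have "energy C s ?d \<le> (4 * real CARD('n) + 1) * \<epsilon>\<^sup>2" using elim(1) E by (simp add: distrib_right)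
        also have "\<dots> \<le> (2 * c) * \<epsilon>\<^sup>2" unfolding c_def by (intro mult_right_mono) auto
        finally show ?thesis by simp
      qed
      ultimately have "?N\<^sup>2 \<le> a * \<epsilon> * ?N + c * \<epsilon>\<^sup>2" by (simp add: a_def algebra_simps)
      then have NN: "?N \<le> (a + c) * \<epsilon>" by (rule quadratic_bound[OF _ a c e])
      have uf: "(\<lambda>x. ?u x - u_one x) \<in> L2 \<Omega>" by (rule L2_diff[OF H0s_L2[OF uH] uL])
      have "(\<lambda>x. ?u x - u_one x) = (\<lambda>x. w x + ?q x)" by (auto simp: w_def)
      then have "L2_norm \<Omega> (\<lambda>x. ?u x - u_one x) = nrm (\<lambda>x. w x + ?q x)"
        using L2_norm_eq_nrm[OF \<Omega>b uf] by simp
      also have "\<dots> \<le> ?N + nrm ?q" by (rule nrm_triangle[OF wL qL])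
      also have "\<dots> \<le> (a + c + 1) * \<epsilon>" using NN qn by (simp add: distrib_right)
      finally show ?case .
    qed
  qed
  show ?thesis
  proof (rule tendstoI)
    fix \<epsilon> :: real assume e: "\<epsilon> > 0"
    \<comment> \<open>The factor 2 turns the non-strict bound of \<open>main\<close> into a strict
      one.\<close>
    define \<epsilon>' where "\<epsilon>' = \<epsilon> / (2 * (a + c + 1))"
    have p: "a + c + 1 > 0" using a c by linarith
    have "\<epsilon>' > 0" using e p by (simp add: \<epsilon>'_def)
    from main[OF this] show "\<forall>\<^sub>F s in at_left 1. dist (L2_norm \<Omega> (\<lambda>x. u_frac s x - u_one x)) 0 < \<epsilon>"
    proof eventually_elim
      case (elim s)
      have "D * (\<epsilon> / (2 * D)) = \<epsilon> / 2" if "D > 0" for D using that by simp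
      from this[OF p] have "(a + c + 1) * \<epsilon>' = \<epsilon> / 2" unfolding \<epsilon>'_def .
      moreover have "L2_norm \<Omega> (\<lambda>x. u_frac s x - u_one x) \<ge> 0"
        unfolding L2_norm_def set_lebesgue_integral_def by (intro real_sqrt_ge_zero integral_nonneg_AE) simp
      ultimately show ?case using elim e by (simp add: dist_real_def)
    qed
  qed
qed


end
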